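(* Let $k\ge2$ be a constant. A $T(n)$ time algorithm for $k$-LCS with alphabet size $O(k)$ implies a $\tilde{O}(T(n))$ time algorithm for F$k$-OV.
   Context: $k$-LCS: given $k$ sequences of length $n$ over an alphabet $\Sigma$, compute the length of the longest sequence that appears as a subsequence of every one of them. F$k$-OV: with $g=o(\lg n/\lg\lg n)$, $b=o(\lg n)$, a $(g,b)$-factored vector is a $g$-tuple of sets $v[i]\subseteq\{0,1\}^b$; given $k$ sets $V_1,\dots,V_k$ of $n$ factored vectors each, decide whether there are $v_1\in V_1,\dots,v_k\in V_k$ such that for every $i\in\{1,\dots,g\}$ there exist $w_1\in v_1[i],\dots,w_k\in v_k[i]$ with $\sum_{a=1}^b\prod_{j=1}^k w_j[a]=0$. *)

theory Defs
  imports
    Complex_Main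
    "HOL-Library.Sublist"
    "HOL-Library.Landau_Symbols"
    "HOL-Library.Discrete_Functions"
begin

unbundle bit_operations_syntax

section \<open>A word RAM\<close>

text \<open>
  A machine word is a natural number below \<open>2 ^ w\<close>, where \<open>w\<close> is the word size. A program mentions
  finitely many registers and finitely many arrays, all of them named statically; array cells are
  addressed by the content of a register. (Several arrays instead of one memory change running times
  by a constant factor only, by interleaving; the same holds for structured control flow instead
  of jumps, with the program counter held in a register.)
\<close>

datatype operation = Add | Sub | Mul | Div | Mod | And | Or | Xor | Shl | Shr

text \<open>Arithmetic is modulo \<open>2 ^ w\<close>; division by zero follows the HOL conventions.\<close>

fun apply_op :: "nat \<Rightarrow> operation \<Rightarrow> nat \<Rightarrow> nat \<Rightarrow> nat" where
  "apply_op w Add x y = (x + y) mod 2 ^ w"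
| "apply_op w Sub x y = (x + 2 ^ w - y) mod 2 ^ w"
| "apply_op w Mul x y = (x * y) mod 2 ^ w"
| "apply_op w Div x y = x div y"
| "apply_op w Mod x y = x mod y"
| "apply_op w And x y = x AND y"
| "apply_op w Or x y = x OR y"
| "apply_op w Xor x y = x XOR y"
| "apply_op w Shl x y = (x * 2 ^ y) mod 2 ^ w"
| "apply_op w Shr x y = x div 2 ^ y"

datatype test = Eq nat nat | Less nat nat

datatype program =
    Skip
  | Const nat nat                \<comment> \<open>\<open>Const r c\<close>: \<open>r := c\<close>\<close>
  | Op operation nat nat nat     \<comment> \<open>\<open>Op f r p q\<close>: \<open>r := f p q\<close>\<close>
  | Load nat nat nat             \<comment> \<open>\<open>Load r a p\<close>: \<open>r := a[p]\<close>\<close>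
  | Store nat nat nat            \<comment> \<open>\<open>Store a p r\<close>: \<open>a[p] := r\<close>\<close>
  | Seq program program
  | If test program program
  | While test program

record state =
  reg :: "nat \<Rightarrow> nat"
  mem :: "nat \<Rightarrow> nat \<Rightarrow> nat"

fun holds :: "test \<Rightarrow> state \<Rightarrow> bool" where
  "holds (Eq p q) s \<longleftrightarrow> reg s p = reg s q"
| "holds (Less p q) s \<longleftrightarrow> reg s p < reg s q"

text \<open>
  \<open>exec w P s t s'\<close>: with word size \<open>w\<close>, program \<open>P\<close> started in \<open>s\<close> halts in \<open>s'\<close> after
  exactly \<open>t\<close> steps. Every elementary instruction and every evaluation of a test is one step.
\<close>

inductive exec :: "nat \<Rightarrow> program \<Rightarrow> state \<Rightarrow> nat \<Rightarrow> state \<Rightarrow> bool" for w :: nat where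
  Skip: "exec w Skip s 1 s"
| Const: "exec w (Const r c) s 1 (s\<lparr>reg := (reg s)(r := c mod 2 ^ w)\<rparr>)"
| Op: "exec w (Op f r p q) s 1 (s\<lparr>reg := (reg s)(r := apply_op w f (reg s p) (reg s q))\<rparr>)"
| Load: "exec w (Load r a p) s 1 (s\<lparr>reg := (reg s)(r := mem s a (reg s p))\<rparr>)"
| Store: "exec w (Store a p r) s 1 (s\<lparr>mem := (mem s)(a := (mem s a)(reg s p := reg s r))\<rparr>)"
| Seq: "exec w P s t s' \<Longrightarrow> exec w Q s' u s'' \<Longrightarrow> exec w (Seq P Q) s (t + u) s''"
| IfTrue: "holds b s \<Longrightarrow> exec w P s t s' \<Longrightarrow> exec w (If b P Q) s (1 + t) s'"
| IfFalse: "\<not> holds b s \<Longrightarrow> exec w Q s t s' \<Longrightarrow> exec w (If b P Q) s (1 + t) s'"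
| WhileFalse: "\<not> holds b s \<Longrightarrow> exec w (While b P) s 1 s"
| WhileTrue: "holds b s \<Longrightarrow> exec w P s t s' \<Longrightarrow> exec w (While b P) s' u s'' \<Longrightarrow>
    exec w (While b P) s (1 + t + u) s''"

lemma exec_deterministic:
  "exec w P s t s' \<Longrightarrow> exec w P s u s'' \<Longrightarrow> u = t \<and> s'' = s'"
proof (induction arbitrary: u s'' rule: exec.induct)
  case (Seq P s t s' Q v s3)
  from Seq.prems show ?case by cases (use Seq.IH in blast)
next
  case (IfTrue b s P t s' Q)
  from IfTrue.prems show ?case by cases (use IfTrue in blast)+
next
  case (IfFalse b s Q t s' P)
  from IfFalse.prems show ?case by cases (use IfFalse in blast)+
next
  case (WhileFalse b s P)
  from WhileFalse.prems show ?case by cases (use WhileFalse in blast)+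
next
  case (WhileTrue b s P t s' v s3)
  from WhileTrue.prems show ?case by cases (use WhileTrue in blast)+
qed (auto elim: exec.cases)

text \<open>The input is in array 0; all other cells and all registers are initially 0.\<close>

definition initial_state :: "nat list \<Rightarrow> state" where
  "initial_state xs = \<lparr>reg = (\<lambda>_. 0),
     mem = (\<lambda>a i. if a = 0 \<and> i < length xs then xs ! i else 0)\<rparr>"


section \<open>Problems and running times\<close>

text \<open>
  For every value \<open>n\<close> of the size parameter, the set of pairs of an encoded instance and its answer.
\<close>

type_synonym problem = "nat \<Rightarrow> (nat list \<times> nat) set"

text \<open>
  \<open>solvable_in_time Q T\<close>: there is a \<open>T(n)\<close> time algorithm for \<open>Q\<close> in the word RAM with words of
  \<open>O(log n)\<close> bits. Precisely, words have \<open>c\<close> times as many bits as the binary representation of \<open>n\<close>,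
  where the constant \<open>c\<close> belongs to the algorithm and has to be such that the input words
  and the addresses of the input cells are words. The answer is left in register 0.
\<close>

definition word_size :: "nat \<Rightarrow> nat \<Rightarrow> nat" where
  "word_size c n = c * (floor_log n + 1)"

definition solvable_in_time :: "problem \<Rightarrow> (nat \<Rightarrow> nat) \<Rightarrow> bool" where
  "solvable_in_time Q T \<longleftrightarrow> (\<exists>P c. \<forall>n. \<forall>(xs, y) \<in> Q n.
     (\<forall>x \<in> set xs. x < 2 ^ word_size c n) \<and> length xs \<le> 2 ^ word_size c n \<and>
     (\<exists>t s. exec (word_size c n) P (initial_state xs) t s \<and> t \<le> T n \<and> reg s 0 = y))"

text \<open>
  The class \<open>\<tilde>O(T)\<close>, hiding subpolynomial factors \<open>n\<^sup>o\<^sup>(\<^sup>1\<^sup>)\<close>. (Hiding only polylogarithmic factors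
  would not do for F\<open>k\<close>-OV: since \<open>2 ^ b\<close> may be any subpolynomial function of \<open>n\<close>, an
  instance of F\<open>k\<close>-OV can have size \<open>n\<close> times a factor that is subpolynomial but not polylogarithmic.)
\<close>

definition soft_O :: "(nat \<Rightarrow> nat) \<Rightarrow> (nat \<Rightarrow> nat) set" where
  "soft_O T = {t. \<exists>e :: nat \<Rightarrow> real. e \<longlonglongrightarrow> 0 \<and>
     (\<lambda>n. real (t n)) \<in> O(\<lambda>n. real (T n) * real n powr e n)}"


section \<open>\<open>k\<close>-LCS\<close>

definition lcs_length :: "'a list list \<Rightarrow> nat" where
  "lcs_length ss = Max {length z | z. \<forall>s \<in> set ss. subseq z s}"

text \<open>The alphabet of size \<open>\<sigma>\<close> is \<open>{..<\<sigma>}\<close>.\<close>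

definition k_LCS :: "nat \<Rightarrow> nat \<Rightarrow> problem" where
  "k_LCS k \<sigma> n = {(n # concat ss, lcs_length ss) | ss.
     length ss = k \<and> (\<forall>s \<in> set ss. length s = n \<and> set s \<subseteq> {..<\<sigma>})}"


section \<open>F\<open>k\<close>-OV\<close>

definition cube :: "nat \<Rightarrow> nat list set" where
  "cube b = {w. length w = b \<and> set w \<subseteq> {0, 1}}"

type_synonym factored_vector = "nat list set list"

definition factored_vectors :: "nat \<Rightarrow> nat \<Rightarrow> factored_vector set" where
  "factored_vectors g b = {v. length v = g \<and> (\<forall>S \<in> set v. S \<subseteq> cube b)}"

definition FOV_yes :: "nat \<Rightarrow> nat \<Rightarrow> nat \<Rightarrow> (nat \<Rightarrow> factored_vector set) \<Rightarrow> bool" where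
  "FOV_yes k g b V \<longleftrightarrow> (\<exists>v. (\<forall>j<k. v j \<in> V j) \<and>
     (\<forall>i<g. \<exists>w. (\<forall>j<k. w j \<in> v j ! i) \<and> (\<Sum>a<b. \<Prod>j<k. w j ! a) = 0))"

text \<open>
  A set \<open>S \<subseteq> {0,1}\<^sup>b\<close> is encoded by its characteristic function, tabulated in \<open>2 ^ b\<close> words; the position
  of a vector in the table is the number with these binary digits, least significant first.
\<close>

definition encode_set :: "nat \<Rightarrow> nat list set \<Rightarrow> nat list" where
  "encode_set b S = map (\<lambda>p. of_bool (map (\<lambda>a. p div 2 ^ a mod 2) [0..<b] \<in> S)) [0..<2 ^ b]"

definition encode_factored_vector :: "nat \<Rightarrow> factored_vector \<Rightarrow> nat list" where
  "encode_factored_vector b v = concat (map (encode_set b) v)"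

text \<open>Each of the \<open>k\<close> sets is presented by a list of its \<open>n\<close> elements, in any order.\<close>

definition Fk_OV :: "nat \<Rightarrow> (nat \<Rightarrow> nat) \<Rightarrow> (nat \<Rightarrow> nat) \<Rightarrow> problem" where
  "Fk_OV k g b n =
     {(n # g n # b n # concat (map (encode_factored_vector (b n)) (concat Vs)),
       of_bool (FOV_yes k (g n) (b n) (\<lambda>j. set (Vs ! j)))) | Vs.
      length Vs = k \<and>
      (\<forall>V \<in> set Vs. length V = n \<and> distinct V \<and> set V \<subseteq> factored_vectors (g n) (b n))}"

end

theory Submission
  imports Defs
begin

text \<open>
  In coordinate \<open>i\<close>, suitable \<open>w\<^sub>j \<in> v\<^sub>j[i]\<close> exist iff there is a number \<open>t < R = 2\<^bsup>bk\<^esup>\<close> whose \<open>k\<close> digits in base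
  \<open>2\<^sup>b\<close>, read as elements of \<open>{0,1}\<^sup>b\<close>, are orthogonal and belong to the respective sets; for fixed \<open>t\<close> this is a
  conjunction of conditions on the single vectors. In the gadgets of a \<open>k\<close>-tuple of vectors, one string is a list of
  one-hot tables for the pairs \<open>(i, t)\<close>, the other strings consist of one table for each \<open>i\<close>, and a long common
  subsequence has to match each of these with one entry of the list. On the next level, a string with \<open>m\<close> gadgets is
  shifted along lists of \<open>3m\<close> gadgets.
  On both levels every string has separator symbols of its own that the other strings contain in abundance, and
  which are lost whenever a common subsequence tears a gadget apart.

  Each gadget has length \<open>n\<^sup>o\<^sup>(\<^sup>1\<^sup>)\<close>. In order to get by with strings of length exactly \<open>n\<close> (nothing is known
  about the growth of \<open>T\<close>), the lists of vectors are cut into \<open>n\<^sup>o\<^sup>(\<^sup>1\<^sup>)\<close> blocks, and the LCS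
  algorithm is run on all \<open>k\<close>-tuples of blocks. Writing the strings takes time \<open>n\<^sup>1\<^sup>+\<^sup>o\<^sup>(\<^sup>1\<^sup>)\<close> in total, which is
  absorbed because any algorithm for \<open>k\<close>-LCS has to read its input.
\<close>

section \<open>Strings made of gadgets and separators\<close>

text \<open>An LCS length only reports a maximum, so all losing configurations need one common score
  that a winning one exceeds. Within a gadget, every coordinate with a witness earns one extra
  letter; if some coordinate has none, the score drops below \<open>inner_high\<close>, but by an
  amount that depends on the tuple. Filler of length \<open>low = inner_high - 1\<close> evens this
  out: a gadget of string 0 can always earn \<open>low\<close>, and it earns \<open>low + 1\<close>
  only from an orthogonal tuple. A single good tuple is thus visible as an excess of one. Choices
  are expressed by shifting strings, and a shift must not change the number of separators that can
  be matched. Therefore \<open>sep l\<close> is scarce in string \<open>l\<close> only: there it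
  follows just the active slots, while every other string has it after every slot, and inactive
  slots absorb the shifts. This takes \<open>k - 1\<close> letters on each of the two levels, whence
  an alphabet of size \<open>O(k)\<close>. String 0 has no letter of its own, because the upper
  bound is charged to its slots.\<close>

lemma subseq_concat_map:
  assumes "\<And>x. x \<in> set xs \<Longrightarrow> subseq (f x) (h x)"
  shows "subseq (concat (map f xs)) (concat (map h xs))"
  using assms by (induction xs) (auto intro!: list_emb_append_mono)

lemma subseq_concat_map_subseq:
  assumes "subseq xs ys"
  shows "subseq (concat (map h xs)) (concat (map h ys))"
  using assms by induction (auto intro: list_emb_append_mono subseq_drop_many)

lemma subseq_filter_right:
  assumes "subseq z x" and "\<And>a. a \<in> set z \<Longrightarrow> P a"
  shows "subseq z (filter P x)"
  using subseq_filter[OF assms(1), of P] assms(2) by (simp add: filter_id_conv)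

lemma subseq_set: "subseq xs ys \<Longrightarrow> set xs \<subseteq> set ys"
  by (induction rule: list_emb.induct) auto

lemma count_list_subseq: "subseq xs ys \<Longrightarrow> count_list xs a \<le> count_list ys a"
  by (induction rule: list_emb.induct) auto

lemma count_list_replicate: "count_list (replicate n a) b = (if a = b then n else 0)"
  by (induction n) auto

lemma sum_count_list:
  assumes "inj_on f L" "finite L" "set xs \<subseteq> f ` L"
  shows "(\<Sum>l\<in>L. count_list xs (f l)) = length xs"
  using assms(3)
proof (induction xs)
  case (Cons x xs)
  obtain l where l: "l \<in> L" "x = f l" using Cons.prems by auto
  have eq: "count_list (x # xs) (f i) = count_list xs (f i) + (if i = l then 1 else 0)" if "i \<in> L" for i
    using that l assms(1) by (auto simp: inj_on_def)
  have "(\<Sum>i\<in>L. count_list (x # xs) (f i)) = (\<Sum>i\<in>L. count_list xs (f i)) + (\<Sum>i\<in>L. if i = l then 1 else 0)"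
    by (simp add: eq sum.distrib del: count_list.simps)
  also have "(\<Sum>i\<in>L. if i = l then 1 else (0::nat)) = 1"
    using l assms(2) by simp
  finally show ?case using Cons by simp
qed simp

definition separators :: "nat \<Rightarrow> (nat \<Rightarrow> nat) \<Rightarrow> nat \<Rightarrow> (nat \<Rightarrow> bool) \<Rightarrow> nat list" where
  "separators k sep w ok = concat (map (\<lambda>l. if ok l then replicate w (sep l) else []) [1..<k])"

definition slot :: "nat \<Rightarrow> (nat \<Rightarrow> nat) \<Rightarrow> nat \<Rightarrow> (nat \<Rightarrow> nat \<Rightarrow> bool) \<Rightarrow> (nat \<Rightarrow> nat \<Rightarrow> nat list)
    \<Rightarrow> nat \<Rightarrow> nat \<Rightarrow> nat list" where
  "slot k sep w act C j u = C j u @ separators k sep w (\<lambda>l. l \<noteq> j \<or> act l u)"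

definition slots :: "nat \<Rightarrow> (nat \<Rightarrow> nat) \<Rightarrow> nat \<Rightarrow> (nat \<Rightarrow> nat \<Rightarrow> bool) \<Rightarrow> (nat \<Rightarrow> nat \<Rightarrow> nat list)
    \<Rightarrow> nat \<Rightarrow> nat \<Rightarrow> nat list" where
  "slots k sep w act C U j = concat (map (slot k sep w act C j) [0..<U])"

lemma set_separators: "set (separators k sep w ok) \<subseteq> sep ` {1..<k}"
  by (auto simp: separators_def split: if_splits)

lemma count_separators:
  assumes "inj_on sep {1..<k}" "l \<in> {1..<k}"
  shows "count_list (separators k sep w ok) (sep l) = (if ok l then w else 0)"
proof -
  have "count_list (concat (map (\<lambda>l. if ok l then replicate w (sep l) else []) ls)) (sep l)
      = (if ok l \<and> l \<in> set ls then w else 0)" if "distinct ls" "set ls \<subseteq> {1..<k}" for ls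
    using that
  proof (induction ls)
    case (Cons a ls)
    then have "a \<in> {1..<k}" by simp
    then have "sep a = sep l \<longleftrightarrow> a = l" using assms by (auto simp: inj_on_def)
    then show ?case using Cons by (auto simp: count_list_replicate)
  qed simp
  from this[of "[1..<k]"] show ?thesis using assms(2) by (simp add: separators_def)
qed

lemma subseq_separators:
  "(\<And>l. ok l \<Longrightarrow> ok' l) \<Longrightarrow> subseq (separators k sep w ok) (separators k sep w ok')"
  unfolding separators_def by (rule subseq_concat_map) auto

lemma length_separators: "length (separators k sep w ok) = w * card {l\<in>{1..<k}. ok l}"
proof -
  have "length (concat (map (\<lambda>l. if ok l then replicate w (sep l) else []) ls))
      = w * card {l\<in>set ls. ok l}" if "distinct ls" for ls
    using that
  proof (induction ls)
    case (Cons a ls)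
    have "{l \<in> set (a # ls). ok l} = (if ok a then insert a {l \<in> set ls. ok l} else {l \<in> set ls. ok l})"
      by auto
    with Cons show ?case by auto
  qed simp
  from this[of "[1..<k]"] show ?thesis by (simp add: separators_def)
qed

text \<open>A slot of string \<open>j\<close> with nonempty content is active, so its content is
  followed by \<open>w\<close> copies of \<open>sep j\<close>. A factor that meets the contents of
  two slots contains the whole block after the first of them; with fewer than \<open>w\<close>
  copies, all its other letters come from a single slot.\<close>

lemma slots_factor:
  assumes inj: "inj_on sep {1..<k}" and j: "j \<in> {1..<k}"
    and pure: "\<And>u. set (C j u) \<inter> sep ` {1..<k} = {}"
    and act: "\<And>u. C j u \<noteq> [] \<Longrightarrow> act j u"
    and X: "concat (map (slot k sep w act C j) us) = P @ B @ Q"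
    and cnt: "count_list B (sep j) < w"
  shows "filter (\<lambda>x. x \<notin> sep ` {1..<k}) B = [] \<or>
    (\<exists>u\<in>set us. subseq (filter (\<lambda>x. x \<notin> sep ` {1..<k}) B) (C j u))"
  using X cnt
proof (induction us arbitrary: P B Q)
  case Nil
  then show ?case by simp
next
  case (Cons u us)
  let ?f = "filter (\<lambda>x. x \<notin> sep ` {1..<k})"
  define S where "S = separators k sep w (\<lambda>l. l \<noteq> j \<or> act l u)"
  have fS: "?f S = []"
    using set_separators[of k sep w "\<lambda>l. l \<noteq> j \<or> act l u"] by (auto simp: S_def filter_empty_conv)
  have fC: "?f (C j u) = C j u"
    using pure[of u] by (auto simp: filter_id_conv)
  let ?rest = "concat (map (slot k sep w act C j) us)"
  have eq: "(C j u @ S) @ ?rest = P @ B @ Q"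
    unfolding S_def using Cons.prems(1) by (subst (asm) list.map, subst (asm) concat.simps, subst (asm) slot_def)
  from eq consider (a) P' where "P = (C j u @ S) @ P'" "?rest = P' @ B @ Q"
    | (b) D where "C j u @ S = P @ D" "D @ ?rest = B @ Q"
    unfolding append_eq_append_conv2[of "C j u @ S"] by blast
  then show ?case
  proof cases
    case a
    from Cons.IH[OF a(2) Cons.prems(2)] show ?thesis by auto
  next
    case b
    from b(2) consider (c) E where "D = B @ E" "E @ ?rest = Q" | (d) B' where "B = D @ B'" "?rest = B' @ Q"
      by (auto simp: append_eq_append_conv2)
    then show ?thesis
    proof cases
      case c
      then have "C j u @ S = P @ B @ E" using b by simp
      then have "C j u = ?f P @ ?f B @ ?f E"
        using fS fC by (metis append.right_neutral filter_append)
      then have "subseq (?f B) (C j u)" by (metis sublist_appendI sublist_imp_subseq)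
      then show ?thesis by auto
    next
      case d
      have IH: "?f B' = [] \<or> (\<exists>u\<in>set us. subseq (?f B') (C j u))"
        using Cons.IH[of "[]" B' Q] d Cons.prems(2) by auto
      \<comment> \<open>\<open>B\<close> continues beyond this slot, so \<open>D\<close> is a suffix
        of the slot. If \<open>D\<close> reached back into nonempty content, it would contain all
        \<open>w\<close> copies of \<open>sep j\<close>; hence it consists of separators
        only.\<close>
      have "?f D = []"
      proof (cases "C j u = []")
        case True
        then have "S = P @ D" using b by simp
        then show ?thesis using fS by (metis append_is_Nil_conv filter_append)
      next
        case False
        then have "count_list S (sep j) = w"
          using act[of u] count_separators[OF inj j] by (simp add: S_def)
        moreover have "count_list D (sep j) < w" using Cons.prems(2) d by simp
        ultimately have "\<not> suffix S D" by (auto simp: suffix_def)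
        from b(1) obtain E where "C j u @ E = P \<and> S = E @ D \<or> C j u = P @ E \<and> D = E @ S"
          by (auto simp: append_eq_append_conv2)
        with \<open>\<not> suffix S D\<close> have "S = E @ D" by (auto simp: suffix_def)
        then show ?thesis using fS by (metis append_is_Nil_conv filter_append)
      qed
      then show ?thesis using d IH by auto
    qed
  qed
qed

text \<open>
  A piece of a common subsequence that comes from one gadget of string 0 either stays within one
  gadget of every other string \<open>j\<close>, or skips a whole block of \<open>w\<close> separators \<open>sep j\<close> of some string \<open>j\<close>;
  in the latter case the lost separators pay for the whole gadget of string 0.
\<close>

lemma slots_upper_aux:
  fixes X :: "nat \<Rightarrow> nat list"
  assumes inj: "inj_on sep {1..<k}"
    and pure0: "\<And>u. set (C 0 u) \<inter> sep ` {1..<k} = {}"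
    and bound: "\<And>u y. \<lbrakk>u \<in> set us; subseq y (C 0 u); \<And>j. j \<in> {1..<k} \<Longrightarrow> y = [] \<or> (\<exists>u'<U. subseq y (C j u'))\<rbrakk>
       \<Longrightarrow> length y \<le> c u"
    and heavy: "\<And>u. u \<in> set us \<Longrightarrow> length (C 0 u) \<le> c u + w"
    and good: "\<And>j P B Q. \<lbrakk>j \<in> {1..<k}; X j = P @ B @ Q; count_list B (sep j) < w\<rbrakk> \<Longrightarrow>
       filter (\<lambda>x. x \<notin> sep ` {1..<k}) B = [] \<or>
         (\<exists>u<U. subseq (filter (\<lambda>x. x \<notin> sep ` {1..<k}) B) (C j u))"
    and z0: "subseq z (concat (map (slot k sep w act C 0) us))"
    and zj: "\<And>j. j \<in> {1..<k} \<Longrightarrow> subseq z (X j)"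
  shows "length z \<le> (\<Sum>u\<leftarrow>us. c u) + (\<Sum>l\<in>{1..<k}. count_list (X l) (sep l))"
  using bound heavy good z0 zj
\<comment> \<open>The induction removes slots from string 0, while the other strings are cut at
  arbitrary places. They are therefore arbitrary lists \<open>X j\<close> of which only a property
  of factors is known, and this passes to suffixes.\<close>
proof (induction us arbitrary: z X)
  case Nil
  from Nil.prems(4) have "z = []" by simp
  then show ?case by simp
next
  case (Cons u us)
  let ?content = "\<lambda>x. x \<notin> sep ` {1..<k}"
  have "subseq z (C 0 u @ separators k sep w (\<lambda>l. l \<noteq> 0 \<or> act l u) @ concat (map (slot k sep w act C 0) us))"
    using Cons.prems(4) by (simp add: slot_def[of k sep w act C 0 u])
  then obtain y s z' where z: "z = y @ s @ z'" and y: "subseq y (C 0 u)"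
    and s: "subseq s (separators k sep w (\<lambda>l. l \<noteq> 0 \<or> act l u))"
    and z': "subseq z' (concat (map (slot k sep w act C 0) us))"
    by (auto simp: subseq_append_iff)
  \<comment> \<open>\<open>B\<close>, \<open>A\<close> and \<open>X'\<close> are the parts of string
    \<open>j\<close> that serve the content \<open>y\<close>, the separators \<open>s\<close> and
    the rest \<open>z'\<close>. They are disjoint, so the separators charged to them add up to those
    of \<open>X j\<close>.\<close>
  have "\<exists>B A X'. X j = B @ A @ X' \<and> subseq y B \<and> subseq s A \<and> subseq z' X'" if "j \<in> {1..<k}" for j
    using Cons.prems(5)[OF that] z by (metis list_emb_appendD)
  then obtain B A X' where split: "\<And>j. j \<in> {1..<k} \<Longrightarrow>
      X j = B j @ A j @ X' j \<and> subseq y (B j) \<and> subseq s (A j) \<and> subseq z' (X' j)"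
    by metis
  have IH: "length z' \<le> (\<Sum>u\<leftarrow>us. c u) + (\<Sum>l\<in>{1..<k}. count_list (X' l) (sep l))"
  proof (rule Cons.IH)
    show "length y \<le> c u" if "u \<in> set us" "subseq y (C 0 u)"
      "\<And>j. j \<in> {1..<k} \<Longrightarrow> y = [] \<or> (\<exists>u'<U. subseq y (C j u'))" for u y
      using Cons.prems(1)[of u y] that by simp
    show "length (C 0 u) \<le> c u + w" if "u \<in> set us" for u
      using Cons.prems(2) that by simp
    show "filter ?content B' = [] \<or> (\<exists>u<U. subseq (filter ?content B') (C j u))"
      if "j \<in> {1..<k}" "X' j = P @ B' @ Q" "count_list B' (sep j) < w" for j P B' Q
      using Cons.prems(3)[of j "B j @ A j @ P" B' Q] that split by simp
  qed (use z' split in auto)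
  have "length s = (\<Sum>l\<in>{1..<k}. count_list s (sep l))"
    using sum_count_list[OF inj, of s] subseq_set[OF s] set_separators by fastforce
  also have "\<dots> \<le> (\<Sum>l\<in>{1..<k}. count_list (A l) (sep l))"
    using split by (intro sum_mono count_list_subseq) auto
  finally have ls: "length s \<le> (\<Sum>l\<in>{1..<k}. count_list (A l) (sep l))" .
  have ly: "length y \<le> c u + (\<Sum>l\<in>{1..<k}. count_list (B l) (sep l))"
  proof (cases "\<exists>l\<in>{1..<k}. w \<le> count_list (B l) (sep l)")
    case True
    then obtain l where l: "l \<in> {1..<k}" "w \<le> count_list (B l) (sep l)" by auto
    have "length y \<le> c u + w"
      using list_emb_length[OF y] Cons.prems(2)[of u] by simp
    also have "count_list (B l) (sep l) \<le> (\<Sum>l\<in>{1..<k}. count_list (B l) (sep l))"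
      using l by (intro member_le_sum) auto
    with l have "c u + w \<le> c u + (\<Sum>l\<in>{1..<k}. count_list (B l) (sep l))" by simp
    finally show ?thesis .
  next
    case False
    have pure: "?content x" if "x \<in> set y" for x
      using that subseq_set[OF y] pure0[of u] by auto
    have "y = [] \<or> (\<exists>u'<U. subseq y (C j u'))" if j: "j \<in> {1..<k}" for j
    proof -
      have "subseq y (filter ?content (B j))"
        using subseq_filter_right[of y "B j" ?content] split[OF j] pure by blast
      moreover have "filter ?content (B j) = [] \<or> (\<exists>u<U. subseq (filter ?content (B j)) (C j u))"
        using Cons.prems(3)[of j "[]" "B j" "A j @ X' j"] split[OF j] False j by (simp add: not_le)
      ultimately show ?thesis by (auto dest: subseq_order.trans)
    qed
    then have "length y \<le> c u" using Cons.prems(1)[of u y] y by simp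
    then show ?thesis by simp
  qed
  have "(\<Sum>l\<in>{1..<k}. count_list (X l) (sep l)) = (\<Sum>l\<in>{1..<k}. count_list (B l) (sep l))
     + (\<Sum>l\<in>{1..<k}. count_list (A l) (sep l)) + (\<Sum>l\<in>{1..<k}. count_list (X' l) (sep l))"
    using split by (simp add: sum.distrib[symmetric] add.assoc)
  with IH ls ly z show ?case by simp
qed

lemma count_slots:
  assumes "inj_on sep {1..<k}" "j \<in> {1..<k}" and pure: "\<And>u. set (C j u) \<inter> sep ` {1..<k} = {}"
  shows "count_list (slots k sep w act C U j) (sep j) = w * card {u\<in>{..<U}. act j u}"
proof (induction U)
  case (Suc U)
  have "count_list (C j U) (sep j) = 0"
    using pure[of U] assms(2) by (auto simp: count_list_0_iff)
  then have "count_list (slot k sep w act C j U) (sep j) = (if act j U then w else 0)"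
    by (simp add: slot_def count_separators[OF assms(1,2)])
  moreover have "{u\<in>{..<Suc U}. act j u} =
      (if act j U then insert U {u\<in>{..<U}. act j u} else {u\<in>{..<U}. act j u})"
    by (auto simp: less_Suc_eq)
  ultimately show ?case using Suc by (simp add: slots_def)
qed (simp add: slots_def)

text \<open>A common subsequence is charged with \<open>c u\<close> letters for slot
  \<open>u\<close> of string 0 and with the own separators of the other strings, of which string
  \<open>l\<close> has \<open>w\<close> per active slot. This serves both levels of the
  construction; on each, the weight \<open>w\<close> is chosen such that a whole gadget of string 0
  has at most \<open>c u + w\<close> letters.\<close>

lemma slots_upper:
  assumes inj: "inj_on sep {1..<k}"
    and pure: "\<And>j u. j < k \<Longrightarrow> set (C j u) \<inter> sep ` {1..<k} = {}" and k: "0 < k"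
    and act: "\<And>j u. j \<in> {1..<k} \<Longrightarrow> C j u \<noteq> [] \<Longrightarrow> act j u"
    and bound: "\<And>u y. \<lbrakk>u < U; subseq y (C 0 u); \<And>j. j \<in> {1..<k} \<Longrightarrow> y = [] \<or> (\<exists>u'<U. subseq y (C j u'))\<rbrakk>
       \<Longrightarrow> length y \<le> c u"
    and heavy: "\<And>u. u < U \<Longrightarrow> length (C 0 u) \<le> c u + w"
    and z: "\<And>j. j < k \<Longrightarrow> subseq z (slots k sep w act C U j)"
  shows "length z \<le> (\<Sum>u<U. c u) + w * (\<Sum>l\<in>{1..<k}. card {u\<in>{..<U}. act l u})"
proof -
  have "length z \<le> (\<Sum>u\<leftarrow>[0..<U]. c u) + (\<Sum>l\<in>{1..<k}. count_list (slots k sep w act C U l) (sep l))"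
  proof (rule slots_upper_aux[where C = C and act = act and w = w and U = U, OF inj])
    show "set (C 0 u) \<inter> sep ` {1..<k} = {}" for u using pure[OF k] .
    show "filter (\<lambda>x. x \<notin> sep ` {1..<k}) B = [] \<or>
         (\<exists>u<U. subseq (filter (\<lambda>x. x \<notin> sep ` {1..<k}) B) (C j u))"
      if "j \<in> {1..<k}" "slots k sep w act C U j = P @ B @ Q" "count_list B (sep j) < w" for j P B Q
    proof -
      have "filter (\<lambda>x. x \<notin> sep ` {1..<k}) B = [] \<or>
         (\<exists>u\<in>set [0..<U]. subseq (filter (\<lambda>x. x \<notin> sep ` {1..<k}) B) (C j u))"
        by (rule slots_factor[OF inj that(1), where w = w and act = act and P = P and Q = Q])
          (use that pure[of j] act[of j] in \<open>auto simp: slots_def\<close>)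
      then show ?thesis by auto
    qed
  qed (use bound heavy z k in \<open>auto simp: slots_def\<close>)
  also have "(\<Sum>u\<leftarrow>[0..<U]. c u) = (\<Sum>u<U. c u)"
    by (simp add: interv_sum_list_conv_sum_set_nat atLeast0LessThan)
  also have "(\<Sum>l\<in>{1..<k}. count_list (slots k sep w act C U l) (sep l))
      = w * (\<Sum>l\<in>{1..<k}. card {u\<in>{..<U}. act l u})"
    using count_slots[OF inj] pure by (simp add: sum_distrib_left)
  finally show ?thesis .
qed

section \<open>Common subsequences that realise a chosen alignment\<close>

definition aligned :: "nat \<Rightarrow> (nat \<Rightarrow> nat) \<Rightarrow> nat \<Rightarrow> (nat \<Rightarrow> nat \<Rightarrow> bool) \<Rightarrow> (nat \<Rightarrow> nat \<Rightarrow> nat)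
    \<Rightarrow> (nat \<Rightarrow> nat list) \<Rightarrow> nat list \<Rightarrow> nat list" where
  "aligned k sep w act f Y ts = concat (map (\<lambda>t. Y t @ separators k sep w (\<lambda>l. act l (f l t))) ts)"

text \<open>In step \<open>t\<close> slot \<open>f j t\<close> of every string \<open>j\<close> is
  used, and \<open>sep l\<close> is kept if string \<open>l\<close> is active there. Such a piece
  fits into slot \<open>f j t\<close>, since string \<open>j\<close> can lack only its own
  separator; as \<open>f j\<close> is increasing, the pieces fit one after the other and the
  remaining slots are skipped.\<close>

lemma subseq_aligned:
  assumes ts: "sorted_wrt (<) (map (f j) ts)" "\<And>t. t \<in> set ts \<Longrightarrow> f j t < U"
    and Y: "\<And>t. t \<in> set ts \<Longrightarrow> subseq (Y t) (C j (f j t))"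
  shows "subseq (aligned k sep w act f Y ts) (slots k sep w act C U j)"
proof -
  have "subseq (aligned k sep w act f Y ts) (concat (map (\<lambda>t. slot k sep w act C j (f j t)) ts))"
    unfolding aligned_def slot_def
    using Y by (intro subseq_concat_map list_emb_append_mono subseq_separators) auto
  also have "\<dots> = concat (map (slot k sep w act C j) (map (f j) ts))"
    by (simp add: comp_def)
  also have "subseq (map (f j) ts) [0..<U]"
    using ts by (intro sorted_subset_imp_subseq) (auto simp: sorted_wrt_upt)
  note subseq_concat_map_subseq[OF this, of "slot k sep w act C j"]
  finally show ?thesis by (simp add: slots_def)
qed

lemma length_aligned:
  "length (aligned k sep w act f Y ts)
    = (\<Sum>t\<leftarrow>ts. length (Y t)) + w * (\<Sum>t\<leftarrow>ts. card {l\<in>{1..<k}. act l (f l t)})"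
  by (induction ts) (auto simp: aligned_def length_separators algebra_simps)

section \<open>Gadgets for a tuple of factored vectors\<close>

lemma sum_div_mod:
  fixes f :: "nat \<Rightarrow> nat \<Rightarrow> 'a::comm_monoid_add"
  shows "(\<Sum>u<a*b. f (u div b) (u mod b)) = (\<Sum>i<a. \<Sum>v<b. f i v)"
proof -
  have "(\<Sum>u<a*b. f (u div b) (u mod b)) = (\<Sum>i<a. \<Sum>u\<in>{i*b..<i*b+b}. f (u div b) (u mod b))"
    by (rule sum.nat_group[symmetric])
  also have "\<dots> = (\<Sum>i<a. \<Sum>v<b. f i v)"
  proof (rule sum.cong[OF refl])
    fix i
    have "(\<Sum>u\<in>{i*b..<i*b+b}. f (u div b) (u mod b)) = (\<Sum>v\<in>{0..<b}. f ((v + i*b) div b) ((v + i*b) mod b))"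
      using sum.shift_bounds_nat_ivl[of "\<lambda>u. f (u div b) (u mod b)" 0 "i*b" b] by (simp add: add.commute)
    also have "\<dots> = (\<Sum>v\<in>{0..<b}. f i v)" by (rule sum.cong) auto
    finally show "(\<Sum>u\<in>{i*b..<i*b+b}. f (u div b) (u mod b)) = (\<Sum>v<b. f i v)"
      by (simp add: atLeast0LessThan)
  qed
  finally show ?thesis .
qed

lemma card_mod:
  "card {u\<in>{..<a*b}. Q (u mod b)} = a * card {v\<in>{..<b}. Q v}" for a b :: nat
proof -
  have *: "card {u\<in>A. S u} = (\<Sum>u\<in>A. if S u then 1 else 0)" if "finite A" for A :: "nat set" and S
    using that by (simp add: sum.If_cases Int_def)
  show ?thesis unfolding *[OF finite_lessThan] using sum_div_mod[of "\<lambda>i v. if Q v then 1 else 0::nat" b a] by simp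
qed

lemma sum_list_filter_upt:
  "(\<Sum>t\<leftarrow>filter Q [a..<b]. f t) = (\<Sum>t\<in>{a..<b}. if Q t then f t else 0)" for f :: "nat \<Rightarrow> nat"
  by (simp add: sum_list_map_filter' interv_sum_list_conv_sum_set_nat)

text \<open>The zeros are position markers. A common subsequence of two tables of the same size that
  retains all zeros is aligned position by position, and then a \<open>1\<close> can survive only
  where both tables have one.\<close>

definition table :: "nat \<Rightarrow> (nat \<Rightarrow> bool) \<Rightarrow> nat list" where
  "table n B = concat (map (\<lambda>p. (if B p then [1] else []) @ [0]) [0..<n])"

lemma table_Suc: "table (Suc n) B = (if B 0 then [1] else []) @ 0 # table n (\<lambda>p. B (Suc p))"
  by (simp add: table_def upt_conv_Cons map_Suc_upt[symmetric] comp_def del: upt_Suc)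

lemma table_mono: "(\<And>p. B p \<Longrightarrow> B' p) \<Longrightarrow> subseq (table n B) (table n B')"
  unfolding table_def by (rule subseq_concat_map) auto

lemma count_table: "count_list (table n B) 0 = n"
  by (induction n) (auto simp: table_def)

lemma length_table: "length (table n B) = n + card {p\<in>{..<n}. B p}"
proof (induction n)
  case (Suc n)
  have "{p\<in>{..<Suc n}. B p} = (if B n then insert n {p\<in>{..<n}. B p} else {p\<in>{..<n}. B p})"
    by (auto simp: less_Suc_eq)
  then show ?case using Suc by (auto simp: table_def)
qed (simp add: table_def)

lemma length_table_le: "length (table n B) \<le> 2 * n"
  using card_mono[of "{..<n}" "{p\<in>{..<n}. B p}"] by (auto simp: length_table)

lemma set_table: "set (table n B) \<subseteq> {0, 1}"
  by (auto simp: table_def)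

lemma table_False: "table n (\<lambda>_. False) = replicate n 0"
  by (induction n) (auto simp: table_def replicate_append_same)

text \<open>Both tables have exactly \<open>n\<close> zeros, so an embedding matches them in order,
  and the \<open>1\<close> has to fall directly before the same zero, where the second table has a
  \<open>1\<close> only if \<open>B q\<close>.\<close>

lemma subseq_table_singleton:
  assumes "subseq (table n (\<lambda>p. p = q)) (table n B)" "q < n"
  shows "B q"
  using assms
proof (induction n arbitrary: q B)
  case (Suc n)
  show ?case
  proof (cases q)
    case 0
    show ?thesis
    proof (rule ccontr)
      assume "\<not> B q"
      \<comment> \<open>Without a \<open>1\<close> at position 0 the leading zero of the second
        table is wasted, and \<open>n + 1\<close> zeros would have to fit among
        \<open>n\<close>.\<close>
      then have "subseq (1 # 0 # replicate n 0) (table n (\<lambda>p. B (Suc p)))"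
        using Suc.prems 0 by (simp add: table_Suc table_False)
      from count_list_subseq[OF this, of 0] show False
        by (simp add: count_table count_list_replicate)
    qed
  next
    case (Suc q')
    then have "subseq (table n (\<lambda>p. p = q')) (table n (\<lambda>p. B (Suc p)))"
      using Suc.prems by (auto simp: table_Suc split: if_splits)
    from Suc.IH[OF this] show ?thesis using Suc.prems Suc by simp
  qed
qed simp

text \<open>Each coordinate owns \<open>2 * R\<close> slots. String 1 is active in the first
  \<open>R\<close> of them, all other strings only in slot \<open>R\<close>; the free slots leave
  room for moving any one-hot table of string 1 opposite slot \<open>R\<close> without leaving the
  range of the coordinate.\<close>

definition inner_act :: "nat \<Rightarrow> nat \<Rightarrow> nat \<Rightarrow> bool" where
  "inner_act R j u \<longleftrightarrow> (if j = 1 then u mod (2 * R) < R else u mod (2 * R) = R)"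

text \<open>
  String 1 lists the one-hot tables: slot \<open>v < R\<close> of block \<open>i\<close> is for position \<open>p = i * R + v\<close>. The other strings have one
  table per block, for all positions of the block, in slot \<open>R\<close> of \<open>2 * R\<close>.
\<close>

definition inner_content :: "nat \<Rightarrow> nat \<Rightarrow> (nat \<Rightarrow> bool) \<Rightarrow> nat \<Rightarrow> nat \<Rightarrow> nat list" where
  "inner_content g R x j u = (if inner_act R j u then
     table (g * R) (\<lambda>p. x p \<and> (if j = 1 then p = u div (2 * R) * R + u mod (2 * R) else p div R = u div (2 * R)))
     else [])"

definition inner_sep :: "nat \<Rightarrow> nat" where "inner_sep l = 4 + l"

definition gadget :: "nat \<Rightarrow> nat \<Rightarrow> nat \<Rightarrow> (nat \<Rightarrow> bool) \<Rightarrow> nat \<Rightarrow> nat list" where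
  "gadget k g R x j = slots k inner_sep (g * R) (inner_act R) (inner_content g R x) (g * (2 * R)) j"

text \<open>Score of a gadget in case of success: in each of the \<open>g\<close> coordinates a
  one-hot table with \<open>g * R\<close> zeros and one \<open>1\<close>, and all own separators in
  groups of \<open>g * R\<close>, where string 1 has \<open>g * R\<close> active slots and each of
  the \<open>k - 2\<close> strings after it has \<open>g\<close>.\<close>

definition inner_high :: "nat \<Rightarrow> nat \<Rightarrow> nat \<Rightarrow> nat" where
  "inner_high k g R = g * (g * R + 1) + g * R * (g * (R + (k - 2)))"

lemma gadget_conv:
  "gadget k g R (x j) j = slots k inner_sep (g * R) (inner_act R) (\<lambda>j. inner_content g R (x j) j) (g * (2 * R)) j"
  unfolding gadget_def slots_def slot_def ..

lemma inj_inner_sep: "inj_on inner_sep A"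
  by (auto simp: inner_sep_def inj_on_def)

lemma set_inner_content: "set (inner_content g R x j u) \<subseteq> {0, 1}"
  using set_table by (auto simp: inner_content_def)

lemma card_inner_act:
  assumes "0 < R"
  shows "card {u\<in>{..<g * (2 * R)}. inner_act R j u} = g * (if j = 1 then R else 1)"
proof -
  have "{v\<in>{..<2 * R}. v < R} = {..<R}" "{v\<in>{..<2 * R}. v = R} = {R}" using assms by auto
  then show ?thesis
    using card_mod[of g "2 * R" "\<lambda>v. if j = 1 then v < R else v = R"] by (simp add: inner_act_def)
qed

lemma set_gadget: "set (gadget k g R x j) \<subseteq> {0, 1} \<union> inner_sep ` {1..<k}"
  unfolding gadget_def slots_def slot_def using set_inner_content set_separators by fastforce

text \<open>A one-hot table has \<open>g * R\<close> zeros and at most one \<open>1\<close>, so only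
  length \<open>g * R + 1\<close> has to be examined. It means that the entire one-hot table of some
  \<open>q\<close> was matched. Tables have cells for the positions of all coordinates, so an
  embedding into a table of string \<open>j\<close> certifies \<open>x j q\<close> and, as that
  table has ones in its own block only, also locates \<open>q\<close>; string 0 thus forces
  \<open>q\<close> into the coordinate of \<open>u\<close>.\<close>

lemma row_bound:
  assumes "2 \<le> k" and R: "0 < R" and u: "u < g * (2 * R)"
    and y0: "subseq y (inner_content g R (x 0) 0 u)"
    and yj: "\<And>j. j \<in> {1..<k} \<Longrightarrow> y = [] \<or> (\<exists>u'. subseq y (inner_content g R (x j) j u'))"
  shows "length y \<le> (if inner_act R 0 u then
     g * R + of_bool (\<exists>t<R. \<forall>j<k. x j (u div (2 * R) * R + t)) else 0)"
proof (cases "y = []")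
  case False
  have a0: "inner_act R 0 u" using y0 False by (auto simp: inner_content_def split: if_splits)
  have "1 \<in> {1..<k}" using assms by auto
  from yj[OF this] False obtain u1 where u1: "subseq y (inner_content g R (x 1) 1 u1)" by auto
  define q where "q = u1 div (2 * R) * R + u1 mod (2 * R)"
  have y1: "subseq y (table (g * R) (\<lambda>p. x 1 p \<and> p = q))"
    using u1 False by (auto simp: inner_content_def q_def split: if_splits)
  have eq: "{p\<in>{..<g * R}. x 1 p \<and> p = q} = (if q < g * R \<and> x 1 q then {q} else {})" by auto
  have len: "length (table (g * R) (\<lambda>p. x 1 p \<and> p = q)) = g * R + (if q < g * R \<and> x 1 q then 1 else 0)"
    unfolding length_table eq by simp
  show ?thesis
  proof (cases "length y \<le> g * R")
    case True
    then show ?thesis using a0 by simp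
  next
    case big: False
    have "length y \<le> g * R + (if q < g * R \<and> x 1 q then 1 else 0)"
      using list_emb_length[OF y1] len by simp
    then have q: "q < g * R" "x 1 q" and ly: "length y = g * R + 1"
      using big by (auto split: if_splits)
    have "y = table (g * R) (\<lambda>p. x 1 p \<and> p = q)"
      using subseq_same_length[OF y1] ly len q by simp
    also have "(\<lambda>p. x 1 p \<and> p = q) = (\<lambda>p. p = q)" using q by auto
    finally have y: "y = table (g * R) (\<lambda>p. p = q)" .
    have key: "x j q \<and> (j \<noteq> 1 \<longrightarrow> q div R = u' div (2 * R))" if "subseq y (inner_content g R (x j) j u')" for j u'
    proof -
      have "inner_content g R (x j) j u' \<noteq> []" using that False by auto
      then have "inner_act R j u'" by (auto simp: inner_content_def split: if_splits)
      then show ?thesis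
        using that subseq_table_singleton[OF _ q(1)] unfolding y inner_content_def
        by (cases "j = 1") fastforce+
    qed
    have "x j q" if "j < k" for j
      using key[of j] yj[of j] y0 False that by (cases "j = 0") auto
    moreover have "q div R = u div (2 * R)" using key[of 0 u] y0 by simp
    then have "q = u div (2 * R) * R + q mod R" by (metis div_mult_mod_eq)
    \<comment> \<open>The witness is \<open>q mod R\<close>.\<close>
    ultimately have "\<exists>t<R. \<forall>j<k. x j (u div (2 * R) * R + t)"
      using R by (metis mod_less_divisor)
    then show ?thesis using ly a0 by simp
  qed
qed simp

text \<open>Each coordinate earns \<open>g * R\<close>, and one more if it has a witness; a
  coordinate without witness leaves at most \<open>g - 1\<close> extra letters. A table has at most
  twice \<open>g * R\<close> letters, so \<open>g * R\<close> lost separators pay for what exceeds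
  the guaranteed \<open>g * R\<close>.\<close>

lemma gadget_upper:
  assumes k: "2 \<le> k" and R: "0 < R"
    and z: "\<And>j. j < k \<Longrightarrow> subseq z (gadget k g R (x j) j)"
    and no: "\<not> (\<forall>i<g. \<exists>t<R. \<forall>j<k. x j (i * R + t))"
  shows "length z \<le> inner_high k g R - 1"
proof -
  let ?row = "\<lambda>i. \<exists>t<R. \<forall>j<k. x j (i * R + t)"
  define c where "c u = (if inner_act R 0 u then g * R + of_bool (?row (u div (2 * R))) else 0)" for u
  have "length z \<le> (\<Sum>u<g * (2 * R). c u)
     + g * R * (\<Sum>l\<in>{1..<k}. card {u\<in>{..<g * (2 * R)}. inner_act R l u})"
  proof (rule slots_upper[where C = "\<lambda>j. inner_content g R (x j) j" and sep = inner_sep])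
    show "inj_on inner_sep {1..<k}" by (rule inj_inner_sep)
    show "set (inner_content g R (x j) j u) \<inter> inner_sep ` {1..<k} = {}" for j u
      using set_inner_content[of g R "x j" j u] by (auto simp: inner_sep_def)
    show "inner_act R j u" if "inner_content g R (x j) j u \<noteq> []" for j u
      using that by (auto simp: inner_content_def split: if_splits)
    show "length y \<le> c u" if "u < g * (2 * R)" "subseq y (inner_content g R (x 0) 0 u)"
      "\<And>j. j \<in> {1..<k} \<Longrightarrow> y = [] \<or> (\<exists>u'<g * (2 * R). subseq y (inner_content g R (x j) j u'))" for u y
      unfolding c_def by (rule row_bound[where x = x, OF k R that(1,2)]) (use that(3) in blast)
    show "length (inner_content g R (x 0) 0 u) \<le> c u + g * R" for u
      using length_table_le[of "g * R", unfolded mult_2] by (auto simp: inner_content_def c_def intro: le_SucI)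
    show "subseq z (slots k inner_sep (g * R) (inner_act R) (\<lambda>j. inner_content g R (x j) j) (g * (2 * R)) j)"
      if "j < k" for j
      using z[OF that] by (simp add: gadget_conv)
  qed (use k in auto)
  also have "(\<Sum>l\<in>{1..<k}. card {u\<in>{..<g * (2 * R)}. inner_act R l u}) = g * (R + (k - 2))"
  proof -
    have "{1..<k} = insert 1 {2..<k}" using k by auto
    moreover have "(\<Sum>l\<in>{2..<k}. g * (if l = 1 then R else 1)) = g * (k - 2)" by simp
    ultimately show ?thesis unfolding card_inner_act[OF R] by (simp add: algebra_simps)
  qed
  also have "(\<Sum>u<g * (2 * R). c u) \<le> g * (g * R) + (g - 1)"
  proof -
    have "(\<Sum>u<g * (2 * R). c u) = (\<Sum>i<g. \<Sum>v<2 * R. if v = R then g * R + of_bool (?row i) else 0)"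
      using sum_div_mod[of "\<lambda>i v. if v = R then g * R + of_bool (?row i) else 0" "2 * R" g]
      by (simp add: c_def inner_act_def)
    also have "\<dots> = g * (g * R) + (\<Sum>i<g. of_bool (?row i))"
      using R by (simp add: sum.distrib)
    also have "(\<Sum>i<g. of_bool (?row i)) \<le> g - 1"
    proof -
      obtain i0 where i0: "i0 < g" "\<not> ?row i0" using no by auto
      have "(\<Sum>i<g. of_bool (?row i)) = of_bool (?row i0) + (\<Sum>i\<in>{..<g} - {i0}. of_bool (?row i) :: nat)"
        using i0 by (intro sum.remove) auto
      also have "\<dots> \<le> 0 + (\<Sum>i\<in>{..<g} - {i0}. 1)"
        using i0 by (intro add_mono sum_mono) auto
      also have "\<dots> = g - 1" using i0 by simp
      finally show ?thesis .
    qed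
    finally show ?thesis by simp
  qed
  finally have "length z \<le> g * (g * R) + (g - 1) + g * R * (g * (R + (k - 2)))" by simp
  moreover have "0 < g" using no by auto
  ultimately show ?thesis by (simp add: inner_high_def algebra_simps)
qed

text \<open>In coordinate \<open>i\<close>, string 1 is moved by \<open>R - t i\<close> slots, so
  that its one-hot table for \<open>t i\<close> faces the tables in slot \<open>R\<close> of the
  other strings.\<close>

lemma gadget_lower:
  assumes k: "2 \<le> k" and R: "0 < R"
    and yes: "\<forall>i<g. \<exists>t<R. \<forall>j<k. x j (i * R + t)"
  shows "\<exists>z. length z = inner_high k g R \<and> (\<forall>j<k. subseq z (gadget k g R (x j) j))"
proof -
  obtain t where t: "\<And>i. i < g \<Longrightarrow> t i < R" "\<And>i j. i < g \<Longrightarrow> j < k \<Longrightarrow> x j (i * R + t i)"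
    using yes by metis
  define s where "s u = R - t (u div (2 * R))" for u
  \<comment> \<open>The first \<open>R - t i\<close> slots of each coordinate are omitted in the
    strings other than 1, and equally many at the end in string 1. The former precede slot
    \<open>R\<close> and the latter start at slot \<open>R + t i\<close>, so all of them are
    inactive and no separator is lost.\<close>
  define ts where "ts = filter (\<lambda>u. s u \<le> u mod (2 * R)) [0..<g * (2 * R)]"
  define f where "f j u = (if j = 1 then u - s u else u)" for j u :: nat
  define Y where "Y u = (if u mod (2 * R) = R then
     table (g * R) (\<lambda>p. p = u div (2 * R) * R + t (u div (2 * R))) else [])" for u
  define z where "z = aligned k inner_sep (g * R) (inner_act R) f Y ts"
  have blk: "u div (2 * R) < g" if "u < g * (2 * R)" for u
    using that by (simp add: less_mult_imp_div_less)
  have shift: "(u - s u) div (2 * R) = u div (2 * R)" "(u - s u) mod (2 * R) = u mod (2 * R) - s u"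
    if "s u \<le> u mod (2 * R)" for u
  proof -
    have eq: "u - s u = (u mod (2 * R) - s u) + u div (2 * R) * (2 * R)"
      using that div_mult_mod_eq[of u "2 * R"] by linarith
    have lt: "u mod (2 * R) - s u < 2 * R"
      using R by (simp add: less_imp_diff_less)
    show "(u - s u) div (2 * R) = u div (2 * R)" unfolding eq using lt R by (subst div_mult_self1) auto
    show "(u - s u) mod (2 * R) = u mod (2 * R) - s u" unfolding eq using lt by (subst mod_mult_self1) auto
  qed
  have "subseq z (slots k inner_sep (g * R) (inner_act R) (\<lambda>j. inner_content g R (x j) j) (g * (2 * R)) j)"
    if j: "j < k" for j
    unfolding z_def
  proof (rule subseq_aligned)
    show "sorted_wrt (<) (map (f j) ts)"
    proof -
      have "sorted_wrt (\<lambda>u u'. f j u < f j u') ts"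
      proof (rule sorted_wrt_mono_rel[of _ "(<)"])
        show "sorted_wrt (<) ts" unfolding ts_def by (rule sorted_wrt_filter) (simp add: sorted_wrt_upt)
        fix u u' assume "u \<in> set ts" "u' \<in> set ts" and lt: "u < u'"
        then have su: "s u \<le> u mod (2 * R)" "s u' \<le> u' mod (2 * R)" by (auto simp: ts_def)
        \<comment> \<open>Within a coordinate the shift is constant; between coordinates the order
          is kept because a shifted slot stays in its coordinate.\<close>
        show "f j u < f j u'"
        proof (cases "u div (2 * R) = u' div (2 * R)")
          case True
          then have "s u = s u'" by (simp add: s_def)
          moreover have "s u \<le> u" using su(1) mod_less_eq_dividend le_trans by blast
          ultimately show ?thesis using lt by (simp add: f_def diff_less_mono)
        next
          case False
          then have d: "u div (2 * R) < u' div (2 * R)" using lt by (simp add: div_le_mono le_neq_implies_less)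
          have "u - s u < u' - s u'"
          proof (rule ccontr)
            assume "\<not> ?thesis"
            then have "(u' - s u') div (2 * R) \<le> (u - s u) div (2 * R)" by (simp add: div_le_mono)
            then show False using d shift su by simp
          qed
          then show ?thesis using lt by (simp add: f_def)
        qed
      qed
      then show ?thesis by (simp add: sorted_wrt_map)
    qed
    fix u assume u: "u \<in> set ts"
    then have su: "s u \<le> u mod (2 * R)" and ug: "u < g * (2 * R)" by (auto simp: ts_def)
    show "f j u < g * (2 * R)" using ug by (auto simp: f_def less_imp_diff_less)
    show "subseq (Y u) (inner_content g R (x j) j (f j u))"
    proof (cases "u mod (2 * R) = R")
      case True
      have i: "u div (2 * R) < g" using blk[OF ug] .
      show ?thesis
      proof (cases "j = 1")
        case True
        have "R - s u = t (u div (2 * R))" using t(1)[OF i] by (simp add: s_def)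
        then have "f j u mod (2 * R) = t (u div (2 * R))" "f j u div (2 * R) = u div (2 * R)"
          using \<open>j = 1\<close> shift[OF su] \<open>u mod (2 * R) = R\<close> by (auto simp: f_def)
        then show ?thesis using True j t(1)[OF i] t(2)[OF i]
          by (auto simp: Y_def inner_content_def inner_act_def intro!: table_mono)
      next
        case False
        then show ?thesis using \<open>u mod (2 * R) = R\<close> t(1)[OF i] t(2)[OF i j]
          by (auto simp: Y_def inner_content_def inner_act_def f_def intro!: table_mono)
      qed
    qed (simp add: Y_def)
  qed
  then have sub: "\<forall>j<k. subseq z (gadget k g R (x j) j)" by (simp add: gadget_conv)
  have lY: "length (Y u) = (if u mod (2 * R) = R then g * R + 1 else 0)" if "u < g * (2 * R)" for u
  proof -
    let ?q = "u div (2 * R) * R + t (u div (2 * R))"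
    have "?q < (u div (2 * R) + 1) * R" using t(1)[OF blk[OF that]] by simp
    also have "\<dots> \<le> g * R" using blk[OF that] by (intro mult_right_mono) auto
    finally have "{p\<in>{..<g * R}. p = ?q} = {?q}" by auto
    then show ?thesis by (simp add: Y_def length_table)
  qed
  have sY: "(\<Sum>u\<leftarrow>ts. length (Y u)) = g * (g * R + 1)"
  proof -
    have "(\<Sum>u\<leftarrow>ts. length (Y u)) = (\<Sum>u<g * (2 * R). if s u \<le> u mod (2 * R) then length (Y u) else 0)"
      by (simp add: ts_def sum_list_filter_upt atLeast0LessThan)
    also have "\<dots> = (\<Sum>u<g * (2 * R). if u mod (2 * R) = R then g * R + 1 else 0)"
      by (rule sum.cong) (auto simp: lY s_def)
    also have "\<dots> = (\<Sum>i<g. \<Sum>v<2 * R. if v = R then g * R + 1 else 0)"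
      by (rule sum_div_mod)
    also have "\<dots> = g * (g * R + 1)" using R by simp
    finally show ?thesis .
  qed
  have card: "card {l\<in>{1..<k}. inner_act R l (f l u)}
      = (if u mod (2 * R) - s u < R then 1 else 0) + (if u mod (2 * R) = R then k - 2 else 0)"
    if "s u \<le> u mod (2 * R)" for u
  proof -
    have "{l\<in>{1..<k}. inner_act R l (f l u)} = (if u mod (2 * R) - s u < R then {1} else {})
       \<union> (if u mod (2 * R) = R then {2..<k} else {})"
      using k shift[OF that] by (auto simp: inner_act_def f_def)
    moreover have "{1} \<union> {2..<k} = insert 1 {2..<k}" "(1::nat) \<notin> {2..<k}" by auto
    ultimately show ?thesis
      by (cases "u mod (2 * R) = R"; cases "u mod (2 * R) - s u < R") (simp_all only: if_True if_False, simp_all)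
  qed
  have "(\<Sum>u\<leftarrow>ts. card {l\<in>{1..<k}. inner_act R l (f l u)}) = g * (R + (k - 2))"
  proof -
    have "(\<Sum>u\<leftarrow>ts. card {l\<in>{1..<k}. inner_act R l (f l u)})
       = (\<Sum>u<g * (2 * R). if s u \<le> u mod (2 * R) then card {l\<in>{1..<k}. inner_act R l (f l u)} else 0)"
      unfolding ts_def sum_list_filter_upt atLeast0LessThan ..
    also have "\<dots> = (\<Sum>u<g * (2 * R). (if s u \<le> u mod (2 * R) \<and> u mod (2 * R) - s u < R then 1 else 0)
        + (if u mod (2 * R) = R then k - 2 else 0))"
    proof (rule sum.cong[OF refl])
      fix u
      show "(if s u \<le> u mod (2 * R) then card {l\<in>{1..<k}. inner_act R l (f l u)} else 0)
        = (if s u \<le> u mod (2 * R) \<and> u mod (2 * R) - s u < R then 1 else 0) + (if u mod (2 * R) = R then k - 2 else 0)"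
      proof (cases "s u \<le> u mod (2 * R)")
        case True
        then show ?thesis by (simp only: card[OF True] if_True simp_thms)
      next
        case False
        then show ?thesis by (simp add: s_def)
      qed
    qed
    also have "\<dots> = (\<Sum>i<g. \<Sum>v<2 * R. (if R - t i \<le> v \<and> v - (R - t i) < R then 1 else 0)
        + (if v = R then k - 2 else 0))"
      unfolding s_def by (rule sum_div_mod)
    also have "\<dots> = (\<Sum>i<g. R + (k - 2))"
    proof (rule sum.cong[OF refl])
      fix i assume "i \<in> {..<g}"
      then have ti: "t i < R" using t by simp
      have "{v\<in>{..<2 * R}. R - t i \<le> v \<and> v - (R - t i) < R} = {R - t i..<2 * R - t i}"
        using ti by auto
      then have "card {v\<in>{..<2 * R}. R - t i \<le> v \<and> v - (R - t i) < R} = R" using ti by simp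
      moreover have "(\<Sum>v<2 * R. if R - t i \<le> v \<and> v - (R - t i) < R then 1 else 0 :: nat)
          = card {v\<in>{..<2 * R}. R - t i \<le> v \<and> v - (R - t i) < R}"
        by (simp add: sum.If_cases Int_def)
      ultimately show "(\<Sum>v<2 * R. (if R - t i \<le> v \<and> v - (R - t i) < R then 1 else 0)
        + (if v = R then k - 2 else 0)) = R + (k - 2)"
        using R by (simp add: sum.distrib)
    qed
    finally show ?thesis by simp
  qed
  then have "length z = inner_high k g R"
    using sY by (simp add: z_def length_aligned inner_high_def)
  then show ?thesis using sub by blast
qed

section \<open>Choosing a tuple of vectors\<close>

text \<open>
  Slots \<open>4 * m, \<dots>, 5 * m - 1\<close> are for the \<open>m\<close> vectors. Except in string 0, the \<open>m\<close> slots on either side are active, too, as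
  partners of the other gadgets of string 0 when the strings are shifted.
\<close>

definition top_act :: "nat \<Rightarrow> nat \<Rightarrow> nat \<Rightarrow> bool" where
  "top_act m j u \<longleftrightarrow> (if j = 0 then 4 * m \<le> u \<and> u < 5 * m else 3 * m \<le> u \<and> u < 6 * m)"

text \<open>The letters are \<open>0\<close> and \<open>1\<close> for tables, \<open>2\<close> for
  filler, \<open>3\<close> and \<open>4\<close> for padding, then \<open>k - 1\<close> inner
  separators from \<open>5\<close> on and \<open>k - 1\<close> outer ones from \<open>k + 5\<close>
  on.\<close>

definition top_sep :: "nat \<Rightarrow> nat \<Rightarrow> nat" where "top_sep k l = 4 + k + l"

definition top_content :: "nat \<Rightarrow> nat \<Rightarrow> nat \<Rightarrow> nat \<Rightarrow> nat \<Rightarrow> (nat \<Rightarrow> nat \<Rightarrow> bool) \<Rightarrow> nat \<Rightarrow> nat \<Rightarrow> nat list" where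
  "top_content k g R low m x j u =
     (if j = 0 \<and> top_act m j u then replicate low 2 else []) @
     (if 4 * m \<le> u \<and> u < 5 * m then gadget k g R (x (u - 4 * m)) j else []) @
     (if j \<noteq> 0 \<and> top_act m j u then replicate low 2 else [])"

text \<open>All activity lies between slots \<open>3 * m\<close> and \<open>6 * m\<close>. Since a
  string is shifted by less than \<open>m\<close> relative to string 0, the inactive slots at both
  ends ensure that every active slot has partners in all other strings.\<close>

definition top_string :: "nat \<Rightarrow> nat \<Rightarrow> nat \<Rightarrow> nat \<Rightarrow> nat \<Rightarrow> nat \<Rightarrow> (nat \<Rightarrow> nat \<Rightarrow> bool) \<Rightarrow> nat \<Rightarrow> nat list" where
  "top_string k g R low H m x j =
     slots k (top_sep k) H (top_act m) (top_content k g R low m x) (9 * m) j"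

lemma top_string_conv:
  "top_string k g R low H m (x j) j =
    slots k (top_sep k) H (top_act m) (\<lambda>j. top_content k g R low m (x j) j) (9 * m) j"
  unfolding top_string_def slots_def slot_def ..

lemma inj_top_sep: "inj_on (top_sep k) A"
  by (auto simp: top_sep_def inj_on_def)

lemma gadget_symbols: "s \<in> set (gadget k g R x j) \<Longrightarrow> s < 4 + k \<and> s \<noteq> 2"
  using set_gadget[of k g R x j] by (auto simp: inner_sep_def)

text \<open>
  The block \<open>2\<^bsup>low\<^esup>\<close> precedes the gadget in string 0 and follows it in the other strings, so a common
  subsequence uses either the block or the gadgets but not both.
\<close>

lemma normalized_bound:
  fixes y :: "nat list"
  assumes y0: "subseq y (replicate low 2 @ G)" and G: "2 \<notin> set G" "2 \<notin> set G'"
    and y1: "subseq y (G' @ replicate low 2)" and no2: "2 \<notin> set y \<Longrightarrow> length y \<le> low"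
  shows "length y \<le> low"
proof (cases "2 \<in> set y")
  case True
  obtain a b where ab: "y = a @ b" "subseq a (replicate low 2)" "subseq b G"
    using y0 by (auto simp: subseq_append_iff)
  obtain c d where cd: "y = c @ d" "subseq c G'" "subseq d (replicate low 2)"
    using y1 by (auto simp: subseq_append_iff)
  have "2 \<notin> set b" "2 \<notin> set c" using subseq_set ab cd G by blast+
  then have "a \<noteq> []" using True ab by auto
  then have "hd y = 2" using ab subseq_set[OF ab(2)] by (cases a) (auto split: if_splits)
  then have "c = []" using \<open>2 \<notin> set c\<close> cd by (cases c) auto
  then show ?thesis using cd list_emb_length by fastforce
qed (use no2 in simp)

text \<open>The content of an active slot of string 0 is filler of length \<open>low = c u\<close>
  and a gadget of length at most \<open>H\<close>, so the weight \<open>H\<close> pays for the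
  gadget. Without an orthogonal tuple no untorn piece is longer than \<open>low\<close>.\<close>

lemma top_upper:
  assumes k: "2 \<le> k" and R: "0 < R"
    and H: "\<And>x. length (gadget k g R x 0) \<le> H" and low: "low = inner_high k g R - 1"
    and z: "\<And>j. j < k \<Longrightarrow> subseq z (top_string k g R low H m (x j) j)"
    and no: "\<And>r. (\<And>j. j < k \<Longrightarrow> r j < m) \<Longrightarrow> \<not> (\<forall>i<g. \<exists>t<R. \<forall>j<k. x j (r j) (i * R + t))"
  shows "length z \<le> m * low + H * ((k - 1) * (3 * m))"
proof -
  define c where "c u = (if 4 * m \<le> u \<and> u < 5 * m then low else 0)" for u
  have "length z \<le> (\<Sum>u<9 * m. c u) + H * (\<Sum>l\<in>{1..<k}. card {u\<in>{..<9 * m}. top_act m l u})"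
  proof (rule slots_upper[where C = "\<lambda>j. top_content k g R low m (x j) j" and sep = "top_sep k"])
    show "inj_on (top_sep k) {1..<k}" by (rule inj_top_sep)
    show "set (top_content k g R low m (x j) j u) \<inter> top_sep k ` {1..<k} = {}" for j u
      using gadget_symbols by (fastforce simp: top_content_def top_sep_def split: if_splits)
    show "top_act m j u" if "j \<in> {1..<k}" "top_content k g R low m (x j) j u \<noteq> []" for j u
      using that by (auto simp: top_content_def top_act_def split: if_splits)
    show "length y \<le> c u" if u: "u < 9 * m" and y0: "subseq y (top_content k g R low m (x 0) 0 u)"
      and yj: "\<And>j. j \<in> {1..<k} \<Longrightarrow> y = [] \<or> (\<exists>u'<9 * m. subseq y (top_content k g R low m (x j) j u'))" for u y
    proof (cases "y = []")
      case ne: False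
      have act: "4 * m \<le> u \<and> u < 5 * m"
        using y0 ne by (auto simp: top_content_def top_act_def split: if_splits)
      from yj ne obtain v where v: "\<And>j. j \<in> {1..<k} \<Longrightarrow> subseq y (top_content k g R low m (x j) j (v j))"
        by metis
      define G where "G = gadget k g R (x 0 (u - 4 * m)) 0"
      define G' where "G' j = (if 4 * m \<le> v j \<and> v j < 5 * m then gadget k g R (x j (v j - 4 * m)) j else [])" for j
      have v': "subseq y (G' j @ replicate low 2)" if "j \<in> {1..<k}" for j
      proof (cases "top_act m j (v j)")
        case True
        then show ?thesis using v[OF that] that by (simp add: top_content_def G'_def)
      next
        case False
        then show ?thesis using v[OF that] that ne
          by (auto simp: top_content_def G'_def top_act_def dest: list_emb_length)
      qed
      have "length y \<le> low"
      proof (rule normalized_bound)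
        show "subseq y (replicate low 2 @ G)"
          using y0 act by (simp add: top_content_def top_act_def G_def)
        show "2 \<notin> set G" "2 \<notin> set (G' 1)"
          using gadget_symbols by (fastforce simp: G_def G'_def)+
        show "subseq y (G' 1 @ replicate low 2)" using v'[of 1] k by simp
        assume y2: "2 \<notin> set y"
        have f2: "filter (\<lambda>s. s \<noteq> 2) (G' j @ replicate low 2) = G' j" for j
          using gadget_symbols by (fastforce simp: G'_def filter_id_conv filter_empty_conv)
        have vG: "subseq y (G' j)" if "j \<in> {1..<k}" for j
          using subseq_filter_right[OF v'[OF that], of "\<lambda>s. s \<noteq> 2"] y2 f2 by auto
        \<comment> \<open>A nonempty \<open>y\<close> without the letter \<open>2\<close> cannot
          come from the additional active slots, which hold filler only. So every string matches
          \<open>y\<close> within the gadget of a vector, and these vectors form the tuple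
          \<open>r\<close>.\<close>
        have real: "4 * m \<le> v j \<and> v j < 5 * m" if "j \<in> {1..<k}" for j
          using vG[OF that] ne by (auto simp: G'_def split: if_splits)
        define r where "r j = (if j = 0 then u else v j) - 4 * m" for j
        have f0: "filter (\<lambda>s. s \<noteq> 2) (replicate low 2 @ G) = G"
          using gadget_symbols by (fastforce simp: G_def filter_id_conv filter_empty_conv)
        have "subseq y G"
          using subseq_filter_right[of y "replicate low 2 @ G" "\<lambda>s. s \<noteq> 2"] y2 f0 y0 act
          by (fastforce simp: top_content_def top_act_def G_def)
        then have "subseq y (gadget k g R (x j (r j)) j)" if "j < k" for j
          using vG[of j] real[of j] that by (cases "j = 0") (auto simp: G_def G'_def r_def)
        moreover have "r j < m" if "j < k" for j
          using real[of j] that act by (cases "j = 0") (auto simp: r_def)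
        ultimately show "length y \<le> low"
          unfolding low using no[of r]
          by (intro gadget_upper[OF k R, where x = "\<lambda>j. x j (r j)"]) auto
      qed
      then show ?thesis using act by (simp add: c_def)
    qed simp
    show "length (top_content k g R low m (x 0) 0 u) \<le> c u + H" for u
      using H by (auto simp: top_content_def c_def top_act_def)
    show "subseq z (slots k (top_sep k) H (top_act m) (\<lambda>j. top_content k g R low m (x j) j) (9 * m) j)"
      if "j < k" for j
      using z[OF that] by (simp add: top_string_conv)
  qed (use k in auto)
  also have "(\<Sum>u<9 * m. c u) = m * low"
  proof -
    have "{u\<in>{..<9 * m}. 4 * m \<le> u \<and> u < 5 * m} = {4 * m..<5 * m}" by auto
    then have "card {u\<in>{..<9 * m}. 4 * m \<le> u \<and> u < 5 * m} = m" by simp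
    then show ?thesis by (simp add: c_def sum.If_cases Int_def)
  qed
  also have "(\<Sum>l\<in>{1..<k}. card {u\<in>{..<9 * m}. top_act m l u}) = (k - 1) * (3 * m)"
  proof -
    have "{u\<in>{..<9 * m}. top_act m l u} = {3 * m..<6 * m}" if "l \<in> {1..<k}" for l
      using that by (auto simp: top_act_def)
    then show ?thesis by simp
  qed
  finally show ?thesis .
qed

text \<open>String \<open>j\<close> is moved by \<open>r j - r 0\<close> slots, so that the gadgets
  of the chosen tuple face each other and earn \<open>low + 1\<close>. The other
  \<open>m - 1\<close> gadgets of string 0 face active slots and earn their filler.\<close>

lemma top_lower:
  assumes k: "2 \<le> k" and R: "0 < R" and g: "0 < g" and low: "low = inner_high k g R - 1"
    and r: "\<And>j. j < k \<Longrightarrow> r j < m" and yes: "\<forall>i<g. \<exists>t<R. \<forall>j<k. x j (r j) (i * R + t)"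
  shows "\<exists>z. length z = m * low + H * ((k - 1) * (3 * m)) + 1 \<and>
    (\<forall>j<k. subseq z (top_string k g R low H m (x j) j))"
proof -
  obtain y where y: "length y = inner_high k g R" "\<And>j. j < k \<Longrightarrow> subseq y (gadget k g R (x j (r j)) j)"
    using gadget_lower[OF k R, of g "\<lambda>j. x j (r j)"] yes by blast
  \<comment> \<open>Only \<open>u\<close> between \<open>m\<close> and \<open>8 * m\<close> will be
    used, so the subtraction is not truncated, because of \<open>r 0 < m\<close>, and the result
    stays below \<open>9 * m\<close>.\<close>
  define f where "f j u = u + r j - r 0" for j u
  define Y where "Y u = (if u = 4 * m + r 0 then y else if 4 * m \<le> u \<and> u < 5 * m then replicate low 2 else [])" for u
  define z where "z = aligned k (top_sep k) H (top_act m) f Y [m..<8 * m]"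
  have r0: "r 0 < m" using r k by simp
  have "subseq z (slots k (top_sep k) H (top_act m) (\<lambda>j. top_content k g R low m (x j) j) (9 * m) j)"
    if j: "j < k" for j
    unfolding z_def
  proof (rule subseq_aligned)
    have "sorted_wrt (\<lambda>u u'. f j u < f j u') [m..<8 * m]"
      by (rule sorted_wrt_mono_rel[of _ "(<)"]) (use r0 in \<open>auto simp: f_def sorted_wrt_upt\<close>)
    then show "sorted_wrt (<) (map (f j) [m..<8 * m])" by (simp add: sorted_wrt_map)
    fix u assume u: "u \<in> set [m..<8 * m]"
    show "f j u < 9 * m" using u r[OF j] by (auto simp: f_def)
    show "subseq (Y u) (top_content k g R low m (x j) j (f j u))"
    proof (cases "u = 4 * m + r 0")
      case True
      then have "f j u = 4 * m + r j" by (simp add: f_def)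
      then show ?thesis using y(2)[OF j] r[OF j] True
        by (auto simp: Y_def top_content_def intro: subseq_drop_many subseq_rev_drop_many)
    next
      case False
      show ?thesis
      proof (cases "4 * m \<le> u \<and> u < 5 * m")
        case True
        have "top_act m j (f j u)" using True r[OF j] r0 by (auto simp: top_act_def f_def)
        then show ?thesis using False True
          by (auto simp: Y_def top_content_def intro: subseq_drop_many subseq_rev_drop_many)
      qed (use False in \<open>auto simp: Y_def\<close>)
    qed
  qed
  then have sub: "\<forall>j<k. subseq z (top_string k g R low H m (x j) j)" by (simp add: top_string_conv)
  have high: "inner_high k g R = low + 1"
    using low g by (simp add: inner_high_def)
  have "(\<Sum>u\<leftarrow>[m..<8 * m]. length (Y u)) = (\<Sum>u\<in>{m..<8 * m}. length (Y u))"
    by (simp add: interv_sum_list_conv_sum_set_nat)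
  also have "\<dots> = (\<Sum>u\<in>{m..<8 * m}. (if u = 4 * m + r 0 then 1 else 0) + (if u \<in> {4 * m..<5 * m} then low else 0))"
    by (rule sum.cong) (use r0 y high in \<open>auto simp: Y_def\<close>)
  also have "\<dots> = 1 + (\<Sum>u\<in>{m..<8 * m} \<inter> {4 * m..<5 * m}. low)"
  proof -
    have "4 * m + r 0 \<in> {m..<8 * m}" using r0 by simp
    then show ?thesis unfolding sum.distrib sum.inter_restrict[OF finite_atLeastLessThan]
      by (simp del: sum_constant atLeastLessThan_iff)
  qed
  also have "{m..<8 * m} \<inter> {4 * m..<5 * m} = {4 * m..<5 * m}" by auto
  finally have sY: "(\<Sum>u\<leftarrow>[m..<8 * m]. length (Y u)) = m * low + 1" by simp
  have "(\<Sum>u\<leftarrow>[m..<8 * m]. card {l\<in>{1..<k}. top_act m l (f l u)})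
      = (\<Sum>u\<in>{m..<8 * m}. \<Sum>l\<in>{1..<k}. if top_act m l (f l u) then 1 else 0)"
    unfolding interv_sum_list_conv_sum_set_nat atLeastLessThan_upt[symmetric]
    by (simp add: sum.If_cases Int_def)
  also have "\<dots> = (\<Sum>l\<in>{1..<k}. \<Sum>u\<in>{m..<8 * m}. if top_act m l (f l u) then 1 else 0)"
    by (rule sum.swap)
  also have "\<dots> = (\<Sum>l\<in>{1..<k}. 3 * m)"
  proof (rule sum.cong[OF refl])
    fix l assume l: "l \<in> {1..<k}"
    \<comment> \<open>The steps at which string \<open>l\<close> is active form a translate by less
      than \<open>m\<close> of the interval from \<open>3 * m\<close> to \<open>6 * m\<close>. It
      lies entirely in the range of steps, so all own separators of string \<open>l\<close> are
      used.\<close>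
    have "{u\<in>{m..<8 * m}. top_act m l (f l u)} = {3 * m + r 0 - r l..<6 * m + r 0 - r l}"
      using l r[of l] r0 by (auto simp: top_act_def f_def)
    then have "card {u\<in>{m..<8 * m}. top_act m l (f l u)} = 3 * m"
      using l r[of l] by simp
    then show "(\<Sum>u\<in>{m..<8 * m}. if top_act m l (f l u) then 1 else 0) = 3 * m"
      by (simp add: sum.If_cases Int_def)
  qed
  finally have "length z = m * low + H * ((k - 1) * (3 * m)) + 1"
    using sY by (simp add: z_def length_aligned)
  then show ?thesis using sub by blast
qed

section \<open>The letters of the strings\<close>

lemma map_upt_add: "map f [0..<a + b] = map f [0..<a] @ map (\<lambda>r. f (a + r)) [0..<b]"
  by (rule nth_equalityI) (auto simp: nth_append)

lemma map_upt_mult: "map f [0..<a * b] = concat (map (\<lambda>u. map (\<lambda>r. f (u * b + r)) [0..<b]) [0..<a])"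
proof (induction a)
  case (Suc a)
  have "map f [0..<Suc a * b] = map f [0..<a * b + b]" by (simp add: add.commute)
  also have "\<dots> = map f [0..<a * b] @ map (\<lambda>r. f (a * b + r)) [0..<b]" by (rule map_upt_add)
  finally show ?case using Suc by simp
qed simp

lemma filter_map_upt_mult:
  "filter Q (map f [0..<a * b]) = concat (map (\<lambda>u. filter Q (map (\<lambda>r. f (u * b + r)) [0..<b])) [0..<a])"
  unfolding map_upt_mult[of f a b] filter_concat map_map comp_def ..

lemma filter_map_upt_tail:
  assumes "a \<le> n" "\<And>t. a \<le> t \<Longrightarrow> \<not> Q (f t)"
  shows "filter Q (map f [0..<n]) = filter Q (map f [0..<a])"
proof -
  obtain d where "n = a + d" using assms(1) le_Suc_ex by blast
  then show ?thesis using assms(2) by (simp add: map_upt_add filter_empty_conv)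
qed

text \<open>
  String 0 is padded with the letter 3 and the other strings with the letter 4, so that all pieces have a fixed length
  but padding never takes part in a common subsequence.
\<close>

definition junk :: "nat \<Rightarrow> nat" where "junk j = (if j = 0 then 3 else 4)"

lemma filter_blocks:
  assumes "\<And>l. f l = (if ok l then sep l else a)" "\<And>l. l \<in> {1..<k} \<Longrightarrow> sep l \<noteq> a"
  shows "filter (\<lambda>s. s \<noteq> a) (map (\<lambda>r. f (r div w + 1)) [0..<(k - 1) * w]) = separators k sep w ok"
proof -
  have *: "[1..<k] = map Suc [0..<k - 1]" by (cases k) (auto simp: map_Suc_upt)
  have "map (\<lambda>r. f (r div w + 1)) [0..<(k - 1) * w] = concat (map (\<lambda>l. replicate w (f (l + 1))) [0..<k - 1])"
    unfolding map_upt_mult[of _ "k - 1"] by (rule arg_cong[where f = concat]) (auto simp: list_eq_iff_nth_eq)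
  then have "filter (\<lambda>s. s \<noteq> a) (map (\<lambda>r. f (r div w + 1)) [0..<(k - 1) * w])
      = concat (map (\<lambda>l. filter (\<lambda>s. s \<noteq> a) (replicate w (f (l + 1)))) [0..<k - 1])"
    by (simp add: filter_concat comp_def)
  also have "\<dots> = separators k sep w ok"
    unfolding separators_def * map_map comp_def
    using assms by (intro arg_cong[where f = concat] map_cong) auto
  finally show ?thesis .
qed

text \<open>The program has to produce single letters in constant time, so a letter is given as a
  function of its position. All slots have the same length \<open>(k + 1) * P\<close>:
  \<open>2 * P\<close> cells for a table, with the optional \<open>1\<close> at even and the
  \<open>0\<close> at odd places, and \<open>P\<close> cells for each of \<open>k - 1\<close>
  separators. Whatever is absent becomes padding.\<close>

definition inner_char :: "nat \<Rightarrow> nat \<Rightarrow> nat \<Rightarrow> (nat \<Rightarrow> bool) \<Rightarrow> nat \<Rightarrow> nat \<Rightarrow> nat" where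
  "inner_char k g R x j t = (let P = g * R; u = t div ((k + 1) * P); r = t mod ((k + 1) * P) in
     if r < P * 2 then
       if inner_act R j u then
         if r mod 2 = 1 then 0
         else if x (r div 2) \<and> (if j = 1 then r div 2 = u div (2 * R) * R + u mod (2 * R)
              else r div 2 div R = u div (2 * R)) then 1
         else junk j
       else junk j
     else let l = (r - P * 2) div P + 1 in if l \<noteq> j \<or> inner_act R j u then inner_sep l else junk j)"

definition gadget_length :: "nat \<Rightarrow> nat \<Rightarrow> nat \<Rightarrow> nat" where
  "gadget_length k g R = g * (2 * R) * ((k + 1) * (g * R))"

lemma filter_inner_char:
  assumes "1 \<le> k"
  shows "filter (\<lambda>s. s \<noteq> junk j) (map (inner_char k g R x j) [0..<gadget_length k g R]) = gadget k g R x j"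
proof -
  define P where "P = g * R"
  define content where "content u r = (if inner_act R j u then if r mod 2 = 1 then 0
         else if x (r div 2) \<and> (if j = 1 then r div 2 = u div (2 * R) * R + u mod (2 * R)
              else r div 2 div R = u div (2 * R)) then 1 else junk j else junk j)" for u r
  define sp where "sp u l = (if l \<noteq> j \<or> inner_act R l u then inner_sep l else junk j)" for u l
  define L where "L = (k + 1) * P"
  have char: "inner_char k g R x j (u * (L) + r)
      = (if r < P * 2 then content u r else sp u ((r - P * 2) div P + 1))" if "r < L" for u r
    using that unfolding inner_char_def Let_def P_def[symmetric] L_def[symmetric] content_def sp_def by auto
  have len: "L = P * 2 + (k - 1) * P"
    using assms by (cases k) (auto simp: algebra_simps L_def)
  have slot: "filter (\<lambda>s. s \<noteq> junk j) (map (\<lambda>r. inner_char k g R x j (u * (L) + r)) [0..<L])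
      = slot k inner_sep P (inner_act R) (inner_content g R x) j u" for u
  proof -
    have "map (\<lambda>r. inner_char k g R x j (u * (L) + r)) [0..<L]
        = map (\<lambda>r. if r < P * 2 then content u r else sp u ((r - P * 2) div P + 1)) [0..<P * 2 + (k - 1) * P]"
      unfolding len[symmetric] by (rule map_cong) (auto simp: char)
    also have "\<dots> = map (content u) [0..<P * 2] @ map (\<lambda>r. sp u (r div P + 1)) [0..<(k - 1) * P]"
      unfolding map_upt_add by simp
    finally have "filter (\<lambda>s. s \<noteq> junk j) (map (\<lambda>r. inner_char k g R x j (u * (L) + r)) [0..<L])
      = filter (\<lambda>s. s \<noteq> junk j) (map (content u) [0..<P * 2])
        @ filter (\<lambda>s. s \<noteq> junk j) (map (\<lambda>r. sp u (r div P + 1)) [0..<(k - 1) * P])"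
      by simp
    also have "filter (\<lambda>s. s \<noteq> junk j) (map (\<lambda>r. sp u (r div P + 1)) [0..<(k - 1) * P])
        = separators k inner_sep P (\<lambda>l. l \<noteq> j \<or> inner_act R l u)"
      by (rule filter_blocks) (auto simp: sp_def inner_sep_def junk_def)
    also have "filter (\<lambda>s. s \<noteq> junk j) (map (content u) [0..<P * 2]) = inner_content g R x j u"
    proof (cases "inner_act R j u")
      case True
      show ?thesis
        unfolding inner_content_def table_def map_upt_mult[of _ P] filter_concat P_def[symmetric] if_P[OF True] map_map
        by (rule arg_cong[where f = concat], rule map_cong)
          (auto simp: content_def True junk_def upt_rec[of 0] upt_rec[of 1] upt_rec[of "Suc 0"])
    next
      case False
      then show ?thesis by (auto simp: content_def inner_content_def filter_empty_conv)
    qed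
    finally show ?thesis by (simp add: slot_def)
  qed
  show ?thesis
    unfolding gadget_def slots_def gadget_length_def map_upt_mult[of _ "g * (2 * R)"] filter_concat map_map P_def[symmetric] L_def[symmetric]
    by (rule arg_cong[where f = concat], rule map_cong[OF refl]) (simp add: slot)
qed

lemma length_gadget: "1 \<le> k \<Longrightarrow> length (gadget k g R x j) \<le> gadget_length k g R"
  using filter_inner_char[of k j g R x, symmetric] by (simp add: le_trans[OF length_filter_le])

text \<open>The four summands are the filler of string 0, the padded gadget, the filler of the other
  strings, and \<open>H\<close> copies of each of \<open>k - 1\<close> separators. The padded length
  of a gadget doubles as the weight \<open>H\<close>, since it bounds the length of every
  gadget.\<close>

definition slot_length :: "nat \<Rightarrow> nat \<Rightarrow> nat \<Rightarrow> nat" where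
  "slot_length k low H = low + (H + (low + (k - 1) * H))"

definition top_char :: "nat \<Rightarrow> nat \<Rightarrow> nat \<Rightarrow> nat \<Rightarrow> nat \<Rightarrow> nat \<Rightarrow> (nat \<Rightarrow> nat \<Rightarrow> bool) \<Rightarrow> nat \<Rightarrow> nat \<Rightarrow> nat" where
  "top_char k g R low H m x j t = (let u = t div slot_length k low H; r = t mod slot_length k low H in
     if t < 9 * m * slot_length k low H then
       if r < low then if j = 0 \<and> top_act m j u then 2 else junk j
       else if r - low < H then
         if 4 * m \<le> u \<and> u < 5 * m then inner_char k g R (x (u - 4 * m)) j (r - low) else junk j
       else if r - low - H < low then if j \<noteq> 0 \<and> top_act m j u then 2 else junk j
       else let l = (r - low - H - low) div H + 1 in if l \<noteq> j \<or> top_act m j u then top_sep k l else junk j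
     else junk j)"

lemma filter_top_char:
  assumes k: "1 \<le> k" and N: "9 * m * slot_length k low (gadget_length k g R) \<le> N"
  shows "filter (\<lambda>s. s \<noteq> junk j) (map (top_char k g R low (gadget_length k g R) m x j) [0..<N])
    = top_string k g R low (gadget_length k g R) m x j"
proof -
  define H where "H = gadget_length k g R"
  define \<Lambda> where "\<Lambda> = slot_length k low H"
  let ?c = "top_char k g R low H m x j"
  define ch where "ch u r = (
       if r < low then if j = 0 \<and> top_act m j u then 2 else junk j
       else if r - low < H then
         if 4 * m \<le> u \<and> u < 5 * m then inner_char k g R (x (u - 4 * m)) j (r - low) else junk j
       else if r - low - H < low then if j \<noteq> 0 \<and> top_act m j u then 2 else junk j
       else let l = (r - low - H - low) div H + 1 in if l \<noteq> j \<or> top_act m j u then top_sep k l else junk j)" for u r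
  have char: "?c (u * \<Lambda> + r) = ch u r" if "r < \<Lambda>" "u < 9 * m" for u r
  proof -
    have "u * \<Lambda> + r < (u + 1) * \<Lambda>" using that by simp
    also have "\<dots> \<le> 9 * m * \<Lambda>" using that by (intro mult_right_mono) auto
    finally show ?thesis using that by (simp add: top_char_def ch_def Let_def \<Lambda>_def[symmetric])
  qed
  have f2: "junk j \<noteq> 2" by (simp add: junk_def)
  let ?f = "filter (\<lambda>s. s \<noteq> junk j)"
  have slot: "?f (map (ch u) [0..<\<Lambda>]) = slot k (top_sep k) H (top_act m) (top_content k g R low m x) j u" for u
  proof -
    define sp where "sp l = (if l \<noteq> j \<or> top_act m l u then top_sep k l else junk j)" for l
    have a1: "map (ch u) [0..<low] = replicate low (if j = 0 \<and> top_act m j u then 2 else junk j)"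
      by (auto simp: ch_def list_eq_iff_nth_eq)
    have a2: "map (\<lambda>r. ch u (low + r)) [0..<H] = (if 4 * m \<le> u \<and> u < 5 * m
        then map (inner_char k g R (x (u - 4 * m)) j) [0..<H] else replicate H (junk j))"
      by (auto simp: ch_def list_eq_iff_nth_eq)
    have a3: "map (\<lambda>r. ch u (low + (H + r))) [0..<low] = replicate low (if j \<noteq> 0 \<and> top_act m j u then 2 else junk j)"
      by (auto simp: ch_def list_eq_iff_nth_eq)
    have a4: "map (\<lambda>r. ch u (low + (H + (low + r)))) [0..<(k - 1) * H] = map (\<lambda>r. sp (r div H + 1)) [0..<(k - 1) * H]"
      by (rule map_cong) (auto simp: ch_def sp_def Let_def)
    have "?f (map (\<lambda>r. sp (r div H + 1)) [0..<(k - 1) * H])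
        = separators k (top_sep k) H (\<lambda>l. l \<noteq> j \<or> top_act m l u)"
      by (rule filter_blocks) (auto simp: sp_def top_sep_def junk_def)
    then show ?thesis
      unfolding \<Lambda>_def slot_length_def map_upt_add a1 a2 a3 a4 filter_append
      using f2 filter_inner_char[OF k, of j g R "x (u - 4 * m)"]
      by (auto simp: slot_def top_content_def H_def)
  qed
  have "?f (map ?c [0..<N]) = ?f (map ?c [0..<9 * m * \<Lambda>])"
  proof (rule filter_map_upt_tail)
    show "9 * m * \<Lambda> \<le> N" using N unfolding \<Lambda>_def H_def .
    show "\<not> ?c t \<noteq> junk j" if "9 * m * \<Lambda> \<le> t" for t
      using that unfolding top_char_def Let_def \<Lambda>_def[symmetric] by simp
  qed
  also have "\<dots> = concat (map (\<lambda>u. ?f (map (\<lambda>r. ?c (u * \<Lambda> + r)) [0..<\<Lambda>])) [0..<9 * m])"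
    by (rule filter_map_upt_mult)
  also have "\<dots> = concat (map (\<lambda>u. ?f (map (ch u) [0..<\<Lambda>])) [0..<9 * m])"
  proof (intro arg_cong[where f = concat] map_cong[OF refl] arg_cong[where f = ?f])
    fix u r assume "u \<in> set [0..<9 * m]" "r \<in> set [0..<\<Lambda>]"
    then have "u < 9 * m" "r < \<Lambda>" by simp_all
    then show "?c (u * \<Lambda> + r) = ch u r" by (intro char)
  qed
  also have "\<dots> = top_string k g R low H m x j"
    unfolding slot top_string_def slots_def ..
  finally show ?thesis unfolding H_def .
qed

section \<open>Removing the padding and bounding the alphabet\<close>

lemma finite_common_subseqs:
  "ss \<noteq> [] \<Longrightarrow> finite {length z | z. \<forall>s\<in>set ss. subseq z s}"
  by (rule finite_subset[of _ "{..length (hd ss)}"]) (auto dest!: list_emb_length hd_in_set bspec)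

lemma less_lcs_length_iff:
  assumes "ss \<noteq> []"
  shows "d < lcs_length ss \<longleftrightarrow> (\<exists>z. d < length z \<and> (\<forall>s\<in>set ss. subseq z s))"
proof -
  have "{length z | z. \<forall>s\<in>set ss. subseq z s} \<noteq> {}" by (auto intro: exI[of _ "[]"])
  then show ?thesis
    unfolding lcs_length_def by (subst Max_gr_iff[OF finite_common_subseqs[OF assms]]) blast+
qed

lemma inner_char_le: "1 \<le> k \<Longrightarrow> 0 < g * R \<Longrightarrow> inner_char k g R x j t < 4 + k"
proof -
  assume k: "1 \<le> k" and P: "0 < g * R"
  have "(t mod ((k + 1) * (g * R)) - g * R * 2) div (g * R) < k - 1 \<or> k = 1"
    if "\<not> t mod ((k + 1) * (g * R)) < g * R * 2"
  proof -
    have "t mod ((k + 1) * (g * R)) < (k + 1) * (g * R)" using P by (intro mod_less_divisor) simp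
    also have "(k + 1) * (g * R) = (k - 1) * (g * R) + g * R * 2"
      using k by (cases k) (auto simp: algebra_simps)
    finally show ?thesis using that by (auto intro!: less_mult_imp_div_less)
  qed
  moreover have "t mod ((k + 1) * (g * R)) < g * R * 2" if "k = 1"
  proof -
    have "(k + 1) * (g * R) = g * R * 2" using that by simp
    then show ?thesis using P by (metis mod_less_divisor nat_0_less_mult_iff zero_less_numeral)
  qed
  ultimately show ?thesis using k by (auto simp: inner_char_def Let_def inner_sep_def junk_def)
qed

text \<open>The largest separator is \<open>top_sep k (k - 1) = 2 * k + 3\<close>, which is below
  \<open>4 * k\<close> because of \<open>k \<ge> 2\<close>. This is the origin of the factor 4 in
  the alphabet size.\<close>

lemma top_char_less:
  assumes k: "2 \<le> k" and P: "0 < g * R"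
  shows "top_char k g R low (gadget_length k g R) m x j t < 4 * k"
proof -
  let ?H = "gadget_length k g R"
  let ?r = "t mod slot_length k low ?H"
  have H: "0 < ?H" using P by (simp add: gadget_length_def)
  have j: "junk j < 4 * k" using k by (simp add: junk_def)
  have i: "inner_char k g R x j t < 4 * k" for x t using inner_char_le[OF _ P, of k x j t] k by simp
  have "(?r - low - ?H - low) div ?H < k - 1"
  proof -
    have "?r < slot_length k low ?H" using H by (intro mod_less_divisor) (simp add: slot_length_def)
    also have "\<dots> = low + (?H + (low + (k - 1) * ?H))" by (simp add: slot_length_def)
    finally have "?r - low - ?H - low < (k - 1) * ?H" using H k by (cases "low + (?H + low) \<le> ?r") auto
    then show ?thesis by (rule less_mult_imp_div_less)
  qed
  then have "top_sep k ((?r - low - ?H - low) div ?H + 1) < 4 * k" using k by (simp add: top_sep_def)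
  then show ?thesis using k j i by (auto simp: top_char_def Let_def)
qed

definition threshold :: "nat \<Rightarrow> nat \<Rightarrow> nat \<Rightarrow> nat \<Rightarrow> nat" where
  "threshold k low H m = m * low + H * ((k - 1) * (3 * m))"

text \<open>String 0 does not contain \<open>4\<close> and string 1 does not contain
  \<open>3\<close>, so no common subsequence contains either, and deleting the padding loses none.
  For the strings without padding, the upper bound without an orthogonal tuple is
  \<open>threshold\<close>, and an orthogonal tuple yields one letter more.\<close>

lemma lcs_iff:
  assumes k: "2 \<le> k" and R: "0 < R" and g: "0 < g"
    and low: "low = inner_high k g R - 1" and H: "H = gadget_length k g R"
    and N: "9 * m * slot_length k low H \<le> N"
  shows "threshold k low H m < lcs_length (map (\<lambda>j. map (top_char k g R low H m (x j) j) [0..<N]) [0..<k])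
    \<longleftrightarrow> (\<exists>r. (\<forall>j<k. r j < m) \<and> (\<forall>i<g. \<exists>t<R. \<forall>j<k. x j (r j) (i * R + t)))"
    (is "_ < lcs_length ?ss \<longleftrightarrow> ?rhs")
proof -
  have ne: "?ss \<noteq> []" using k by simp
  let ?raw = "\<lambda>j. map (top_char k g R low H m (x j) j) [0..<N]"
  have fil: "filter (\<lambda>s. s \<noteq> junk j) (?raw j) = top_string k g R low H m (x j) j" for j
    using filter_top_char[of k m low g R N] k N unfolding H by auto
  show ?thesis
  proof
    assume "threshold k low H m < lcs_length ?ss"
    then obtain z where z: "threshold k low H m < length z" "\<And>j. j < k \<Longrightarrow> subseq z (?raw j)"
      unfolding less_lcs_length_iff[OF ne] by auto
    have char: "inner_char k g R y 0 t \<noteq> 4" "j \<noteq> 0 \<Longrightarrow> inner_char k g R y j t \<noteq> 3" for y j t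
      by (auto simp: inner_char_def Let_def junk_def inner_sep_def)
    have "4 \<notin> set (?raw 0)" "3 \<notin> set (?raw 1)"
      using char(1) char(2)[of 1] by (auto simp: top_char_def Let_def top_sep_def junk_def split: if_splits)
    then have "3 \<notin> set z" "4 \<notin> set z"
      using subseq_set[OF z(2)[of 1]] subseq_set[OF z(2)[of 0]] k by auto
    then have "junk j \<notin> set z" for j by (auto simp: junk_def)
    then have "subseq z (top_string k g R low H m (x j) j)" if "j < k" for j
      using subseq_filter_right[OF z(2)[OF that], of "\<lambda>s. s \<noteq> junk j"] fil by metis
    note sub = this
    show ?rhs
    proof (rule ccontr)
      assume no: "\<not> ?rhs"
      have "length z \<le> threshold k low H m"
        unfolding threshold_def
      proof (rule top_upper[where x = x, OF k R _ low sub])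
        show "length (gadget k g R y 0) \<le> H" for y using length_gadget[of k] k unfolding H by simp
        show "\<not> (\<forall>i<g. \<exists>t<R. \<forall>j<k. x j (r j) (i * R + t))" if "\<And>j. j < k \<Longrightarrow> r j < m" for r
          using no that by blast
      qed
      then show False using z(1) by simp
    qed
  next
    assume ?rhs
    then obtain z where z: "length z = threshold k low H m + 1"
      "\<And>j. j < k \<Longrightarrow> subseq z (top_string k g R low H m (x j) j)"
      unfolding threshold_def using top_lower[OF k R g low, of _ m x H] by blast
    have "subseq z (?raw j)" if "j < k" for j
      using z(2)[OF that] unfolding fil[symmetric] by (meson subseq_filter_left subseq_order.trans)
    then show "threshold k low H m < lcs_length ?ss"
      unfolding less_lcs_length_iff[OF ne] using z(1) by (intro exI[of _ z]) auto
  qed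
qed

section \<open>Running times on the word RAM\<close>

text \<open>\<open>R\<close> collects the cells that the run loads from, at most one per step. If
  the memory is changed on a set \<open>D\<close> disjoint from \<open>R\<close>, then by induction
  on the run the registers, and with them all tests and addresses, are the same, and the memories
  agree outside \<open>D\<close> throughout. This supports an adversary argument.\<close>

lemma exec_reads:
  assumes "exec w P s t s'"
  shows "\<exists>R. finite R \<and> card R \<le> t \<and> (\<forall>D s2. D \<inter> R = {} \<longrightarrow> reg s2 = reg s \<longrightarrow>
    (\<forall>a i. (a, i) \<notin> D \<longrightarrow> mem s2 a i = mem s a i) \<longrightarrow>
    (\<exists>s2'. exec w P s2 t s2' \<and> reg s2' = reg s' \<and> (\<forall>a i. (a, i) \<notin> D \<longrightarrow> mem s2' a i = mem s' a i)))"
  using assms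
proof induction
  case (Skip s)
  show ?case by (rule exI[of _ "{}"]) (use exec.Skip[of w] in auto)
next
  case (Const r c s)
  show ?case by (intro exI[of _ "{}"] conjI allI impI)
      (simp_all, rule exI, rule conjI[OF exec.Const[unfolded One_nat_def]], auto)
next
  case (Op f r p q s)
  show ?case by (intro exI[of _ "{}"] conjI allI impI)
      (simp_all, rule exI, rule conjI[OF exec.Op[unfolded One_nat_def]], auto)
next
  case (Load r a p s)
  show ?case by (intro exI[of _ "{(a, reg s p)}"] conjI allI impI)
      (simp_all, rule exI, rule conjI[OF exec.Load[unfolded One_nat_def]], auto)
next
  case (Store a p r s)
  show ?case by (intro exI[of _ "{}"] conjI allI impI)
      (simp_all, rule exI, rule conjI[OF exec.Store[unfolded One_nat_def]], auto)
next
  case (Seq P s t s' Q u s'')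
  obtain R1 where R1: "finite R1" "card R1 \<le> t" "\<And>D s2. D \<inter> R1 = {} \<Longrightarrow> reg s2 = reg s \<Longrightarrow>
    (\<forall>a i. (a, i) \<notin> D \<longrightarrow> mem s2 a i = mem s a i) \<Longrightarrow>
    \<exists>s2'. exec w P s2 t s2' \<and> reg s2' = reg s' \<and> (\<forall>a i. (a, i) \<notin> D \<longrightarrow> mem s2' a i = mem s' a i)"
    using Seq.IH(1) by blast
  obtain R2 where R2: "finite R2" "card R2 \<le> u" "\<And>D s2. D \<inter> R2 = {} \<Longrightarrow> reg s2 = reg s' \<Longrightarrow>
    (\<forall>a i. (a, i) \<notin> D \<longrightarrow> mem s2 a i = mem s' a i) \<Longrightarrow>
    \<exists>s2'. exec w Q s2 u s2' \<and> reg s2' = reg s'' \<and> (\<forall>a i. (a, i) \<notin> D \<longrightarrow> mem s2' a i = mem s'' a i)"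
    using Seq.IH(2) by blast
  have "card (R1 \<union> R2) \<le> t + u" using card_Un_le[of R1 R2] R1 R2 by linarith
  moreover have "\<exists>s2'. exec w (program.Seq P Q) s2 (t + u) s2' \<and> reg s2' = reg s'' \<and> (\<forall>a i. (a, i) \<notin> D \<longrightarrow> mem s2' a i = mem s'' a i)"
    if "D \<inter> (R1 \<union> R2) = {}" "reg s2 = reg s" "\<forall>a i. (a, i) \<notin> D \<longrightarrow> mem s2 a i = mem s a i" for D s2
  proof -
    from R1(3)[of D s2] that obtain s3 where s3: "exec w P s2 t s3" "reg s3 = reg s'"
      "\<forall>a i. (a, i) \<notin> D \<longrightarrow> mem s3 a i = mem s' a i" by blast
    from R2(3)[of D s3] that s3 show ?thesis by (blast intro: exec.Seq)
  qed
  ultimately show ?case using R1(1) R2(1) by (intro exI[of _ "R1 \<union> R2"]) blast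
next
  case (IfTrue b s P t s' Q)
  then obtain R where R: "finite R" "card R \<le> t" "\<forall>D s2. D \<inter> R = {} \<longrightarrow> reg s2 = reg s \<longrightarrow>
    (\<forall>a i. (a, i) \<notin> D \<longrightarrow> mem s2 a i = mem s a i) \<longrightarrow>
    (\<exists>s2'. exec w P s2 t s2' \<and> reg s2' = reg s' \<and> (\<forall>a i. (a, i) \<notin> D \<longrightarrow> mem s2' a i = mem s' a i))" by blast
  have "holds b s2" if "reg s2 = reg s" for s2 using IfTrue(1) that by (cases b) auto
  then show ?case using R by (intro exI[of _ R]) (meson exec.IfTrue trans_le_add2)
next
  case (IfFalse b s Q t s' P)
  then obtain R where R: "finite R" "card R \<le> t" "\<forall>D s2. D \<inter> R = {} \<longrightarrow> reg s2 = reg s \<longrightarrow>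
    (\<forall>a i. (a, i) \<notin> D \<longrightarrow> mem s2 a i = mem s a i) \<longrightarrow>
    (\<exists>s2'. exec w Q s2 t s2' \<and> reg s2' = reg s' \<and> (\<forall>a i. (a, i) \<notin> D \<longrightarrow> mem s2' a i = mem s' a i))" by blast
  have "\<not> holds b s2" if "reg s2 = reg s" for s2 using IfFalse(1) that by (cases b) auto
  then show ?case using R by (intro exI[of _ R]) (meson exec.IfFalse trans_le_add2)
next
  case (WhileFalse b s P)
  have "\<not> holds b s2" if "reg s2 = reg s" for s2 using WhileFalse that by (cases b) auto
  then show ?case by (intro exI[of _ "{}"] conjI allI impI)
      (simp_all, metis exec.WhileFalse[unfolded One_nat_def])
next
  case (WhileTrue b s P t s' u s'')
  obtain R1 where R1: "finite R1" "card R1 \<le> t" "\<And>D s2. D \<inter> R1 = {} \<Longrightarrow> reg s2 = reg s \<Longrightarrow>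
    (\<forall>a i. (a, i) \<notin> D \<longrightarrow> mem s2 a i = mem s a i) \<Longrightarrow>
    \<exists>s2'. exec w P s2 t s2' \<and> reg s2' = reg s' \<and> (\<forall>a i. (a, i) \<notin> D \<longrightarrow> mem s2' a i = mem s' a i)"
    using WhileTrue.IH(1) by blast
  obtain R2 where R2: "finite R2" "card R2 \<le> u" "\<And>D s2. D \<inter> R2 = {} \<Longrightarrow> reg s2 = reg s' \<Longrightarrow>
    (\<forall>a i. (a, i) \<notin> D \<longrightarrow> mem s2 a i = mem s' a i) \<Longrightarrow>
    \<exists>s2'. exec w (While b P) s2 u s2' \<and> reg s2' = reg s'' \<and> (\<forall>a i. (a, i) \<notin> D \<longrightarrow> mem s2' a i = mem s'' a i)"
    using WhileTrue.IH(2) by blast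
  have hb: "holds b s2" if "reg s2 = reg s" for s2 using WhileTrue(1) that by (cases b) auto
  have "card (R1 \<union> R2) \<le> 1 + t + u" using card_Un_le[of R1 R2] R1 R2 by linarith
  moreover have "\<exists>s2'. exec w (While b P) s2 (1 + t + u) s2' \<and> reg s2' = reg s'' \<and> (\<forall>a i. (a, i) \<notin> D \<longrightarrow> mem s2' a i = mem s'' a i)"
    if "D \<inter> (R1 \<union> R2) = {}" "reg s2 = reg s" "\<forall>a i. (a, i) \<notin> D \<longrightarrow> mem s2 a i = mem s a i" for D s2
  proof -
    from R1(3)[of D s2] that obtain s3 where s3: "exec w P s2 t s3" "reg s3 = reg s'"
      "\<forall>a i. (a, i) \<notin> D \<longrightarrow> mem s3 a i = mem s' a i" by blast
    from R2(3)[of D s3] that s3 hb show ?thesis by (blast intro: exec.WhileTrue)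
  qed
  ultimately show ?case using R1(1) R2(1) by (intro exI[of _ "R1 \<union> R2"]) blast
qed

lemma lcs_length_replicate: "0 < k \<Longrightarrow> lcs_length (replicate k s) = length s"
  unfolding lcs_length_def
  by (rule Max_eqI) (auto intro!: exI[of _ s] list_emb_length finite_subset[of _ "{..length s}"])

text \<open>
  On \<open>k\<close> copies of \<open>0\<^sup>n\<close>, changing any letter of the first string changes the answer, so each of them has to be read.
\<close>

lemma k_LCS_time_lower_bound:
  assumes k: "2 \<le> k" and \<sigma>: "2 \<le> \<sigma>"
    and P: "\<And>xs y. (xs, y) \<in> k_LCS k \<sigma> n \<Longrightarrow> \<exists>t s. exec w P (initial_state xs) t s \<and> t \<le> T \<and> reg s 0 = y"
  shows "n \<le> T"
proof (cases "n = 0")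
  case n: False
  \<comment> \<open>For \<open>i = n\<close> the update is out of range and has no effect, so
    \<open>ss n\<close> is the unmodified instance.\<close>
  define ss :: "nat \<Rightarrow> nat list list"
    where "ss i = (replicate n 0)[i := 1] # replicate (k - 1) (replicate n 0)" for i
  define xs where "xs i = n # concat (ss i)" for i
  have in_LCS: "(xs i, lcs_length (ss i)) \<in> k_LCS k \<sigma> n" for i
  proof -
    have "set ((replicate n 0)[i := 1]) \<subseteq> {0, 1::nat}"
      by (rule order.trans[OF set_update_subset_insert]) auto
    also have "{0, 1} \<subseteq> {..<\<sigma>}" using \<sigma> by auto
    finally show ?thesis
      unfolding k_LCS_def xs_def using k \<sigma> by (auto simp: ss_def intro!: exI[of _ "ss i"])
  qed
  have "ss n = replicate k (replicate n 0)" using k by (cases k) (auto simp: ss_def list_update_beyond)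
  then have full: "lcs_length (ss n) = n" using k by (simp add: lcs_length_replicate)
  have part: "lcs_length (ss i) \<noteq> n" if i: "i < n" for i
  proof
    assume eq: "lcs_length (ss i) = n"
    have "n - 1 < lcs_length (ss i)" using eq n by simp
    then obtain z where z: "n - 1 < length z" "\<forall>s\<in>set (ss i). subseq z s"
      using less_lcs_length_iff[of "ss i"] by (auto simp: ss_def)
    have z1: "subseq z ((replicate n 0)[i := 1])" using z by (simp add: ss_def)
    have z2: "subseq z (replicate n 0)" using z k by (simp add: ss_def)
    have "length z = n" using z(1) list_emb_length[OF z2] by simp
    then have "(replicate n 0)[i := 1] = replicate n (0::nat)"
      using subseq_same_length[OF z1] subseq_same_length[OF z2] by simp
    then show False using i by (metis length_replicate nth_list_update_eq nth_replicate zero_neq_one)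
  qed
  obtain t s where t: "exec w P (initial_state (xs n)) t s" "t \<le> T" "reg s 0 = n"
    using P[OF in_LCS[of n]] full by auto
  from exec_reads[OF t(1)] obtain R where R: "finite R" "card R \<le> t"
    "\<And>D s2. \<lbrakk>D \<inter> R = {}; reg s2 = reg (initial_state (xs n));
       \<forall>a i. (a, i) \<notin> D \<longrightarrow> mem s2 a i = mem (initial_state (xs n)) a i\<rbrakk> \<Longrightarrow>
       \<exists>s2'. exec w P s2 t s2' \<and> reg s2' = reg s \<and> (\<forall>a i. (a, i) \<notin> D \<longrightarrow> mem s2' a i = mem s a i)"
    by (elim exE conjE) metis
  \<comment> \<open>Cell 0 of the input holds the length, hence the shift by one. If the cell were
    not read, the modified instance would get the same answer \<open>n\<close>.\<close>
  have "(0, i + 1) \<in> R" if i: "i < n" for i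
  proof (rule ccontr)
    assume "(0, i + 1) \<notin> R"
    moreover have "mem (initial_state (xs i)) a l = mem (initial_state (xs n)) a l" if "(a, l) \<notin> {(0, i + 1)}" for a l
      using that i by (auto simp: initial_state_def xs_def ss_def nth_Cons nth_append nth_list_update split: nat.split)
    moreover have "reg (initial_state (xs i)) = reg (initial_state (xs n))" by (simp add: initial_state_def)
    ultimately obtain s2 where "exec w P (initial_state (xs i)) t s2" "reg s2 = reg s"
      using R(3)[of "{(0, i + 1)}" "initial_state (xs i)"] by blast
    then show False
      using P[OF in_LCS[of i]] part[OF i] exec_deterministic t(3) by metis
  qed
  then have "(\<lambda>i. (0, i + 1)) ` {..<n} \<subseteq> R" by auto
  then have "card ((\<lambda>i. (0::nat, i + 1)) ` {..<n}) \<le> card R" using R(1) by (rule card_mono[rotated])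
  also have "card ((\<lambda>i. (0::nat, i + 1)) ` {..<n}) = n" by (subst card_image) (auto simp: inj_on_def)
  finally show ?thesis using R(2) t(2) by linarith
qed simp

section \<open>Total correctness with a bound on the number of steps\<close>

definition runs :: "nat \<Rightarrow> program \<Rightarrow> state \<Rightarrow> nat \<Rightarrow> (state \<Rightarrow> bool) \<Rightarrow> bool" where
  "runs w P s T Q \<longleftrightarrow> (\<exists>t s'. exec w P s t s' \<and> t \<le> T \<and> Q s')"

lemma runs_weaken: "runs w P s T Q \<Longrightarrow> T \<le> T' \<Longrightarrow> (\<And>s. Q s \<Longrightarrow> Q' s) \<Longrightarrow> runs w P s T' Q'"
  unfolding runs_def by (meson le_trans)

lemma runs_Skip: "Q s \<Longrightarrow> runs w Skip s 1 Q"
  unfolding runs_def by (blast intro: exec.Skip)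

lemma runs_Const: "Q (s\<lparr>reg := (reg s)(r := c mod 2 ^ w)\<rparr>) \<Longrightarrow> runs w (Const r c) s 1 Q"
  unfolding runs_def by (blast intro: exec.Const)

lemma runs_Op: "Q (s\<lparr>reg := (reg s)(r := apply_op w f (reg s p) (reg s q))\<rparr>) \<Longrightarrow> runs w (Op f r p q) s 1 Q"
  unfolding runs_def by (blast intro: exec.Op)

lemma runs_Load: "Q (s\<lparr>reg := (reg s)(r := mem s a (reg s p))\<rparr>) \<Longrightarrow> runs w (Load r a p) s 1 Q"
  unfolding runs_def by (blast intro: exec.Load)

lemma runs_Store: "Q (s\<lparr>mem := (mem s)(a := (mem s a)(reg s p := reg s r))\<rparr>) \<Longrightarrow> runs w (Store a p r) s 1 Q"
  unfolding runs_def by (blast intro: exec.Store)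

lemma runs_Seq:
  "runs w P s T R \<Longrightarrow> (\<And>s'. R s' \<Longrightarrow> runs w P' s' T' Q) \<Longrightarrow> runs w (Seq P P') s (T + T') Q"
  unfolding runs_def by (meson add_mono exec.Seq)

lemma runs_If:
  "(holds b s \<Longrightarrow> runs w P s T Q) \<Longrightarrow> (\<not> holds b s \<Longrightarrow> runs w P' s T Q) \<Longrightarrow> runs w (If b P P') s (1 + T) Q"
  unfolding runs_def by (meson add_left_mono exec.IfTrue exec.IfFalse)

text \<open>The number \<open>n\<close> of iterations is fixed in advance and indexes the invariant,
  so termination comes with it. An iteration costs \<open>T\<close> steps and one test, and one more
  test ends the loop.\<close>

lemma runs_While:
  assumes "Inv 0 s"
    and "\<And>i s. Inv i s \<Longrightarrow> i < n \<Longrightarrow> holds b s \<and> runs w P s T (Inv (Suc i))"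
    and "\<And>s. Inv n s \<Longrightarrow> \<not> holds b s"
  shows "runs w (While b P) s (n * (T + 1) + 1) (Inv n)"
proof -
  have "runs w (While b P) s ((n - i) * (T + 1) + 1) (Inv n)" if "i \<le> n" "Inv i s" for i s
    using that
  proof (induction "n - i" arbitrary: i s)
    case 0
    then have "i = n" by simp
    then show ?case using 0 assms(3)[of s] exec.WhileFalse[of b s w P] by (auto simp: runs_def)
  next
    case (Suc d)
    then have i: "i < n" by simp
    from assms(2)[OF Suc.prems(2) i] obtain t s' where b: "holds b s" "exec w P s t s'" "t \<le> T" "Inv (Suc i) s'"
      by (auto simp: runs_def)
    have "runs w (While b P) s' ((n - Suc i) * (T + 1) + 1) (Inv n)"
      using Suc.hyps(1)[of "Suc i" s'] Suc.hyps(2) i b by auto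
    then obtain u s'' where u: "exec w (While b P) s' u s''" "u \<le> (n - Suc i) * (T + 1) + 1" "Inv n s''"
      by (auto simp: runs_def)
    have "exec w (While b P) s (1 + t + u) s''" using exec.WhileTrue b u by blast
    moreover have "1 + t + u \<le> (n - i) * (T + 1) + 1"
    proof -
      have "n - i = Suc (n - Suc i)" using i by simp
      then show ?thesis using b u by simp
    qed
    ultimately show ?case using u(3) by (auto simp: runs_def)
  qed
  from this[of 0 s] assms(1) show ?thesis by simp
qed

section \<open>Compiling arithmetic expressions\<close>

text \<open>
  Registers are split into the variables of the program, the temporaries of expression evaluation and
  the registers of the simulated program.
\<close>

definition vreg :: "nat \<Rightarrow> nat" where "vreg i = 4 * i + 1"
definition treg :: "nat \<Rightarrow> nat" where "treg i = 4 * i + 3"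
definition sreg :: "nat \<Rightarrow> nat" where "sreg i = 2 * i"

lemma reg_simps [simp]:
  "vreg i = vreg j \<longleftrightarrow> i = j" "treg i = treg j \<longleftrightarrow> i = j" "sreg i = sreg j \<longleftrightarrow> i = j"
  "vreg i \<noteq> treg j" "treg j \<noteq> vreg i" "vreg i \<noteq> sreg j" "sreg j \<noteq> vreg i" "treg i \<noteq> sreg j" "sreg j \<noteq> treg i"
  by (auto simp: vreg_def treg_def sreg_def) presburger+

definition vars :: "state \<Rightarrow> nat \<Rightarrow> nat" where "vars s i = reg s (vreg i)"
definition sregs :: "state \<Rightarrow> nat \<Rightarrow> nat" where "sregs s i = reg s (sreg i)"

lemma view_simps [simp]:
  "vars (s\<lparr>reg := (reg s)(vreg x := v)\<rparr>) = (vars s)(x := v)"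
  "vars (s\<lparr>reg := (reg s)(treg x := v)\<rparr>) = vars s"
  "vars (s\<lparr>reg := (reg s)(sreg x := v)\<rparr>) = vars s"
  "vars (s\<lparr>mem := \<mu>\<rparr>) = vars s"
  "sregs (s\<lparr>reg := (reg s)(vreg x := v)\<rparr>) = sregs s"
  "sregs (s\<lparr>reg := (reg s)(treg x := v)\<rparr>) = sregs s"
  "sregs (s\<lparr>reg := (reg s)(sreg x := v)\<rparr>) = (sregs s)(x := v)"
  "sregs (s\<lparr>mem := \<mu>\<rparr>) = sregs s"
  "reg s (vreg x) = vars s x" "reg s (sreg x) = sregs s x"
  by (simp_all add: vars_def sregs_def fun_eq_iff)

text \<open>
  \<open>Bin Sub\<close> is truncated subtraction on the natural numbers; the operations that \<open>nat_op\<close> does not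
  interpret are not used.
\<close>

datatype expr =
    Var nat | Lit nat | Bin operation expr expr | Arr expr
  | Cond bool expr expr expr expr

abbreviation "IfLess \<equiv> Cond True"
abbreviation "IfEq \<equiv> Cond False"

fun nat_op :: "operation \<Rightarrow> nat \<Rightarrow> nat \<Rightarrow> nat" where
  "nat_op Add x y = x + y"
| "nat_op Sub x y = x - y"
| "nat_op Mul x y = x * y"
| "nat_op Div x y = x div y"
| "nat_op Mod x y = x mod y"
| "nat_op And x y = x AND y"
| "nat_op _ x y = 0"

primrec val :: "(nat \<Rightarrow> nat) \<Rightarrow> (nat \<Rightarrow> nat) \<Rightarrow> expr \<Rightarrow> nat" where
  "val \<rho> a (Var i) = \<rho> i"
| "val \<rho> a (Lit c) = c"
| "val \<rho> a (Bin f x y) = nat_op f (val \<rho> a x) (val \<rho> a y)"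
| "val \<rho> a (Arr x) = a (val \<rho> a x)"
| "val \<rho> a (Cond l x y p q) = (if (if l then val \<rho> a x < val \<rho> a y else val \<rho> a x = val \<rho> a y)
     then val \<rho> a p else val \<rho> a q)"

primrec expr_size :: "expr \<Rightarrow> nat" where
  "expr_size (Var i) = 1"
| "expr_size (Lit c) = 1"
| "expr_size (Bin f x y) = expr_size x + expr_size y"
| "expr_size (Arr x) = expr_size x + 1"
| "expr_size (Cond l x y p q) = expr_size x + expr_size y + expr_size p + expr_size q"

primrec max_lit :: "expr \<Rightarrow> nat" where
  "max_lit (Var i) = 0"
| "max_lit (Lit c) = c"
| "max_lit (Bin f x y) = max (max_lit x) (max_lit y)"
| "max_lit (Arr x) = max_lit x"
| "max_lit (Cond l x y p q) = max (max (max_lit x) (max_lit y)) (max (max_lit p) (max_lit q))"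

text \<open>Machine subtraction wraps around, so truncated subtraction is guarded by a test.
  Operations that \<open>nat_op\<close> maps to 0 are compiled to 0, so that correctness can be
  stated for all operations alike.\<close>

fun op_code :: "operation \<Rightarrow> nat \<Rightarrow> program" where
  "op_code Sub d = If (Less (treg (d + 1)) (treg d)) (Op Sub (treg d) (treg d) (treg (d + 1))) (Const (treg d) 0)"
| "op_code Or d = Const (treg d) 0"
| "op_code Xor d = Const (treg d) 0"
| "op_code Shl d = Const (treg d) 0"
| "op_code Shr d = Const (treg d) 0"
| "op_code f d = Op f (treg d) (treg d) (treg (d + 1))"

text \<open>Code at depth \<open>d\<close> leaves its result in \<open>treg d\<close> and respects
  every \<open>treg i\<close> with \<open>i < d\<close>, where pending operands are kept. The
  instruction set has no move; \<open>x AND x\<close> copies a register.\<close>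

primrec comp_expr :: "nat \<Rightarrow> expr \<Rightarrow> program" where
  "comp_expr d (Var i) = Op And (treg d) (vreg i) (vreg i)"
| "comp_expr d (Lit c) = Const (treg d) c"
| "comp_expr d (Bin f x y) = Seq (comp_expr d x) (Seq (comp_expr (d + 1) y) (op_code f d))"
| "comp_expr d (Arr x) = Seq (comp_expr d x) (Load (treg d) 0 (treg d))"
| "comp_expr d (Cond l x y p q) = Seq (comp_expr d x) (Seq (comp_expr (d + 1) y)
     (If (if l then Less (treg d) (treg (d + 1)) else Eq (treg d) (treg (d + 1))) (comp_expr d p) (comp_expr d q)))"

primrec cost :: "expr \<Rightarrow> nat" where
  "cost (Var i) = 1"
| "cost (Lit c) = 1"
| "cost (Bin f x y) = cost x + (cost y + 2)"
| "cost (Arr x) = cost x + 1"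
| "cost (Cond l x y p q) = cost x + (cost y + (1 + max (cost p) (cost q)))"

lemma expr_size_pos: "1 \<le> expr_size e"
  by (induction e) auto

lemma and_nat_le: "x AND y \<le> (x::nat)"
proof -
  have "int (x AND y) \<le> int x" unfolding of_nat_and_eq by (rule AND_upper1) simp
  then show ?thesis by simp
qed

text \<open>If the operands are bounded by \<open>p\<close> and \<open>q\<close>, both at least 2,
  then every operation yields at most \<open>p * q\<close>, so exponents add up. As the bound
  applies to subexpressions too, the single inequality \<open>B ^ expr_size e < 2 ^ w\<close>
  excludes overflow in all intermediate results.\<close>

lemma val_le:
  assumes "\<And>i. \<rho> i \<le> B" "\<And>i. a i \<le> B" "2 \<le> B" "max_lit e \<le> B"
  shows "val \<rho> a e \<le> B ^ expr_size e"
  using assms(4)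
proof (induction e)
  case (Bin f x y)
  let ?X = "B ^ expr_size x" and ?Y = "B ^ expr_size y"
  have X: "2 \<le> ?X" "2 \<le> ?Y"
    using assms(3) expr_size_pos[of x] expr_size_pos[of y]
    by (metis le_trans power_one_right power_increasing one_le_numeral)+
  have *: "?X + ?Y \<le> ?X * ?Y"
  proof -
    obtain u v where "?X = 2 + u" "?Y = 2 + v" using X le_Suc_ex by blast
    then show ?thesis by (simp add: algebra_simps)
  qed
  have IH: "val \<rho> a x \<le> ?X" "val \<rho> a y \<le> ?Y" using Bin by simp_all
  have XY: "?X \<le> ?X * ?Y" using X by simp
  have "nat_op f (val \<rho> a x) (val \<rho> a y) \<le> ?X * ?Y"
  proof (cases f)
    case Add
    then show ?thesis using IH * by simp
  next
    case Mul
    then show ?thesis using IH by (simp add: mult_mono)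
  next
    case Sub
    then show ?thesis using IH XY by (metis diff_le_self le_trans nat_op.simps(2))
  next
    case Div
    then show ?thesis using IH XY div_le_dividend le_trans by (metis nat_op.simps(4))
  next
    case Mod
    then show ?thesis using IH XY mod_less_eq_dividend le_trans by (metis nat_op.simps(5))
  next
    case And
    then show ?thesis using IH XY and_nat_le le_trans by (metis nat_op.simps(6))
  qed simp_all
  then show ?case by (simp add: power_add)
next
  case (Arr x)
  have "B ^ 1 \<le> B ^ (expr_size x + 1)" using assms(3) by (intro power_increasing) auto
  then show ?case using le_trans[OF assms(2)[of "val \<rho> a x"]] by simp
next
  case (Cond l x y p q)
  have "B ^ expr_size p \<le> B ^ expr_size (Cond l x y p q)" "B ^ expr_size q \<le> B ^ expr_size (Cond l x y p q)"
    using assms(3) by (intro power_increasing; simp)+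
  moreover have "val \<rho> a p \<le> B ^ expr_size p" "val \<rho> a q \<le> B ^ expr_size q" using Cond by simp_all
  ultimately show ?case unfolding val.simps by (simp only: split: if_split) (meson le_trans)
qed (use assms in auto)

lemma power_less_mono: "B ^ b < 2 ^ w \<Longrightarrow> a \<le> b \<Longrightarrow> 2 \<le> B \<Longrightarrow> B ^ a < (2::nat) ^ w"
  using power_increasing[of a b B] by linarith

definition same_below :: "nat \<Rightarrow> state \<Rightarrow> state \<Rightarrow> bool" where
  "same_below d s s' \<longleftrightarrow> mem s' = mem s \<and> (\<forall>r. (\<forall>i\<ge>d. r \<noteq> treg i) \<longrightarrow> reg s' r = reg s r)"

lemma same_below_trans: "same_below d s s' \<Longrightarrow> same_below d' s' s'' \<Longrightarrow> d \<le> d' \<Longrightarrow> same_below d s s''"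
  by (auto simp: same_below_def)

lemma same_below_upd: "same_below d s (s\<lparr>reg := (reg s)(treg d := x)\<rparr>)"
  by (auto simp: same_below_def)

lemma same_below_view: "same_below d s s' \<Longrightarrow> vars s' = vars s \<and> sregs s' = sregs s \<and> mem s' = mem s"
  unfolding same_below_def vars_def sregs_def fun_eq_iff by (auto simp del: view_simps)

lemma same_below_treg: "same_below d s s' \<Longrightarrow> i < d \<Longrightarrow> reg s' (treg i) = reg s (treg i)"
  unfolding same_below_def by auto

lemma op_code_correct:
  assumes "x < 2 ^ w" "y < 2 ^ w" "nat_op f x y < 2 ^ w" "reg s (treg d) = x" "reg s (treg (d + 1)) = y"
  shows "runs w (op_code f d) s 2 (\<lambda>s'. same_below d s s' \<and> reg s' (treg d) = nat_op f x y)"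
proof -
  have c: "runs w (Const (treg d) 0) s 1 (\<lambda>s'. same_below d s s' \<and> reg s' (treg d) = 0)"
    by (rule runs_Const) (simp add: same_below_upd)
  have o: "runs w (Op f (treg d) (treg d) (treg (d + 1))) s 1
      (\<lambda>s'. same_below d s s' \<and> reg s' (treg d) = apply_op w f x y)"
    by (rule runs_Op) (use assms in \<open>simp add: same_below_upd\<close>)
  have direct: ?thesis if "op_code f d = Op f (treg d) (treg d) (treg (d + 1))" "apply_op w f x y = nat_op f x y"
    unfolding that(1) by (rule runs_weaken[OF o]) (simp_all add: that(2))
  have zero: ?thesis if "op_code f d = Const (treg d) 0" "nat_op f x y = 0"
    unfolding that by (rule runs_weaken[OF c]) simp_all
  show ?thesis
  proof (cases "f = Sub")
    case Sub: True
    have "runs w (op_code f d) s (1 + 1) (\<lambda>s'. same_below d s s' \<and> reg s' (treg d) = nat_op f x y)"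
      unfolding Sub op_code.simps
    proof (rule runs_If)
      assume "holds (Less (treg (d + 1)) (treg d)) s"
      then have "y < x" using assms by simp
      then have "x + 2 ^ w - y = (x - y) + 2 ^ w" by linarith
      moreover have "(x - y + 2 ^ w) mod 2 ^ w = x - y"
        using assms(1) by (simp add: less_imp_diff_less)
      ultimately have "apply_op w Sub x y = nat_op Sub x y" by (simp only: apply_op.simps nat_op.simps)
      then show "runs w (Op Sub (treg d) (treg d) (treg (d + 1))) s 1
          (\<lambda>s'. same_below d s s' \<and> reg s' (treg d) = nat_op Sub x y)"
        using o Sub by simp
    next
      assume "\<not> holds (Less (treg (d + 1)) (treg d)) s"
      then show "runs w (Const (treg d) 0) s 1 (\<lambda>s'. same_below d s s' \<and> reg s' (treg d) = nat_op Sub x y)"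
        using c assms by simp
    qed
    then show ?thesis by (simp only: one_add_one)
  next
    case False
    then have "op_code f d = Op f (treg d) (treg d) (treg (d + 1)) \<and> apply_op w f x y = nat_op f x y
        \<or> op_code f d = Const (treg d) 0 \<and> nat_op f x y = 0"
      using assms(1-3) by (cases f) simp_all
    then show ?thesis using direct zero by blast
  qed
qed

lemma comp_expr_correct:
  assumes "\<And>i. vars s i \<le> B" "\<And>i. mem s 0 i \<le> B" "2 \<le> B" "max_lit e \<le> B" "B ^ expr_size e < 2 ^ w"
  shows "runs w (comp_expr d e) s (cost e)
    (\<lambda>s'. same_below d s s' \<and> reg s' (treg d) = val (vars s) (mem s 0) e)"
  using assms
proof (induction e arbitrary: d s)
  case (Var i)
  show ?case unfolding comp_expr.simps cost.simps
    by (rule runs_Op) (simp add: same_below_upd)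
next
  case (Lit c)
  then have "c < 2 ^ w" by simp
  then show ?case unfolding comp_expr.simps cost.simps
    by (intro runs_Const) (simp add: same_below_upd)
next
  case (Bin f x y)
  let ?v = "val (vars s) (mem s 0)"
  have B: "B ^ expr_size x < 2 ^ w" "B ^ expr_size y < 2 ^ w"
    by (rule power_less_mono[OF Bin.prems(5)]; use Bin.prems(3) in simp)+
  have lt: "?v e < 2 ^ w" if "max_lit e \<le> B" "B ^ expr_size e < 2 ^ w" for e
    using val_le[of "vars s" B "mem s 0" e] Bin.prems that by auto
  show ?case unfolding comp_expr.simps cost.simps
  proof (rule runs_Seq)
    show "runs w (comp_expr d x) s (cost x) (\<lambda>s'. same_below d s s' \<and> reg s' (treg d) = ?v x)"
      using Bin.IH(1)[of s d] Bin.prems B by simp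
    fix s1 assume 1: "same_below d s s1 \<and> reg s1 (treg d) = ?v x"
    then have eq: "val (vars s1) (mem s1 0) = ?v" "vars s1 = vars s" "mem s1 = mem s"
      using same_below_view[of d s s1] by simp_all
    show "runs w (Seq (comp_expr (d + 1) y) (op_code f d)) s1 (cost y + 2)
      (\<lambda>s'. same_below d s s' \<and> reg s' (treg d) = ?v (Bin f x y))"
    proof (rule runs_Seq)
      show "runs w (comp_expr (d + 1) y) s1 (cost y) (\<lambda>s'. same_below (d + 1) s1 s' \<and> reg s' (treg (d + 1)) = ?v y)"
        using Bin.IH(2)[of s1 "d + 1"] Bin.prems B eq by simp
      fix s2 assume 2: "same_below (d + 1) s1 s2 \<and> reg s2 (treg (d + 1)) = ?v y"
      have s2: "same_below d s s2" using 1 2 same_below_trans by (metis le_add1)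
      have "reg s2 (treg d) = ?v x" using 1 2 same_below_treg[of "d + 1" s1 s2 d] by simp
      then show "runs w (op_code f d) s2 2 (\<lambda>s'. same_below d s s' \<and> reg s' (treg d) = ?v (Bin f x y))"
      proof (intro runs_weaken[OF op_code_correct[of "?v x" w "?v y" f]])
        show "?v x < 2 ^ w" "?v y < 2 ^ w" "nat_op f (?v x) (?v y) < 2 ^ w"
          using lt[of x] lt[of y] lt[of "Bin f x y"] Bin.prems(4,5) B by simp_all
        show "reg s2 (treg (d + 1)) = ?v y" using 2 ..
      qed (use same_below_trans[OF s2 _ order.refl] in auto)
    qed
  qed
next
  case (Arr x)
  let ?v = "val (vars s) (mem s 0)"
  have B: "B ^ expr_size x < 2 ^ w"
    by (rule power_less_mono[OF Arr.prems(5)]) (use Arr.prems(3) in simp_all)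
  show ?case unfolding comp_expr.simps cost.simps
  proof (rule runs_Seq)
    show "runs w (comp_expr d x) s (cost x) (\<lambda>s'. same_below d s s' \<and> reg s' (treg d) = ?v x)"
      using Arr.IH[of s d] Arr.prems B by simp
    fix s1 assume "same_below d s s1 \<and> reg s1 (treg d) = ?v x"
    then show "runs w (Load (treg d) 0 (treg d)) s1 1 (\<lambda>s'. same_below d s s' \<and> reg s' (treg d) = ?v (Arr x))"
      using same_below_view[of d s s1]
      by (intro runs_Load) (simp add: same_below_trans[OF _ same_below_upd order.refl])
  qed
next
  case (Cond l x y p q)
  let ?v = "val (vars s) (mem s 0)"
  let ?e = "Cond l x y p q"
  let ?b = "if l then Less (treg d) (treg (d + 1)) else Eq (treg d) (treg (d + 1))"
  have B: "B ^ expr_size x < 2 ^ w" "B ^ expr_size y < 2 ^ w" "B ^ expr_size p < 2 ^ w" "B ^ expr_size q < 2 ^ w"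
    by (rule power_less_mono[OF Cond.prems(5)]; use Cond.prems(3) in simp)+
  show ?case unfolding comp_expr.simps cost.simps
  proof (rule runs_Seq)
    show "runs w (comp_expr d x) s (cost x) (\<lambda>s'. same_below d s s' \<and> reg s' (treg d) = ?v x)"
      using Cond.IH(1)[of s d] Cond.prems B by simp
    fix s1 assume 1: "same_below d s s1 \<and> reg s1 (treg d) = ?v x"
    then have eq: "val (vars s1) (mem s1 0) = ?v" "vars s1 = vars s" "mem s1 = mem s"
      using same_below_view[of d s s1] by simp_all
    show "runs w (Seq (comp_expr (d + 1) y) (If ?b (comp_expr d p) (comp_expr d q))) s1
      (cost y + (1 + max (cost p) (cost q))) (\<lambda>s'. same_below d s s' \<and> reg s' (treg d) = ?v ?e)"
    proof (rule runs_Seq)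
      show "runs w (comp_expr (d + 1) y) s1 (cost y) (\<lambda>s'. same_below (d + 1) s1 s' \<and> reg s' (treg (d + 1)) = ?v y)"
        using Cond.IH(2)[of s1 "d + 1"] Cond.prems B eq by simp
      fix s2 assume 2: "same_below (d + 1) s1 s2 \<and> reg s2 (treg (d + 1)) = ?v y"
      have s2: "same_below d s s2" using 1 2 same_below_trans by (metis le_add1)
      have x2: "reg s2 (treg d) = ?v x" using 1 2 same_below_treg[of "d + 1" s1 s2 d] by simp
      have eq2: "val (vars s2) (mem s2 0) = ?v" "vars s2 = vars s" "mem s2 = mem s"
        using same_below_view[OF s2] by simp_all
      have p: "runs w (comp_expr d p) s2 (cost p) (\<lambda>s'. same_below d s2 s' \<and> reg s' (treg d) = ?v p)"
        using Cond.IH(3)[of s2 d] Cond.prems B eq2 by simp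
      have q: "runs w (comp_expr d q) s2 (cost q) (\<lambda>s'. same_below d s2 s' \<and> reg s' (treg d) = ?v q)"
        using Cond.IH(4)[of s2 d] Cond.prems B eq2 by simp
      show "runs w (If ?b (comp_expr d p) (comp_expr d q)) s2 (1 + max (cost p) (cost q))
          (\<lambda>s'. same_below d s s' \<and> reg s' (treg d) = ?v ?e)"
      proof (rule runs_If)
        show "runs w (comp_expr d p) s2 (max (cost p) (cost q)) (\<lambda>s'. same_below d s s' \<and> reg s' (treg d) = ?v ?e)"
          if "holds ?b s2"
          by (rule runs_weaken[OF p]) (use that x2 2[THEN conjunct2] same_below_trans[OF s2 _ order.refl] in auto)
        show "runs w (comp_expr d q) s2 (max (cost p) (cost q)) (\<lambda>s'. same_below d s s' \<and> reg s' (treg d) = ?v ?e)"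
          if "\<not> holds ?b s2"
          by (rule runs_weaken[OF q]) (use that x2 2[THEN conjunct2] same_below_trans[OF s2 _ order.refl] in auto)
      qed
    qed
  qed
qed

definition Assign :: "nat \<Rightarrow> expr \<Rightarrow> program" where
  "Assign x e = Seq (comp_expr 0 e) (Op And (vreg x) (treg 0) (treg 0))"

lemma runs_Assign:
  assumes "\<And>i. vars s i \<le> B" "\<And>i. mem s 0 i \<le> B" "2 \<le> B" "max_lit e \<le> B" "B ^ expr_size e < 2 ^ w"
    and Q: "\<And>s'. vars s' = (vars s)(x := val (vars s) (mem s 0) e) \<Longrightarrow> sregs s' = sregs s \<Longrightarrow> mem s' = mem s \<Longrightarrow> Q s'"
  shows "runs w (Assign x e) s (cost e + 1) Q"
  unfolding Assign_def
proof (rule runs_Seq[OF comp_expr_correct[OF assms(1-5)]])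
  fix s' assume s': "same_below 0 s s' \<and> reg s' (treg 0) = val (vars s) (mem s 0) e"
  have v: "vars s' = vars s" "sregs s' = sregs s" "mem s' = mem s"
    using same_below_view[of 0 s s'] s' by simp_all
  have a: "apply_op w And (reg s' (treg 0)) (reg s' (treg 0)) = val (vars s) (mem s 0) e"
    using s' by simp
  show "runs w (Op And (vreg x) (treg 0) (treg 0)) s' 1 Q"
    by (rule runs_Op, unfold a, rule Q) (simp_all add: v)
qed

section \<open>Simulating a program with smaller words\<close>

text \<open>
  Simulation of a program with word size \<open>w1\<close> on a machine with larger words. The variable \<open>M\<close> holds
  \<open>2\<^bsup>w1\<^esup>\<close>. Array \<open>a\<close> becomes array \<open>data a\<close>, and a cell of it is valid only if array \<open>stamp a\<close> holds the
  current time stamp \<open>now\<close> there; increasing \<open>now\<close> thus resets the whole memory to zero.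
\<close>

definition data :: "nat \<Rightarrow> nat" where "data a = 2 * a + 1"
definition stamp :: "nat \<Rightarrow> nat" where "stamp a = 2 * a + 2"

lemma array_simps [simp]:
  "data a = data b \<longleftrightarrow> a = b" "stamp a = stamp b \<longleftrightarrow> a = b" "data a \<noteq> stamp b" "stamp b \<noteq> data a"
  "data a \<noteq> 0" "0 \<noteq> data a" "stamp a \<noteq> 0" "0 \<noteq> stamp a"
  by (auto simp: data_def stamp_def) presburger+

fun sim_test :: "test \<Rightarrow> test" where
  "sim_test (Eq p q) = Eq (sreg p) (sreg q)"
| "sim_test (Less p q) = Less (sreg p) (sreg q)"

text \<open>Results are computed with the long words and then reduced modulo \<open>2 ^ w1\<close>.
  An instruction takes at most three steps, the maximum being a load: fetch the stamp, compare it,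
  and fetch the datum or zero.\<close>

primrec sim :: "nat \<Rightarrow> nat \<Rightarrow> program \<Rightarrow> program" where
  "sim M now Skip = Skip"
| "sim M now (Const r c) = Seq (Const (sreg r) c) (Op Mod (sreg r) (sreg r) (vreg M))"
| "sim M now (Op f r p q) = Seq (Op f (sreg r) (sreg p) (sreg q)) (Op Mod (sreg r) (sreg r) (vreg M))"
| "sim M now (Load r a p) = Seq (Load (treg 0) (stamp a) (sreg p))
     (If (Eq (treg 0) (vreg now)) (Load (sreg r) (data a) (sreg p)) (Const (sreg r) 0))"
| "sim M now (Store a p r) = Seq (Store (data a) (sreg p) (sreg r)) (Store (stamp a) (sreg p) (vreg now))"
| "sim M now (Seq P Q) = Seq (sim M now P) (sim M now Q)"
| "sim M now (If b P Q) = If (sim_test b) (sim M now P) (sim M now Q)"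
| "sim M now (While b P) = While (sim_test b) (sim M now P)"

fun test_regs :: "test \<Rightarrow> nat \<Rightarrow> bool" where
  "test_regs (Eq p q) n \<longleftrightarrow> p < n \<and> q < n"
| "test_regs (Less p q) n \<longleftrightarrow> p < n \<and> q < n"

primrec regs_below :: "program \<Rightarrow> nat \<Rightarrow> bool" where
  "regs_below Skip n \<longleftrightarrow> True"
| "regs_below (Const r c) n \<longleftrightarrow> r < n"
| "regs_below (Op f r p q) n \<longleftrightarrow> r < n \<and> p < n \<and> q < n"
| "regs_below (Load r a p) n \<longleftrightarrow> r < n \<and> p < n"
| "regs_below (Store a p r) n \<longleftrightarrow> p < n \<and> r < n"
| "regs_below (Seq P Q) n \<longleftrightarrow> regs_below P n \<and> regs_below Q n"
| "regs_below (If b P Q) n \<longleftrightarrow> test_regs b n \<and> regs_below P n \<and> regs_below Q n"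
| "regs_below (While b P) n \<longleftrightarrow> test_regs b n \<and> regs_below P n"

lemma test_regs_mono: "test_regs b m \<Longrightarrow> m \<le> n \<Longrightarrow> test_regs b n"
  by (cases b) auto

lemma regs_below_mono: "regs_below P m \<Longrightarrow> m \<le> n \<Longrightarrow> regs_below P n"
  by (induction P) (auto intro: test_regs_mono)

lemma ex_regs_below: "\<exists>n>0. regs_below P n"
proof -
  have test: "\<exists>n. test_regs b n" for b
  proof (cases b)
    case (Eq p q)
    then show ?thesis by (intro exI[of _ "Suc (p + q)"]) auto
  next
    case (Less p q)
    then show ?thesis by (intro exI[of _ "Suc (p + q)"]) auto
  qed
  have "\<exists>n. regs_below P n"
  proof (induction P)
    case (Const r c)
    show ?case by (intro exI[of _ "Suc r"]) simp
  next
    case (Op f r p q)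
    show ?case by (intro exI[of _ "Suc (r + p + q)"]) simp
  next
    case (Load r a p)
    show ?case by (intro exI[of _ "Suc (r + p)"]) simp
  next
    case (Store a p r)
    show ?case by (intro exI[of _ "Suc (r + p)"]) simp
  next
    case (Seq P Q)
    then obtain m n where "regs_below P m" "regs_below Q n" by blast
    then show ?case
      by (intro exI[of _ "max m n"]) (auto intro: regs_below_mono)
  next
    case (If b P Q)
    obtain l m n where "test_regs b l" "regs_below P m" "regs_below Q n" using If test[of b] by blast
    then show ?case
      by (intro exI[of _ "max l (max m n)"]) (auto intro: regs_below_mono test_regs_mono simp: le_max_iff_disj)
  next
    case (While b P)
    obtain l m where "test_regs b l" "regs_below P m" using While test[of b] by blast
    then show ?case
      by (intro exI[of _ "max l m"]) (auto intro: regs_below_mono test_regs_mono simp: le_max_iff_disj)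
  qed simp
  then obtain n where "regs_below P n" ..
  then have "regs_below P (Suc n)" by (rule regs_below_mono) simp
  then show ?thesis by blast
qed

lemma bitop_less:
  assumes "x < 2 ^ w" "y < (2::nat) ^ w"
  shows "x AND y < 2 ^ w" "x OR y < 2 ^ w" "x XOR y < 2 ^ w"
proof -
  have "take_bit w x = x" "take_bit w y = y" using assms by (simp_all add: take_bit_nat_eq_self_iff)
  then have "take_bit w (x AND y) = x AND y" "take_bit w (x OR y) = x OR y" "take_bit w (x XOR y) = x XOR y"
    by (simp_all add: take_bit_and take_bit_or take_bit_xor)
  then show "x AND y < 2 ^ w" "x OR y < 2 ^ w" "x XOR y < 2 ^ w"
    by (simp_all only: take_bit_nat_eq_self_iff)
qed

lemma apply_op_less:
  assumes "x < 2 ^ w" "y < 2 ^ w"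
  shows "apply_op w f x y < 2 ^ w"
  using assms bitop_less[OF assms]
  by (cases f) (auto intro: le_less_trans[OF div_le_dividend] le_less_trans[OF mod_less_eq_dividend])

text \<open>The operations that wrap around commute with the reduction because \<open>2 ^ w1\<close>
  divides \<open>2 ^ w2\<close>; the results of the others are already below
  \<open>2 ^ w1\<close>.\<close>

lemma apply_op_mod:
  assumes x: "x < 2 ^ w1" and y: "y < 2 ^ w1" and w: "w1 < w2"
  shows "apply_op w2 f x y mod 2 ^ w1 = apply_op w1 f x y"
proof -
  have dvd: "(2::nat) ^ w1 dvd 2 ^ w2" using w by (intro le_imp_power_dvd) simp
  have m: "(z mod 2 ^ w2) mod 2 ^ w1 = z mod 2 ^ w1" for z :: nat by (rule mod_mod_cancel[OF dvd])
  have less: "z < 2 ^ w1 \<Longrightarrow> z mod 2 ^ w1 = z" for z :: nat by simp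
  show ?thesis
  proof (cases f)
    case Sub
    obtain c :: nat where c: "2 ^ w2 = 2 ^ w1 * c" using dvd by (elim dvdE)
    have "c \<noteq> 0" using c by (metis mult_0_right power_not_zero zero_neq_numeral)
    then obtain d where d: "c = Suc d" using not0_implies_Suc by blast
    have "x + 2 ^ w2 - y = (x + 2 ^ w1 - y) + d * 2 ^ w1"
      unfolding c d using y by (simp add: algebra_simps)
    then show ?thesis using Sub m by simp
  next
    case Div
    then show ?thesis using less le_less_trans[OF div_le_dividend x] by simp
  next
    case Mod
    then show ?thesis using less le_less_trans[OF mod_less_eq_dividend x] by simp
  next
    case Shr
    then show ?thesis using less le_less_trans[OF div_le_dividend x] by simp
  qed (use m less bitop_less[OF x y] in simp_all)
qed

definition sim_rel :: "nat \<Rightarrow> nat \<Rightarrow> nat \<Rightarrow> (nat \<Rightarrow> nat) \<Rightarrow> (nat \<Rightarrow> nat) \<Rightarrow> state \<Rightarrow> state \<Rightarrow> bool" where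
  "sim_rel w1 n now \<rho> a0 s \<sigma> \<longleftrightarrow> vars \<sigma> = \<rho> \<and> mem \<sigma> 0 = a0
    \<and> (\<forall>r<n. sregs \<sigma> r = reg s r \<and> reg s r < 2 ^ w1)
    \<and> (\<forall>a i. mem \<sigma> (stamp a) i = \<rho> now \<longrightarrow> mem s a i = mem \<sigma> (data a) i)
    \<and> (\<forall>a i. mem \<sigma> (stamp a) i \<noteq> \<rho> now \<longrightarrow> mem s a i = 0)
    \<and> (\<forall>a i. mem s a i < 2 ^ w1)
    \<and> (\<forall>a i. mem \<sigma> (stamp a) i \<le> \<rho> now)"

lemma sim_test_holds:
  "sim_rel w1 n now \<rho> a0 s \<sigma> \<Longrightarrow> test_regs b n \<Longrightarrow> holds (sim_test b) \<sigma> \<longleftrightarrow> holds b s"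
  by (cases b) (auto simp: sim_rel_def)

lemma sim_rel_reg:
  "sim_rel w1 n now \<rho> a0 s \<sigma> \<Longrightarrow> x < 2 ^ w1 \<Longrightarrow> sregs \<sigma>' = (sregs \<sigma>)(r := x) \<Longrightarrow> vars \<sigma>' = vars \<sigma> \<Longrightarrow> mem \<sigma>' = mem \<sigma>
    \<Longrightarrow> sim_rel w1 n now \<rho> a0 (s\<lparr>reg := (reg s)(r := x)\<rparr>) \<sigma>'"
  unfolding sim_rel_def by (elim conjE, intro conjI allI impI) simp_all

lemma sim_correct:
  assumes "exec w1 P s t s'" "regs_below P n" "sim_rel w1 n now \<rho> a0 s \<sigma>" "\<rho> M = 2 ^ w1" "w1 < w2"
  shows "runs w2 (sim M now P) \<sigma> (3 * t) (sim_rel w1 n now \<rho> a0 s')"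
  using assms(1-3)
proof (induction arbitrary: \<sigma> rule: exec.induct)
  case (Skip s)
  then show ?case using runs_weaken[OF runs_Skip] by simp
next
  case (Const r c s)
  have vM: "vars \<sigma> M = 2 ^ w1" using Const.prems assms(4) by (simp add: sim_rel_def)
  have dvd: "(2::nat) ^ w1 dvd 2 ^ w2" using assms(5) by (intro le_imp_power_dvd) simp
  have "runs w2 (sim M now (Const r c)) \<sigma> (1 + 1) (sim_rel w1 n now \<rho> a0 (s\<lparr>reg := (reg s)(r := c mod 2 ^ w1)\<rparr>))"
    unfolding sim.simps
  proof (rule runs_Seq[where R = "\<lambda>\<sigma>'. sregs \<sigma>' = (sregs \<sigma>)(r := c mod 2 ^ w2) \<and> vars \<sigma>' = vars \<sigma> \<and> mem \<sigma>' = mem \<sigma>"])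
    show "runs w2 (Const (sreg r) c) \<sigma> 1 (\<lambda>\<sigma>'. sregs \<sigma>' = (sregs \<sigma>)(r := c mod 2 ^ w2) \<and> vars \<sigma>' = vars \<sigma> \<and> mem \<sigma>' = mem \<sigma>)"
      by (rule runs_Const) simp
    fix \<sigma>1 assume 1: "sregs \<sigma>1 = (sregs \<sigma>)(r := c mod 2 ^ w2) \<and> vars \<sigma>1 = vars \<sigma> \<and> mem \<sigma>1 = mem \<sigma>"
    show "runs w2 (Op Mod (sreg r) (sreg r) (vreg M)) \<sigma>1 1 (sim_rel w1 n now \<rho> a0 (s\<lparr>reg := (reg s)(r := c mod 2 ^ w1)\<rparr>))"
      by (rule runs_Op, rule sim_rel_reg[OF Const.prems(2)]) (use 1 vM in \<open>simp_all add: mod_mod_cancel[OF dvd]\<close>)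
  qed
  then show ?case by (rule runs_weaken) simp_all
next
  case (Op f r p q s)
  let ?x = "reg s p" and ?y = "reg s q"
  have vM: "vars \<sigma> M = 2 ^ w1" using Op.prems assms(4) by (simp add: sim_rel_def)
  have xy: "?x < 2 ^ w1" "?y < 2 ^ w1" "sregs \<sigma> p = ?x" "sregs \<sigma> q = ?y"
    using Op.prems by (auto simp: sim_rel_def)
  let ?R = "\<lambda>\<sigma>'. sregs \<sigma>' = (sregs \<sigma>)(r := apply_op w2 f ?x ?y) \<and> vars \<sigma>' = vars \<sigma> \<and> mem \<sigma>' = mem \<sigma>"
  have "runs w2 (sim M now (Op f r p q)) \<sigma> (1 + 1)
      (sim_rel w1 n now \<rho> a0 (s\<lparr>reg := (reg s)(r := apply_op w1 f ?x ?y)\<rparr>))"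
    unfolding sim.simps
  proof (rule runs_Seq[where R = ?R])
    show "runs w2 (Op f (sreg r) (sreg p) (sreg q)) \<sigma> 1 ?R"
      by (rule runs_Op) (use xy in simp)
    fix \<sigma>1 assume 1: "?R \<sigma>1"
    have "apply_op w2 Mod (reg \<sigma>1 (sreg r)) (reg \<sigma>1 (vreg M)) = apply_op w1 f ?x ?y"
      using 1 vM apply_op_mod[OF xy(1,2) assms(5)] by simp
    then show "runs w2 (Op Mod (sreg r) (sreg r) (vreg M)) \<sigma>1 1
        (sim_rel w1 n now \<rho> a0 (s\<lparr>reg := (reg s)(r := apply_op w1 f ?x ?y)\<rparr>))"
      by (intro runs_Op sim_rel_reg[OF Op.prems(2) apply_op_less[OF xy(1,2)]]) (use 1 in \<open>simp_all\<close>)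
  qed
  then show ?case by (rule runs_weaken) simp_all
next
  case (Load r a p s)
  let ?x = "mem s a (reg s p)"
  have p: "sregs \<sigma> p = reg s p" using Load.prems by (simp add: sim_rel_def)
  have x: "?x = (if mem \<sigma> (stamp a) (reg s p) = \<rho> now then mem \<sigma> (data a) (reg s p) else 0)" "?x < 2 ^ w1"
    using Load.prems unfolding sim_rel_def by (simp, blast)
  have \<rho>: "vars \<sigma> = \<rho>" using Load.prems by (simp add: sim_rel_def)
  let ?R = "\<lambda>\<sigma>'. sregs \<sigma>' = sregs \<sigma> \<and> vars \<sigma>' = vars \<sigma> \<and> mem \<sigma>' = mem \<sigma> \<and> reg \<sigma>' (treg 0) = mem \<sigma> (stamp a) (reg s p)"
  have "runs w2 (sim M now (Load r a p)) \<sigma> (1 + (1 + 1)) (sim_rel w1 n now \<rho> a0 (s\<lparr>reg := (reg s)(r := ?x)\<rparr>))"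
    unfolding sim.simps
  proof (rule runs_Seq[where R = ?R])
    show "runs w2 (Load (treg 0) (stamp a) (sreg p)) \<sigma> 1 ?R"
      by (rule runs_Load) (use p in simp)
    fix \<sigma>1 assume 1: "?R \<sigma>1"
    show "runs w2 (If (Eq (treg 0) (vreg now)) (Load (sreg r) (data a) (sreg p)) (Const (sreg r) 0)) \<sigma>1 (1 + 1)
        (sim_rel w1 n now \<rho> a0 (s\<lparr>reg := (reg s)(r := ?x)\<rparr>))"
      by (intro runs_If runs_Load runs_Const; rule sim_rel_reg[OF Load.prems(2) x(2)]) (use 1 x(1) \<rho> p in simp_all)
  qed
  then show ?case by (rule runs_weaken) simp_all
next
  case (Store a p r s)
  have pr: "sregs \<sigma> p = reg s p" "sregs \<sigma> r = reg s r" "vars \<sigma> = \<rho>" using Store.prems by (simp_all add: sim_rel_def)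
  let ?\<mu> = "(mem \<sigma>)(data a := (mem \<sigma> (data a))(reg s p := reg s r))"
  let ?R = "\<lambda>\<sigma>'. sregs \<sigma>' = sregs \<sigma> \<and> vars \<sigma>' = vars \<sigma> \<and> mem \<sigma>' = ?\<mu>"
  have "runs w2 (sim M now (Store a p r)) \<sigma> (1 + 1)
      (sim_rel w1 n now \<rho> a0 (s\<lparr>mem := (mem s)(a := (mem s a)(reg s p := reg s r))\<rparr>))"
    unfolding sim.simps
  proof (rule runs_Seq[where R = ?R])
    show "runs w2 (Store (data a) (sreg p) (sreg r)) \<sigma> 1 ?R"
      by (rule runs_Store) (use pr in simp)
    fix \<sigma>1 assume 1: "?R \<sigma>1"
    show "runs w2 (Store (stamp a) (sreg p) (vreg now)) \<sigma>1 1
      (sim_rel w1 n now \<rho> a0 (s\<lparr>mem := (mem s)(a := (mem s a)(reg s p := reg s r))\<rparr>))"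
    proof (rule runs_Store)
      show "sim_rel w1 n now \<rho> a0 (s\<lparr>mem := (mem s)(a := (mem s a)(reg s p := reg s r))\<rparr>)
         (\<sigma>1\<lparr>mem := (mem \<sigma>1)(stamp a := (mem \<sigma>1 (stamp a))(reg \<sigma>1 (sreg p) := reg \<sigma>1 (vreg now)))\<rparr>)"
        using Store.prems 1 pr unfolding sim_rel_def
        by (elim conjE, intro conjI allI impI) (simp_all split: if_splits, auto)
    qed
  qed
  then show ?case by (rule runs_weaken) simp_all
next
  case (Seq P s t s' Q u s'')
  have P: "runs w2 (sim M now P) \<sigma> (3 * t) (sim_rel w1 n now \<rho> a0 s')" using Seq.IH(1) Seq.prems by simp
  show ?case unfolding sim.simps distrib_left
    by (rule runs_Seq[OF P]) (use Seq.IH(2) Seq.prems in simp)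
next
  case (IfTrue b s P t s' Q)
  have "holds (sim_test b) \<sigma>" using IfTrue sim_test_holds by simp
  then have "runs w2 (sim M now (program.If b P Q)) \<sigma> (1 + 3 * t) (sim_rel w1 n now \<rho> a0 s')"
    unfolding sim.simps by (intro runs_If) (use IfTrue in simp_all)
  then show ?case by (rule runs_weaken) simp_all
next
  case (IfFalse b s Q t s' P)
  have "\<not> holds (sim_test b) \<sigma>" using IfFalse sim_test_holds by simp
  then have "runs w2 (sim M now (program.If b P Q)) \<sigma> (1 + 3 * t) (sim_rel w1 n now \<rho> a0 s')"
    unfolding sim.simps by (intro runs_If) (use IfFalse in simp_all)
  then show ?case by (rule runs_weaken) simp_all
next
  case (WhileFalse b s P)
  have "\<not> holds (sim_test b) \<sigma>" using WhileFalse sim_test_holds by simp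
  then show ?case using exec.WhileFalse[of "sim_test b" \<sigma> w2 "sim M now P"] WhileFalse.prems
    by (auto simp: runs_def intro!: exI[of _ 1])
next
  case (WhileTrue b s P t s' u s'')
  have b: "holds (sim_test b) \<sigma>" using WhileTrue sim_test_holds by simp
  from WhileTrue.IH(1)[of \<sigma>] WhileTrue.prems obtain t1 \<sigma>1 where
    1: "exec w2 (sim M now P) \<sigma> t1 \<sigma>1" "t1 \<le> 3 * t" "sim_rel w1 n now \<rho> a0 s' \<sigma>1"
    by (auto simp: runs_def)
  from WhileTrue.IH(2)[of \<sigma>1] WhileTrue.prems 1(3) obtain t2 \<sigma>2 where
    2: "exec w2 (While (sim_test b) (sim M now P)) \<sigma>1 t2 \<sigma>2" "t2 \<le> 3 * u" "sim_rel w1 n now \<rho> a0 s'' \<sigma>2"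
    by (auto simp: runs_def)
  have "exec w2 (While (sim_test b) (sim M now P)) \<sigma> (1 + t1 + t2) \<sigma>2" using exec.WhileTrue b 1 2 by blast
  then show ?case using 1(2) 2(2,3) unfolding runs_def sim.simps
    by (intro exI[of _ "1 + t1 + t2"] exI[of _ \<sigma>2]) simp
qed

primrec zero_regs :: "nat \<Rightarrow> program" where
  "zero_regs 0 = Skip"
| "zero_regs (Suc n) = Seq (zero_regs n) (Const (sreg n) 0)"

lemma runs_zero_regs:
  "runs w (zero_regs n) s (n + 1) (\<lambda>s'. vars s' = vars s \<and> mem s' = mem s \<and> (\<forall>r<n. sregs s' r = 0))"
proof (induction n)
  case 0
  show ?case unfolding zero_regs.simps by (rule runs_weaken[OF runs_Skip[where Q = "\<lambda>s'. s' = s"]]) simp_all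
next
  case (Suc n)
  have "runs w (zero_regs (Suc n)) s (n + 1 + 1) (\<lambda>s'. vars s' = vars s \<and> mem s' = mem s \<and> (\<forall>r<Suc n. sregs s' r = 0))"
    unfolding zero_regs.simps by (rule runs_Seq[OF Suc]) (rule runs_Const, auto simp: less_Suc_eq)
  then show ?case by simp
qed

section \<open>Factored vectors and their encoding\<close>

lemma nth_concat_uniform:
  assumes "\<And>xs. xs \<in> set xss \<Longrightarrow> length xs = l" "u < length xss" "r < l"
  shows "concat xss ! (u * l + r) = xss ! u ! r"
  using assms
proof (induction xss arbitrary: u)
  case (Cons xs xss)
  show ?case
  proof (cases u)
    case (Suc v)
    have "length xs = l" using Cons.prems by simp
    then have "concat (xs # xss) ! (u * l + r) = concat xss ! (v * l + r)"
      using Suc by (simp add: nth_append)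
    then show ?thesis using Cons Suc by simp
  qed (use Cons.prems in \<open>simp add: nth_append\<close>)
qed simp

lemma length_concat_uniform:
  "(\<And>xs. xs \<in> set xss \<Longrightarrow> length xs = l) \<Longrightarrow> length (concat xss) = length xss * l"
  by (induction xss) auto

text \<open>Tuples of bounded numbers are coded in base \<open>s\<close>. This is used for the bits
  of a vector with \<open>s = 2\<close>, for a tuple of vectors in one coordinate with
  \<open>s = 2 ^ b\<close>, and for a tuple of blocks with the number of pieces as base.\<close>

lemma ex_digits:
  assumes "\<And>j. j < k \<Longrightarrow> d j < s"
  shows "\<exists>q<s ^ k. \<forall>j<k. q div s ^ j mod s = (d j :: nat)"
  using assms
proof (induction k)
  case (Suc k)
  then obtain q where q: "q < s ^ k" "\<And>j. j < k \<Longrightarrow> q div s ^ j mod s = d j" by (metis less_SucI)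
  have dk: "d k < s" using Suc.prems by simp
  have s: "0 < s" using dk by simp
  let ?q = "q + d k * s ^ k"
  have "?q < (d k + 1) * s ^ k" using q by simp
  also have "\<dots> \<le> s * s ^ k" using dk by (intro mult_right_mono) auto
  finally have lt: "?q < s ^ Suc k" by simp
  have "?q div s ^ j mod s = d j" if j: "j < Suc k" for j
  proof (cases "j = k")
    case True
    then show ?thesis using q(1) dk s by simp
  next
    case False
    then have "j < k" using j by simp
    then obtain c where c: "s ^ k = s ^ j * (s * c)"
      by (metis Suc_diff_Suc add_diff_inverse_nat less_imp_not_less power_Suc power_add)
    have "?q = q + s ^ j * (s * (c * d k))" unfolding c by (simp add: ac_simps)
    then have "?q div s ^ j = (q + s ^ j * (s * (c * d k))) div s ^ j" by (simp only:)
    also have "\<dots> = q div s ^ j + s * (c * d k)" using s by (subst div_mult_self2) auto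
    finally have "?q div s ^ j = q div s ^ j + s * (c * d k)" .
    then show ?thesis using q(2)[OF \<open>j < k\<close>] by simp
  qed
  then show ?case using lt by blast
qed simp

section \<open>Tuples of bit vectors as numbers\<close>

definition bits :: "nat \<Rightarrow> nat \<Rightarrow> nat list" where
  "bits b p = map (\<lambda>a. p div 2 ^ a mod 2) [0..<b]"

lemma bits_surj:
  assumes "w \<in> cube b"
  shows "\<exists>p<2 ^ b. bits b p = w"
proof -
  have l: "length w = b" and "set w \<subseteq> {0, 1}" using assms by (simp_all add: cube_def)
  then have "w ! a \<in> {0, 1}" if "a < b" for a using that nth_mem[of a w] by blast
  then have d: "w ! a < 2" if "a < b" for a using that by fastforce
  obtain p where "p < 2 ^ b" "\<forall>a<b. p div 2 ^ a mod 2 = w ! a"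
    using ex_digits[of b "\<lambda>a. w ! a" 2] d by blast
  then show ?thesis using l by (intro exI[of _ p]) (auto simp: bits_def list_eq_iff_nth_eq)
qed

primrec digit_and :: "nat \<Rightarrow> nat \<Rightarrow> nat \<Rightarrow> nat" where
  "digit_and X t 0 = t mod X"
| "digit_and X t (Suc j) = digit_and X t j AND (t div X ^ Suc j mod X)"

lemma odd_digit_and:
  "odd (digit_and X t j div 2 ^ a) \<longleftrightarrow> (\<forall>i\<le>j. odd (t div X ^ i mod X div 2 ^ a))"
proof (induction j)
  case (Suc j)
  have "odd (digit_and X t (Suc j) div 2 ^ a) \<longleftrightarrow>
      odd (digit_and X t j div 2 ^ a) \<and> odd (t div X ^ Suc j mod X div 2 ^ a)"
    unfolding digit_and.simps bit_iff_odd[symmetric] bit_and_iff ..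
  then show ?case using Suc by (auto simp: le_Suc_eq)
qed simp

text \<open>Bit \<open>a\<close> of the conjunction of the \<open>k\<close> digits is the product of
  the \<open>a\<close>-th entries of the \<open>k\<close> vectors, so the conjunction vanishes iff
  every summand does. Bits from \<open>b\<close> on vanish anyway, as digits are below
  \<open>2 ^ b\<close>. The argument \<open>k - 1\<close> is the index of the last digit.\<close>

lemma digit_and_eq_0_iff:
  assumes "1 \<le> k"
  shows "digit_and (2 ^ b) t (k - 1) = 0 \<longleftrightarrow> (\<Sum>a<b. \<Prod>j<k. bits b (t div (2 ^ b) ^ j mod 2 ^ b) ! a) = 0"
proof -
  have "digit_and (2 ^ b) t (k - 1) = 0 \<longleftrightarrow> (\<forall>a. \<not> odd (digit_and (2 ^ b) t (k - 1) div 2 ^ a))"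
    unfolding bit_iff_odd[symmetric] by (auto simp: bit_eq_iff)
  also have "\<dots> \<longleftrightarrow> (\<forall>a<b. \<exists>j<k. even (t div (2 ^ b) ^ j mod 2 ^ b div 2 ^ a))"
  proof -
    have "even (t div (2 ^ b) ^ j mod 2 ^ b div 2 ^ a)" if "\<not> a < b" for a j
    proof -
      have "t div (2 ^ b) ^ j mod 2 ^ b < 2 ^ a"
        using that by (meson le_less_trans less_le_trans linorder_not_le mod_less_divisor one_le_numeral
            pos2 power_increasing zero_less_power)
      then show ?thesis by simp
    qed
    moreover have "i \<le> k - 1 \<longleftrightarrow> i < k" for i using assms by auto
    moreover have "0 < k" using assms by simp
    ultimately show ?thesis unfolding odd_digit_and by blast
  qed
  also have "\<dots> \<longleftrightarrow> (\<forall>a<b. \<exists>j<k. bits b (t div (2 ^ b) ^ j mod 2 ^ b) ! a = 0)"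
    by (simp add: bits_def even_iff_mod_2_eq_zero)
  also have "\<dots> \<longleftrightarrow> (\<Sum>a<b. \<Prod>j<k. bits b (t div (2 ^ b) ^ j mod 2 ^ b) ! a) = 0"
    by auto
  finally show ?thesis .
qed

text \<open>Vectors are replaced by their indices \<open>r j\<close> in the lists and, in each
  coordinate, the tuple \<open>w\<close> by a single number \<open>t\<close>: each
  \<open>w j\<close> belongs to the cube and is therefore of the form
  \<open>bits b p\<close>.\<close>

lemma FOV_yes_iff:
  assumes k: "1 \<le> k" and Vs: "length Vs = k" "\<forall>V\<in>set Vs. length V = n \<and> set V \<subseteq> factored_vectors g b"
  shows "FOV_yes k g b (\<lambda>j. set (Vs ! j)) \<longleftrightarrow>
    (\<exists>r. (\<forall>j<k. r j < n) \<and> (\<forall>i<g. \<exists>t<(2 ^ b) ^ k. digit_and (2 ^ b) t (k - 1) = 0 \<and>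
      (\<forall>j<k. bits b (t div (2 ^ b) ^ j mod 2 ^ b) \<in> Vs ! j ! r j ! i)))"
    (is "?L \<longleftrightarrow> ?R")
proof
  assume ?L
  then obtain v where v: "\<And>j. j < k \<Longrightarrow> v j \<in> set (Vs ! j)"
    and w: "\<And>i. i < g \<Longrightarrow> \<exists>w. (\<forall>j<k. w j \<in> v j ! i) \<and> (\<Sum>a<b. \<Prod>j<k. w j ! a) = 0"
    unfolding FOV_yes_def by blast
  have "\<exists>r<n. Vs ! j ! r = v j" if "j < k" for j
    using v[OF that] Vs that by (metis in_set_conv_nth)
  then obtain r where r: "\<And>j. j < k \<Longrightarrow> r j < n \<and> Vs ! j ! r j = v j" by metis
  have "\<exists>t<(2 ^ b) ^ k. digit_and (2 ^ b) t (k - 1) = 0 \<and>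
      (\<forall>j<k. bits b (t div (2 ^ b) ^ j mod 2 ^ b) \<in> Vs ! j ! r j ! i)" if i: "i < g" for i
  proof -
    obtain w where w1: "\<And>j. j < k \<Longrightarrow> w j \<in> v j ! i" "(\<Sum>a<b. \<Prod>j<k. w j ! a) = 0"
      using w[OF i] by blast
    have "\<exists>p. p < 2 ^ b \<and> bits b p = w j" if "j < k" for j
    proof -
      have "v j \<in> factored_vectors g b" using v[OF that] Vs that by (meson nth_mem subsetD)
      then have "v j ! i \<subseteq> cube b" using i by (simp add: factored_vectors_def)
      then have "w j \<in> cube b" using w1(1)[OF that] by blast
      from bits_surj[OF this] show ?thesis by blast
    qed
    then obtain p where p: "\<And>j. j < k \<Longrightarrow> p j < 2 ^ b \<and> bits b (p j) = w j"
      by metis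
    have "\<exists>t<(2 ^ b) ^ k. \<forall>j<k. t div (2 ^ b) ^ j mod 2 ^ b = p j"
      by (rule ex_digits) (use p in blast)
    then obtain t where t: "t < (2 ^ b) ^ k" "\<forall>j<k. t div (2 ^ b) ^ j mod 2 ^ b = p j"
      by (elim exE conjE) (rule that)
    have "digit_and (2 ^ b) t (k - 1) = 0"
      unfolding digit_and_eq_0_iff[OF k] using w1(2) t(2) p by simp
    moreover have "bits b (t div (2 ^ b) ^ j mod 2 ^ b) \<in> Vs ! j ! r j ! i" if "j < k" for j
      using t(2) p[OF that] w1(1)[OF that] r[OF that] that by metis
    ultimately show ?thesis using t(1) by blast
  qed
  then show ?R using r by blast
next
  assume ?R
  then obtain r where r: "\<And>j. j < k \<Longrightarrow> r j < n" and t: "\<And>i. i < g \<Longrightarrow> \<exists>t<(2 ^ b) ^ k. digit_and (2 ^ b) t (k - 1) = 0 \<and>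
      (\<forall>j<k. bits b (t div (2 ^ b) ^ j mod 2 ^ b) \<in> Vs ! j ! r j ! i)" by blast
  show ?L
    unfolding FOV_yes_def
  proof (intro exI[of _ "\<lambda>j. Vs ! j ! r j"] conjI allI impI)
    show "Vs ! j ! r j \<in> set (Vs ! j)" if "j < k" for j using r[OF that] Vs that by (metis nth_mem)
    fix i assume "i < g"
    from t[OF this] obtain t where 1: "digit_and (2 ^ b) t (k - 1) = 0"
      and 2: "\<forall>j<k. bits b (t div (2 ^ b) ^ j mod 2 ^ b) \<in> Vs ! j ! r j ! i" by blast
    show "\<exists>w. (\<forall>j<k. w j \<in> Vs ! j ! r j ! i) \<and> (\<Sum>a<b. \<Prod>j<k. w j ! a) = 0"
      using 2 1[unfolded digit_and_eq_0_iff[OF k]]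
      by (intro exI[of _ "\<lambda>j. bits b (t div (2 ^ b) ^ j mod 2 ^ b)"] conjI)
  qed
qed

lemma length_encode_set: "length (encode_set b S) = 2 ^ b"
  by (simp add: encode_set_def)

lemma encode_nth:
  assumes Vs: "length Vs = k" "\<forall>V\<in>set Vs. length V = n \<and> set V \<subseteq> factored_vectors g b"
    and lt: "j < k" "r < n" "i < g" "p < 2 ^ b"
  shows "((j * n + r) * g + i) * 2 ^ b + p < length (concat (map (encode_factored_vector b) (concat Vs)))"
    "concat (map (encode_factored_vector b) (concat Vs)) ! (((j * n + r) * g + i) * 2 ^ b + p)
      = of_bool (bits b p \<in> Vs ! j ! r ! i)"
proof -
  have fv: "length v = g" if "v \<in> set (concat Vs)" for v
    using that Vs by (auto simp: factored_vectors_def)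
  have lenV: "length (concat Vs) = k * n" using length_concat_uniform[of Vs n] Vs by auto
  have jr: "j * n + r < k * n"
  proof -
    have "j * n + r < (j + 1) * n" using lt by simp
    also have "\<dots> \<le> k * n" using lt by (intro mult_right_mono) auto
    finally show ?thesis .
  qed
  have v: "concat Vs ! (j * n + r) = Vs ! j ! r"
    by (rule nth_concat_uniform) (use Vs lt in auto)
  have leng: "length (Vs ! j ! r) = g" using fv v jr lenV nth_mem by metis
  have lenE: "length (encode_factored_vector b v) = g * 2 ^ b" if "v \<in> set (concat Vs)" for v
    unfolding encode_factored_vector_def fv[OF that, symmetric]
    by (subst length_concat_uniform[where l = "2 ^ b"]) (auto simp: length_encode_set)
  have ip: "i * 2 ^ b + p < g * 2 ^ b"
  proof -
    have "i * 2 ^ b + p < (i + 1) * 2 ^ b" using lt by simp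
    also have "\<dots> \<le> g * 2 ^ b" using lt by (intro mult_right_mono) auto
    finally show ?thesis .
  qed
  have idx: "((j * n + r) * g + i) * 2 ^ b + p = (j * n + r) * (g * 2 ^ b) + (i * 2 ^ b + p)"
    by (simp add: algebra_simps)
  have "length (concat (map (encode_factored_vector b) (concat Vs))) = (k * n) * (g * 2 ^ b)"
    using length_concat_uniform[of "map (encode_factored_vector b) (concat Vs)" "g * 2 ^ b"] lenE lenV by auto
  moreover have "(j * n + r) * (g * 2 ^ b) + (i * 2 ^ b + p) < (j * n + r + 1) * (g * 2 ^ b)" using ip by simp
  moreover have "(j * n + r + 1) * (g * 2 ^ b) \<le> (k * n) * (g * 2 ^ b)" using jr by (intro mult_right_mono) auto
  ultimately show "((j * n + r) * g + i) * 2 ^ b + p < length (concat (map (encode_factored_vector b) (concat Vs)))"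
    unfolding idx by linarith
  have "concat (map (encode_factored_vector b) (concat Vs)) ! (((j * n + r) * g + i) * 2 ^ b + p)
      = map (encode_factored_vector b) (concat Vs) ! (j * n + r) ! (i * 2 ^ b + p)"
    unfolding idx by (rule nth_concat_uniform) (use lenE jr lenV ip in auto)
  also have "\<dots> = encode_factored_vector b (Vs ! j ! r) ! (i * 2 ^ b + p)"
    using jr lenV v by simp
  also have "\<dots> = map (encode_set b) (Vs ! j ! r) ! i ! p"
    unfolding encode_factored_vector_def
    by (rule nth_concat_uniform) (use lt leng length_encode_set in auto)
  also have "\<dots> = of_bool (bits b p \<in> Vs ! j ! r ! i)"
    using lt leng by (simp add: encode_set_def bits_def)
  finally show "concat (map (encode_factored_vector b) (concat Vs)) ! (((j * n + r) * g + i) * 2 ^ b + p)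
      = of_bool (bits b p \<in> Vs ! j ! r ! i)" .
qed

text \<open>
  The parameters of the reduction, as functions of \<open>n\<close>, \<open>g\<close> and \<open>X = 2\<^sup>b\<close>: a string with the gadgets of
  \<open>m\<close> vectors has length at most \<open>block_size * m\<close>, and the lists are cut into \<open>pieces\<close> blocks of \<open>m\<close> vectors such
  that strings of length \<open>n\<close> suffice, unless \<open>n\<close> is too small for a single vector.
\<close>

definition low :: "nat \<Rightarrow> nat \<Rightarrow> nat \<Rightarrow> nat" where "low k g X = inner_high k g (X ^ k) - 1"
definition block_size :: "nat \<Rightarrow> nat \<Rightarrow> nat \<Rightarrow> nat" where
  "block_size k g X = 9 * slot_length k (low k g X) (gadget_length k g (X ^ k))"
definition lcs_size :: "nat \<Rightarrow> nat \<Rightarrow> nat \<Rightarrow> nat \<Rightarrow> nat" where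
  "lcs_size k n g X = (if n < block_size k g X then block_size k g X else n)"
definition per_block :: "nat \<Rightarrow> nat \<Rightarrow> nat \<Rightarrow> nat \<Rightarrow> nat" where
  "per_block k n g X = lcs_size k n g X div block_size k g X"
definition pieces :: "nat \<Rightarrow> nat \<Rightarrow> nat \<Rightarrow> nat \<Rightarrow> nat" where
  "pieces k n g X = (n + (per_block k n g X - 1)) div per_block k n g X"

text \<open>This is the bit at position \<open>p = i * X ^ k + t\<close> for vector \<open>r\<close>
  of the current block of list \<open>j\<close>. The digits of \<open>q\<close> in base
  \<open>pieces\<close> select the blocks, and \<open>3\<close> skips the cells of \<open>n\<close>,
  \<open>g\<close> and \<open>b\<close>. The index is capped at \<open>n - 1\<close>: an incomplete
  last block is filled up with copies of the last vector, which contribute no new tuple.\<close>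

definition table_bit :: "nat \<Rightarrow> nat \<Rightarrow> nat \<Rightarrow> nat \<Rightarrow> (nat \<Rightarrow> nat) \<Rightarrow> nat \<Rightarrow> nat \<Rightarrow> nat \<Rightarrow> nat \<Rightarrow> bool" where
  "table_bit k n g X a q j r p \<longleftrightarrow> digit_and X (p mod X ^ k) (k - 1) = 0 \<and>
     a (3 + ((j * n + min (q div pieces k n g X ^ j mod pieces k n g X * per_block k n g X + r) (n - 1)) * g
        + p div X ^ k) * X + p mod X ^ k div X ^ j mod X) = 1"

definition letter :: "nat \<Rightarrow> nat \<Rightarrow> nat \<Rightarrow> nat \<Rightarrow> (nat \<Rightarrow> nat) \<Rightarrow> nat \<Rightarrow> nat \<Rightarrow> nat \<Rightarrow> nat" where
  "letter k n g X a q j t = top_char k g (X ^ k) (low k g X) (gadget_length k g (X ^ k)) (per_block k n g X)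
     (table_bit k n g X a q j) j t"

definition lcs_strings :: "nat \<Rightarrow> nat \<Rightarrow> nat \<Rightarrow> nat \<Rightarrow> (nat \<Rightarrow> nat) \<Rightarrow> nat \<Rightarrow> nat list list" where
  "lcs_strings k n g X a q = map (\<lambda>j. map (letter k n g X a q j) [0..<lcs_size k n g X]) [0..<k]"

definition lcs_threshold :: "nat \<Rightarrow> nat \<Rightarrow> nat \<Rightarrow> nat \<Rightarrow> nat" where
  "lcs_threshold k n g X = threshold k (low k g X) (gadget_length k g (X ^ k)) (per_block k n g X)"

lemma block_size_pos: "0 < g \<Longrightarrow> 0 < X \<Longrightarrow> 0 < block_size k g X"
  by (simp add: block_size_def slot_length_def gadget_length_def)

lemma per_block_pos: "0 < g \<Longrightarrow> 0 < X \<Longrightarrow> 0 < per_block k n g X"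
  using block_size_pos[of g X k] by (auto simp: per_block_def lcs_size_def div_greater_zero_iff)

lemma letter_less: "2 \<le> k \<Longrightarrow> 0 < g \<Longrightarrow> 0 < X \<Longrightarrow> letter k n g X a q j t < 4 * k"
  unfolding letter_def by (rule top_char_less) auto

lemma FOV_yes_iff_lcs:
  assumes k: "2 \<le> k" and g: "0 < g" and Vs: "length Vs = k" "\<forall>V\<in>set Vs. length V = n \<and> set V \<subseteq> factored_vectors g b"
    and xs: "xs = n # g # b # concat (map (encode_factored_vector b) (concat Vs))"
    and a: "a = (\<lambda>i. if i < length xs then xs ! i else 0)"
    and X: "X = 2 ^ b"
  shows "FOV_yes k g b (\<lambda>j. set (Vs ! j)) \<longleftrightarrow>
    (\<exists>q<pieces k n g X ^ k. lcs_threshold k n g X < lcs_length (lcs_strings k n g X a q))"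
proof -
  define R where "R = X ^ k"
  define m where "m = per_block k n g X"
  define s where "s = pieces k n g X"
  define idx where "idx q j r = min (q div s ^ j mod s * m + r) (n - 1)" for q j r
  have X0: "0 < X" and R0: "0 < R" by (simp_all add: X R_def)
  have m0: "0 < m" using per_block_pos[OF g X0] by (simp add: m_def)
  have enc: "a (3 + ((j * n + r) * g + i) * X + p) = of_bool (bits b p \<in> Vs ! j ! r ! i)"
    if "j < k" "r < n" "i < g" "p < X" for j r i p
    using encode_nth[OF Vs that(1-3), of p] that(4) unfolding a xs X
    by (simp add: numeral_3_eq_3)
  have lcs: "lcs_threshold k n g X < lcs_length (lcs_strings k n g X a q) \<longleftrightarrow>
      (\<exists>r. (\<forall>j<k. r j < m) \<and> (\<forall>i<g. \<exists>t<R. \<forall>j<k. table_bit k n g X a q j (r j) (i * R + t)))" for q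
    unfolding lcs_threshold_def lcs_strings_def letter_def m_def R_def
  proof (rule lcs_iff[OF k _ g low_def refl])
    show "0 < X ^ k" using X0 by simp
    have "per_block k n g X * block_size k g X \<le> lcs_size k n g X"
      by (simp add: per_block_def mult.commute)
    then show "9 * per_block k n g X * slot_length k (low k g X) (gadget_length k g (X ^ k)) \<le> lcs_size k n g X"
      by (simp add: block_size_def ac_simps)
  qed
  have tb: "(\<forall>j<k. table_bit k n g X a q j (r j) (i * R + t)) \<longleftrightarrow> digit_and X t (k - 1) = 0 \<and>
      (\<forall>j<k. bits b (t div X ^ j mod X) \<in> Vs ! j ! idx q j (r j) ! i)" if "i < g" "t < R" "0 < n" for q r i t
  proof -
    have 1: "(i * R + t) mod X ^ k = t" "(i * R + t) div X ^ k = i"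
      unfolding R_def[symmetric] using that(2) by simp_all
    have 2: "idx q j r < n" for j r using that(3) by (auto simp: idx_def)
    have "table_bit k n g X a q j (r j) (i * R + t) \<longleftrightarrow> digit_and X t (k - 1) = 0 \<and>
      bits b (t div X ^ j mod X) \<in> Vs ! j ! idx q j (r j) ! i" if "j < k" for j
      using enc[OF that 2[of j "r j"] \<open>i < g\<close>, of "t div X ^ j mod X"] X0
      unfolding table_bit_def 1 s_def[symmetric] m_def[symmetric] idx_def[symmetric] by simp
    then show ?thesis using k by (metis (no_types, lifting) zero_less_numeral less_le_trans)
  qed
  show ?thesis
  proof (cases "n = 0")
    case True
    have "s = (n + (m - 1)) div m" by (simp only: s_def pieces_def m_def)
    then have "s = 0" using True m0 by simp
    then have s: "pieces k n g X ^ k = 0" using k by (simp add: zero_power s_def)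
    have "\<not> (\<forall>j<k. r j < n)" for r :: "nat \<Rightarrow> nat" using k True by (auto intro!: exI[of _ 0])
    then have "\<not> FOV_yes k g b (\<lambda>j. set (Vs ! j))" using k FOV_yes_iff[OF _ Vs] by auto
    then show ?thesis unfolding s by blast
  next
    case False
    then have n: "0 < n" by simp
    have "(\<exists>r. (\<forall>j<k. r j < n) \<and> (\<forall>i<g. \<exists>t<R. digit_and X t (k - 1) = 0 \<and>
        (\<forall>j<k. bits b (t div X ^ j mod X) \<in> Vs ! j ! r j ! i)))
      \<longleftrightarrow> (\<exists>q<s ^ k. \<exists>r. (\<forall>j<k. r j < m) \<and> (\<forall>i<g. \<exists>t<R. digit_and X t (k - 1) = 0 \<and>
        (\<forall>j<k. bits b (t div X ^ j mod X) \<in> Vs ! j ! idx q j (r j) ! i)))" (is "?L \<longleftrightarrow> ?R")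
    proof
      assume ?L
      then obtain r where r: "\<And>j. j < k \<Longrightarrow> r j < n" and yes: "\<forall>i<g. \<exists>t<R. digit_and X t (k - 1) = 0 \<and>
        (\<forall>j<k. bits b (t div X ^ j mod X) \<in> Vs ! j ! r j ! i)" by blast
      \<comment> \<open>\<open>s\<close> is the quotient of \<open>n\<close> and \<open>m\<close>
        rounded up, so there is a block that contains index \<open>r j\<close>.\<close>
      have "r j div m < s" if "j < k" for j
      proof -
        have "r j div m * m \<le> r j" by simp
        moreover have "(r j div m + 1) * m = r j div m * m + m" by simp
        ultimately have "(r j div m + 1) * m \<le> n + (m - 1)" using r[OF that] m0 by linarith
        then have "r j div m + 1 \<le> (n + (m - 1)) div m" using m0 by (simp add: less_eq_div_iff_mult_less_eq)
        then show ?thesis by (simp add: s_def pieces_def m_def)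
      qed
      then obtain q where q: "q < s ^ k" "\<And>j. j < k \<Longrightarrow> q div s ^ j mod s = r j div m"
        using ex_digits[of k "\<lambda>j. r j div m" s] by blast
      have "idx q j (r j mod m) = r j" if "j < k" for j
        using q(2)[OF that] r[OF that] by (simp add: idx_def min_def)
      then have "\<forall>i<g. \<exists>t<R. digit_and X t (k - 1) = 0 \<and>
        (\<forall>j<k. bits b (t div X ^ j mod X) \<in> Vs ! j ! idx q j (r j mod m) ! i)" using yes by auto
      then show ?R using q(1) m0 by (intro exI[of _ q] conjI exI[of _ "\<lambda>j. r j mod m"]) auto
    next
      assume ?R
      then obtain q r where yes: "\<forall>i<g. \<exists>t<R. digit_and X t (k - 1) = 0 \<and>
        (\<forall>j<k. bits b (t div X ^ j mod X) \<in> Vs ! j ! idx q j (r j) ! i)" by blast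
      have "idx q j (r j) < n" for j using n by (auto simp: idx_def)
      then show ?L using yes by (intro exI[of _ "\<lambda>j. idx q j (r j)"]) blast
    qed
    also have "\<dots> \<longleftrightarrow> (\<exists>q<s ^ k. lcs_threshold k n g X < lcs_length (lcs_strings k n g X a q))"
      unfolding lcs by (simp add: tb n cong: conj_cong)
    finally show ?thesis using FOV_yes_iff[OF _ Vs] k unfolding X[symmetric] R_def[symmetric] s_def by simp
  qed
qed

section \<open>The program\<close>

abbreviation (input) "v_n \<equiv> 0::nat"
abbreviation (input) "v_g \<equiv> 1::nat"
abbreviation (input) "v_b \<equiv> 2::nat"
abbreviation (input) "v_X \<equiv> 3::nat"
abbreviation (input) "v_i \<equiv> 4::nat"
abbreviation (input) "v_pow \<equiv> 5::nat"
abbreviation (input) "v_M \<equiv> 6::nat"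
abbreviation (input) "v_q \<equiv> 7::nat"
abbreviation (input) "v_now \<equiv> 8::nat"
abbreviation (input) "v_ans \<equiv> 9::nat"
abbreviation (input) "v_total \<equiv> 10::nat"
abbreviation (input) "v_len \<equiv> 11::nat"
abbreviation (input) "v_val \<equiv> 12::nat"
abbreviation (input) "v_zero \<equiv> 13::nat"
abbreviation (input) "v_res \<equiv> 14::nat"
abbreviation (input) "v_bound \<equiv> 15::nat"

abbreviation (input) "e_add \<equiv> Bin Add"
abbreviation (input) "e_sub \<equiv> Bin Sub"
abbreviation (input) "e_mul \<equiv> Bin Mul"
abbreviation (input) "e_div \<equiv> Bin Div"
abbreviation (input) "e_mod \<equiv> Bin Mod"

primrec e_pow :: "expr \<Rightarrow> nat \<Rightarrow> expr" where
  "e_pow e 0 = Lit 1"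
| "e_pow e (Suc i) = e_mul e (e_pow e i)"

lemma val_e_pow [simp]: "val \<rho> a (e_pow e i) = val \<rho> a e ^ i"
  by (induction i) auto

definition "e_R k = e_pow (Var v_X) k"
definition "e_P k = e_mul (Var v_g) (e_R k)"
definition "e_low k = e_sub (e_add (e_mul (Var v_g) (e_add (e_P k) (Lit 1)))
  (e_mul (e_P k) (e_mul (Var v_g) (e_add (e_R k) (Lit (k - 2)))))) (Lit 1)"
definition "e_H k = e_mul (e_mul (Var v_g) (e_mul (Lit 2) (e_R k))) (e_mul (Lit (k + 1)) (e_P k))"
definition "e_slot k = e_add (e_low k) (e_add (e_H k) (e_add (e_low k) (e_mul (Lit (k - 1)) (e_H k))))"
definition "e_block k = e_mul (Lit 9) (e_slot k)"
definition "e_N k = IfLess (Var v_n) (e_block k) (e_block k) (Var v_n)"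
definition "e_m k = e_div (e_N k) (e_block k)"
definition "e_s k = e_div (e_add (Var v_n) (e_sub (e_m k) (Lit 1))) (e_m k)"
definition "e_threshold k = e_add (e_mul (e_m k) (e_low k)) (e_mul (e_H k) (e_mul (Lit (k - 1)) (e_mul (Lit 3) (e_m k))))"

lemma val_parameters:
  "val \<rho> a (e_R k) = \<rho> v_X ^ k"
  "val \<rho> a (e_P k) = \<rho> v_g * \<rho> v_X ^ k"
  "val \<rho> a (e_low k) = low k (\<rho> v_g) (\<rho> v_X)"
  "val \<rho> a (e_H k) = gadget_length k (\<rho> v_g) (\<rho> v_X ^ k)"
  "val \<rho> a (e_slot k) = slot_length k (low k (\<rho> v_g) (\<rho> v_X)) (gadget_length k (\<rho> v_g) (\<rho> v_X ^ k))"
  "val \<rho> a (e_block k) = block_size k (\<rho> v_g) (\<rho> v_X)"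
  "val \<rho> a (e_N k) = lcs_size k (\<rho> v_n) (\<rho> v_g) (\<rho> v_X)"
  "val \<rho> a (e_m k) = per_block k (\<rho> v_n) (\<rho> v_g) (\<rho> v_X)"
  "val \<rho> a (e_s k) = pieces k (\<rho> v_n) (\<rho> v_g) (\<rho> v_X)"
  "val \<rho> a (e_threshold k) = lcs_threshold k (\<rho> v_n) (\<rho> v_g) (\<rho> v_X)"
proof -
  show R: "val \<rho> a (e_R k) = \<rho> v_X ^ k" by (simp add: e_R_def)
  show P: "val \<rho> a (e_P k) = \<rho> v_g * \<rho> v_X ^ k" by (simp add: e_P_def R)
  show l: "val \<rho> a (e_low k) = low k (\<rho> v_g) (\<rho> v_X)" by (simp add: e_low_def R P low_def inner_high_def)
  show H: "val \<rho> a (e_H k) = gadget_length k (\<rho> v_g) (\<rho> v_X ^ k)" by (simp add: e_H_def R P gadget_length_def)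
  show s: "val \<rho> a (e_slot k) = slot_length k (low k (\<rho> v_g) (\<rho> v_X)) (gadget_length k (\<rho> v_g) (\<rho> v_X ^ k))"
    by (simp add: e_slot_def l H slot_length_def)
  show b: "val \<rho> a (e_block k) = block_size k (\<rho> v_g) (\<rho> v_X)" by (simp add: e_block_def s block_size_def)
  show N: "val \<rho> a (e_N k) = lcs_size k (\<rho> v_n) (\<rho> v_g) (\<rho> v_X)" by (simp add: e_N_def b lcs_size_def)
  show m: "val \<rho> a (e_m k) = per_block k (\<rho> v_n) (\<rho> v_g) (\<rho> v_X)" by (simp add: e_m_def b N per_block_def)
  show "val \<rho> a (e_s k) = pieces k (\<rho> v_n) (\<rho> v_g) (\<rho> v_X)" by (simp add: e_s_def m pieces_def)
  show "val \<rho> a (e_threshold k) = lcs_threshold k (\<rho> v_n) (\<rho> v_g) (\<rho> v_X)"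
    by (simp add: e_threshold_def m l H lcs_threshold_def threshold_def)
qed

primrec e_digit_and :: "expr \<Rightarrow> nat \<Rightarrow> expr" where
  "e_digit_and t 0 = e_mod t (Var v_X)"
| "e_digit_and t (Suc j) = Bin And (e_digit_and t j) (e_mod (e_div t (e_pow (Var v_X) (Suc j))) (Var v_X))"

lemma val_e_digit_and: "val \<rho> a (e_digit_and t j) = digit_and (\<rho> v_X) (val \<rho> a t) j"
  by (induction j) auto

definition "e_index k j r = (let v = e_add (e_mul (e_mod (e_div (Var v_q) (e_pow (e_s k) j)) (e_s k)) (e_m k)) r;
    last = e_sub (Var v_n) (Lit 1) in IfLess v last v last)"

text \<open>Expressions have no boolean values. A condition is rendered as an expression with two
  continuations, \<open>y\<close> if it holds and \<open>z\<close> if not;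
  \<open>e_inner_act\<close>, \<open>e_between\<close> and \<open>e_top_act\<close> follow the same
  pattern.\<close>

definition "e_table k j r p y z = (let t = e_mod p (e_R k) in
  IfEq (e_digit_and t (k - 1)) (Lit 0)
    (IfEq (Arr (e_add (Lit 3) (e_add (e_mul (e_add (e_mul (e_add (e_mul (Lit j) (Var v_n)) (e_index k j r)) (Var v_g))
        (e_div p (e_R k))) (Var v_X)) (e_mod (e_div t (e_pow (Var v_X) j)) (Var v_X))))) (Lit 1) y z) z)"

lemma val_e_table:
  "val \<rho> a (e_table k j r p y z) = (if table_bit k (\<rho> v_n) (\<rho> v_g) (\<rho> v_X) a (\<rho> v_q) j (val \<rho> a r) (val \<rho> a p)
     then val \<rho> a y else val \<rho> a z)"
proof -
  have "val \<rho> a (e_index k j r) = min (\<rho> v_q div pieces k (\<rho> v_n) (\<rho> v_g) (\<rho> v_X) ^ j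
      mod pieces k (\<rho> v_n) (\<rho> v_g) (\<rho> v_X) * per_block k (\<rho> v_n) (\<rho> v_g) (\<rho> v_X) + val \<rho> a r) (\<rho> v_n - 1)"
    by (simp add: e_index_def Let_def val_parameters min_def)
  then show ?thesis
    by (simp add: e_table_def Let_def table_bit_def val_parameters val_e_digit_and add.assoc)
qed

definition "e_inner_act k j u y z = (let v = e_mod u (e_mul (Lit 2) (e_R k)) in
  if j = 1 then IfLess v (e_R k) y z else IfEq v (e_R k) y z)"

lemma val_e_inner_act:
  "val \<rho> a (e_inner_act k j u y z) = (if inner_act (\<rho> v_X ^ k) j (val \<rho> a u) then val \<rho> a y else val \<rho> a z)"
  by (simp add: e_inner_act_def inner_act_def Let_def val_parameters)

definition "e_inner k j r t = (let L = e_mul (Lit (k + 1)) (e_P k); u = e_div t L; c = e_mod t L;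
    p = e_div c (Lit 2); P2 = e_mul (e_P k) (Lit 2); l = e_add (e_div (e_sub c P2) (e_P k)) (Lit 1);
    R2 = e_mul (Lit 2) (e_R k); jk = Lit (junk j) in
  IfLess c P2
    (e_inner_act k j u
      (IfEq (e_mod c (Lit 2)) (Lit 1) (Lit 0)
        (e_table k j r p
          (if j = 1 then IfEq p (e_add (e_mul (e_div u R2) (e_R k)) (e_mod u R2)) (Lit 1) jk
           else IfEq (e_div p (e_R k)) (e_div u R2) (Lit 1) jk) jk)) jk)
    (IfEq l (Lit j) (e_inner_act k j u (e_add (Lit 4) l) jk) (e_add (Lit 4) l)))"

lemma val_e_inner:
  "val \<rho> a (e_inner k j r t) = inner_char k (\<rho> v_g) (\<rho> v_X ^ k)
     (table_bit k (\<rho> v_n) (\<rho> v_g) (\<rho> v_X) a (\<rho> v_q) j (val \<rho> a r)) j (val \<rho> a t)"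
  unfolding e_inner_def inner_char_def Let_def
  by (auto simp: val_parameters val_e_table val_e_inner_act inner_sep_def)

definition "e_between x lo hi y z = IfLess x lo z (IfLess x hi y z)"

lemma val_e_between: "val \<rho> a (e_between x lo hi y z)
    = (if val \<rho> a lo \<le> val \<rho> a x \<and> val \<rho> a x < val \<rho> a hi then val \<rho> a y else val \<rho> a z)"
  by (auto simp: e_between_def)

definition "e_times k c = e_mul (Lit c) (e_m k)"

definition "e_top_act k j u y z = (if j = 0 then e_between u (e_times k 4) (e_times k 5) y z
  else e_between u (e_times k 3) (e_times k 6) y z)"

lemma val_e_top_act: "val \<rho> a (e_top_act k j u y z)
    = (if top_act (per_block k (\<rho> v_n) (\<rho> v_g) (\<rho> v_X)) j (val \<rho> a u) then val \<rho> a y else val \<rho> a z)"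
  by (simp add: e_top_act_def top_act_def val_e_between e_times_def val_parameters)

definition "e_letter k j t = (let u = e_div t (e_slot k); r = e_mod t (e_slot k); r1 = e_sub r (e_low k);
    r2 = e_sub r1 (e_H k); l = e_add (e_div (e_sub r2 (e_low k)) (e_H k)) (Lit 1); jk = Lit (junk j) in
  IfLess t (e_mul (e_times k 9) (e_slot k))
    (IfLess r (e_low k) (if j = 0 then e_top_act k j u (Lit 2) jk else jk)
      (IfLess r1 (e_H k)
        (e_between u (e_times k 4) (e_times k 5) (e_inner k j (e_sub u (e_times k 4)) r1) jk)
        (IfLess r2 (e_low k) (if j \<noteq> 0 then e_top_act k j u (Lit 2) jk else jk)
          (IfEq l (Lit j) (e_top_act k j u (e_add (Lit (4 + k)) l) jk) (e_add (Lit (4 + k)) l))))) jk)"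

lemma val_e_letter:
  "val \<rho> a (e_letter k j t) = letter k (\<rho> v_n) (\<rho> v_g) (\<rho> v_X) a (\<rho> v_q) j (val \<rho> a t)"
  unfolding e_letter_def letter_def top_char_def Let_def
  by (auto simp: val_parameters val_e_between val_e_top_act val_e_inner e_times_def top_sep_def)

text \<open>The shape of the expression for a letter depends on the number of the string, which is
  known only at run time. As \<open>k\<close> is constant, the choice can be unrolled into
  \<open>k\<close> cases.\<close>

primrec e_select :: "nat \<Rightarrow> expr \<Rightarrow> expr \<Rightarrow> nat \<Rightarrow> expr" where
  "e_select k j t 0 = e_letter k 0 t"
| "e_select k j t (Suc i) = IfEq j (Lit (Suc i)) (e_letter k (Suc i) t) (e_select k j t i)"

lemma val_e_select: "val \<rho> a j \<le> i \<Longrightarrow> val \<rho> a (e_select k j t i) =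
    letter k (\<rho> v_n) (\<rho> v_g) (\<rho> v_X) a (\<rho> v_q) (val \<rho> a j) (val \<rho> a t)"
  by (induction i) (auto simp: val_e_letter le_Suc_eq)

definition lcs_input :: "nat \<Rightarrow> nat \<Rightarrow> nat \<Rightarrow> nat \<Rightarrow> (nat \<Rightarrow> nat) \<Rightarrow> nat \<Rightarrow> nat list" where
  "lcs_input k n g X a q = lcs_size k n g X # concat (lcs_strings k n g X a q)"

definition "e_fill k = (let i = e_sub (Var v_i) (Lit 1) in
  IfLess (Var v_i) (Lit 1) (e_N k) (e_select k (e_div i (e_N k)) (e_mod i (e_N k)) (k - 1)))"

lemma length_lcs_input: "length (lcs_input k n g X a q) = 1 + k * lcs_size k n g X"
  unfolding lcs_input_def list.size
  by (subst length_concat_uniform[where l = "lcs_size k n g X"]) (auto simp: lcs_strings_def)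

lemma val_e_fill:
  assumes "1 \<le> k" "\<rho> v_i < 1 + k * lcs_size k (\<rho> v_n) (\<rho> v_g) (\<rho> v_X)"
  shows "val \<rho> a (e_fill k) = lcs_input k (\<rho> v_n) (\<rho> v_g) (\<rho> v_X) a (\<rho> v_q) ! \<rho> v_i"
proof (cases "\<rho> v_i")
  case 0
  then show ?thesis by (simp add: e_fill_def Let_def lcs_input_def val_parameters)
next
  case (Suc i)
  let ?N = "lcs_size k (\<rho> v_n) (\<rho> v_g) (\<rho> v_X)"
  have i: "i < k * ?N" using assms Suc by simp
  then have N: "0 < ?N" by (auto intro: gr0I)
  have d: "i div ?N < k" using i by (simp add: less_mult_imp_div_less)
  have "lcs_input k (\<rho> v_n) (\<rho> v_g) (\<rho> v_X) a (\<rho> v_q) ! \<rho> v_i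
      = concat (lcs_strings k (\<rho> v_n) (\<rho> v_g) (\<rho> v_X) a (\<rho> v_q)) ! (i div ?N * ?N + i mod ?N)"
    using Suc by (simp add: lcs_input_def)
  also have "\<dots> = lcs_strings k (\<rho> v_n) (\<rho> v_g) (\<rho> v_X) a (\<rho> v_q) ! (i div ?N) ! (i mod ?N)"
    by (rule nth_concat_uniform) (use d N in \<open>auto simp: lcs_strings_def\<close>)
  also have "\<dots> = letter k (\<rho> v_n) (\<rho> v_g) (\<rho> v_X) a (\<rho> v_q) (i div ?N) (i mod ?N)"
    using d N by (simp add: lcs_strings_def)
  also have "\<dots> = val \<rho> a (e_fill k)"
    using d Suc by (subst e_fill_def) (simp add: Let_def val_e_select val_parameters)
  finally show ?thesis ..
qed

definition fill_program :: "nat \<Rightarrow> program" where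
  "fill_program k = While (Less (vreg v_i) (vreg v_len))
     (Seq (Assign v_val (e_fill k))
     (Seq (Store (data 0) (vreg v_i) (vreg v_val))
     (Seq (Store (stamp 0) (vreg v_i) (vreg v_now))
       (Assign v_i (e_add (Var v_i) (Lit 1))))))"

text \<open>The time stamp of round \<open>q\<close> is \<open>q + 1\<close>, so the initial stamps
  0 are invalid from the beginning. The LCS algorithm expects zeros in its registers, which
  \<open>zero_regs\<close> restores; \<open>v_ans\<close> accumulates a disjunction over the
  rounds.\<close>

definition round_program :: "nat \<Rightarrow> nat \<Rightarrow> program \<Rightarrow> program" where
  "round_program k r P =
     Seq (zero_regs r)
     (Seq (Assign v_now (e_add (Var v_q) (Lit 1)))
     (Seq (Assign v_i (Lit 0))
     (Seq (fill_program k)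
     (Seq (sim v_M v_now P)
     (Seq (Op And (vreg v_res) (sreg 0) (sreg 0))
     (Seq (Assign v_ans (IfLess (e_threshold k) (Var v_res) (Lit 1) (Var v_ans)))
       (Assign v_q (e_add (Var v_q) (Lit 1)))))))))"

text \<open>The simulated word size belongs to size \<open>N\<close>, and there is no logarithm
  instruction. Doubling until \<open>N\<close> is exceeded gives
  \<open>2 ^ (floor_log N + 1)\<close>, whose \<open>c\<close>-th power is the modulus
  \<open>2 ^ word_size c N\<close>.\<close>

definition main_program :: "nat \<Rightarrow> nat \<Rightarrow> nat \<Rightarrow> program \<Rightarrow> program" where
  "main_program k c r P =
     Seq (Assign v_X (Lit 1))
     (Seq (While (Less (vreg v_i) (vreg v_b))
        (Seq (Assign v_X (e_add (Var v_X) (Var v_X))) (Assign v_i (e_add (Var v_i) (Lit 1)))))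
     (Seq (Assign v_bound (e_add (e_N k) (Lit 1)))
     (Seq (Assign v_pow (Lit 2))
     (Seq (While (Less (vreg v_pow) (vreg v_bound)) (Assign v_pow (e_add (Var v_pow) (Var v_pow))))
     (Seq (Assign v_M (e_pow (Var v_pow) c))
     (Seq (Assign v_total (e_pow (e_s k) k))
     (Seq (Assign v_len (e_add (Lit 1) (e_mul (Lit k) (e_N k))))
       (While (Less (vreg v_q) (vreg v_total)) (round_program k r P)))))))))"

text \<open>If \<open>g = 0\<close> then each list contains at most the empty vector, so \<open>n \<le> 1\<close> and the answer is \<open>n\<close>.\<close>

definition fov_program :: "nat \<Rightarrow> nat \<Rightarrow> nat \<Rightarrow> program \<Rightarrow> program" where
  "fov_program k c r P =
     Seq (Assign v_n (Arr (Lit 0)))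
     (Seq (Assign v_g (Arr (Lit 1)))
     (Seq (Assign v_b (Arr (Lit 2)))
     (Seq (If (Eq (vreg v_g) (vreg v_zero)) (Assign v_ans (Var v_n)) (main_program k c r P))
       (Op And (sreg 0) (vreg v_ans) (vreg v_ans)))))"

section \<open>Correctness of the program\<close>

lemma runs_SeqI: "runs w P s T (\<lambda>s'. runs w P' s' T' Q) \<Longrightarrow> runs w (Seq P P') s (T + T') Q"
  by (rule runs_Seq)

text \<open>These are the expressions that the program evaluates. The list depends on
  \<open>k\<close> and \<open>c\<close> only, so a single constant in the word size can accommodate
  all of them.\<close>

definition used_exprs :: "nat \<Rightarrow> nat \<Rightarrow> expr list" where
  "used_exprs k c = [Arr (Lit 0), Arr (Lit 1), Arr (Lit 2), Var v_n, Lit 0, Lit 1, Lit 2,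
     e_add (Var v_X) (Var v_X), e_add (Var v_i) (Lit 1), e_add (e_N k) (Lit 1), e_add (Var v_pow) (Var v_pow),
     e_pow (Var v_pow) c, e_pow (e_s k) k, e_add (Lit 1) (e_mul (Lit k) (e_N k)), e_fill k,
     e_add (Var v_q) (Lit 1), IfLess (e_threshold k) (Var v_res) (Lit 1) (Var v_ans)]"

definition fill_time :: "nat \<Rightarrow> nat" where
  "fill_time k = cost (e_fill k) + 1 + (1 + (1 + (cost (e_add (Var v_i) (Lit 1)) + 1)))"

definition round_time :: "nat \<Rightarrow> nat \<Rightarrow> nat \<Rightarrow> nat \<Rightarrow> nat" where
  "round_time k r N T = r + 1 + (cost (e_add (Var v_q) (Lit 1)) + 1 + (cost (Lit 0) + 1 +
     ((1 + k * N) * (fill_time k + 1) + 1 + (3 * T + (1 +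
     (cost (IfLess (e_threshold k) (Var v_res) (Lit 1) (Var v_ans)) + 1 + (cost (e_add (Var v_q) (Lit 1)) + 1)))))))"

definition init_time :: "nat \<Rightarrow> nat \<Rightarrow> nat \<Rightarrow> nat \<Rightarrow> nat \<Rightarrow> nat" where
  "init_time k c b N R = cost (Lit 1) + 1 + (b * (cost (e_add (Var v_X) (Var v_X)) + 1
       + (cost (e_add (Var v_i) (Lit 1)) + 1) + 1) + 1 +
     (cost (e_add (e_N k) (Lit 1)) + 1 + (cost (Lit 2) + 1 +
     (floor_log N * (cost (e_add (Var v_pow) (Var v_pow)) + 1 + 1) + 1 +
     (cost (e_pow (Var v_pow) c) + 1 + (cost (e_pow (e_s k) k) + 1 +
     (cost (e_add (Lit 1) (e_mul (Lit k) (e_N k))) + 1 + R)))))))"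

definition fov_time :: "nat \<Rightarrow> nat \<Rightarrow> nat \<Rightarrow> nat \<Rightarrow> nat \<Rightarrow> nat \<Rightarrow> nat \<Rightarrow> nat" where
  "fov_time k c r b N T tot = cost (Arr (Lit 0)) + 1 + (cost (Arr (Lit 1)) + 1 + (cost (Arr (Lit 2)) + 1 +
     (1 + init_time k c b N (tot * (round_time k r N T + 1) + 1) + 1)))"

text \<open>One instance with its parameters. \<open>B\<close> bounds the input and all values that
  variables will hold; \<open>w\<close> is the actual word size and \<open>w1\<close> the simulated
  one; \<open>answer q\<close> is the output of the LCS algorithm for block tuple
  \<open>q\<close>.\<close>

locale reduction =
  fixes k c r n g b X B w w1 T N total :: nat and P :: program and a0 :: "nat \<Rightarrow> nat" and answer :: "nat \<Rightarrow> nat"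
  assumes k: "2 \<le> k" and X: "X = 2 ^ b"
    and N: "N = lcs_size k n g X" and total: "total = pieces k n g X ^ k"
    and a0: "a0 0 = n" "a0 1 = g" "a0 2 = b" "\<And>i. a0 i \<le> B"
    and P: "regs_below P r" "0 < r"
    and w1: "w1 = word_size c N"
    and B: "2 \<le> B" "n \<le> B" "g \<le> B" "b \<le> B" "X \<le> B" "2 * N + 1 \<le> B" "2 ^ w1 \<le> B" "total \<le> B" "1 + k * N \<le> B"
    and w: "\<And>e. e \<in> set (used_exprs k c) \<Longrightarrow> max_lit e \<le> B \<and> B ^ expr_size e < 2 ^ w"
    and input: "\<And>q x. q < total \<Longrightarrow> x \<in> set (lcs_input k n g X a0 q) \<Longrightarrow> x < 2 ^ w1"
    and lcs: "\<And>q. q < total \<Longrightarrow> \<exists>t s. exec w1 P (initial_state (lcs_input k n g X a0 q)) t s \<and> t \<le> T \<and> reg s 0 = answer q"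
begin

definition good :: "state \<Rightarrow> bool" where
  "good s \<longleftrightarrow> (\<forall>i. vars s i \<le> B) \<and> mem s 0 = a0"

definition params :: "state \<Rightarrow> bool" where
  "params s \<longleftrightarrow> good s \<and> vars s v_n = n \<and> vars s v_g = g \<and> vars s v_b = b \<and> vars s v_X = X \<and>
     vars s v_M = 2 ^ w1 \<and> vars s v_total = total \<and> vars s v_len = 1 + k * N"

lemma assign:
  assumes "good s" "e \<in> set (used_exprs k c)" "val (vars s) a0 e \<le> B"
    and "\<And>s'. vars s' = (vars s)(x := val (vars s) a0 e) \<Longrightarrow> sregs s' = sregs s \<Longrightarrow> mem s' = mem s \<Longrightarrow> good s' \<Longrightarrow> Q s'"
  shows "runs w (Assign x e) s (cost e + 1) Q"
proof (rule runs_Assign)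
  show "vars s i \<le> B" "mem s 0 i \<le> B" for i using assms(1) a0(4) by (auto simp: good_def)
  fix s' assume "vars s' = (vars s)(x := val (vars s) (mem s 0) e)" "sregs s' = sregs s" "mem s' = mem s"
  then show "Q s'" using assms by (intro assms(4)) (auto simp: good_def)
qed (use B(1) w[OF assms(2)] in auto)

text \<open>Before the loop all stamps are at most \<open>q\<close>, so the simulated memory is
  empty at time \<open>q + 1\<close>. Afterwards exactly the \<open>1 + k * N\<close> input cells
  are valid, which is the initial memory of the LCS algorithm.\<close>

lemma fill:
  assumes s: "params s" "vars s v_i = 0" "vars s v_q = q" "vars s v_now = q + 1" and q: "q < total"
    and stamps: "\<And>a l. mem s (stamp a) l \<le> q"
  shows "runs w (fill_program k) s ((1 + k * N) * (fill_time k + 1) + 1)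
    (\<lambda>s'. good s' \<and> (\<forall>x. x \<noteq> v_i \<longrightarrow> x \<noteq> v_val \<longrightarrow> vars s' x = vars s x) \<and> sregs s' = sregs s \<and>
      (\<forall>a l. mem s' (stamp a) l = q + 1 \<longleftrightarrow> a = 0 \<and> l < 1 + k * N) \<and> (\<forall>a l. mem s' (stamp a) l \<le> q + 1) \<and>
      (\<forall>l<1 + k * N. mem s' (data 0) l = lcs_input k n g X a0 q ! l))"
proof -
  define Inv where "Inv i s' \<longleftrightarrow> good s' \<and> vars s' v_i = i \<and>
      (\<forall>x. x \<noteq> v_i \<longrightarrow> x \<noteq> v_val \<longrightarrow> vars s' x = vars s x) \<and> sregs s' = sregs s \<and>
      (\<forall>a l. mem s' (stamp a) l = q + 1 \<longleftrightarrow> a = 0 \<and> l < i) \<and> (\<forall>a l. mem s' (stamp a) l \<le> q + 1) \<and>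
      (\<forall>l<i. mem s' (data 0) l = lcs_input k n g X a0 q ! l)" for i s'
  have "runs w (fill_program k) s ((1 + k * N) * (fill_time k + 1) + 1) (Inv (1 + k * N))"
    unfolding fill_program_def
  proof (rule runs_While)
    have "mem s (stamp a) l \<noteq> q + 1" for a l using stamps[of a l] by simp
    then show "Inv 0 s" using s stamps by (auto simp: Inv_def params_def intro: le_SucI)
    show "\<not> holds (Less (vreg v_i) (vreg v_len)) s'" if "Inv (1 + k * N) s'" for s'
      using that s by (auto simp: Inv_def params_def)
    fix i s1 assume I: "Inv i s1" and i: "i < 1 + k * N"
    have v1: "vars s1 v_n = n" "vars s1 v_g = g" "vars s1 v_X = X" "vars s1 v_q = q" "vars s1 v_i = i"
      "vars s1 v_now = q + 1" "vars s1 v_len = 1 + k * N" and good1: "good s1"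
      using I s by (auto simp: Inv_def params_def)
    let ?x = "lcs_input k n g X a0 q ! i"
    have val: "val (vars s1) a0 (e_fill k) = ?x"
      using val_e_fill[of k "vars s1" a0] k v1 i by (simp add: N)
    have x: "?x \<le> B"
    proof -
      have "?x \<in> set (lcs_input k n g X a0 q)" using i by (intro nth_mem) (simp add: length_lcs_input N)
      then show ?thesis using input[OF q, of ?x] B(7) by simp
    qed
    have "runs w (Seq (Assign v_val (e_fill k)) (Seq (Store (data 0) (vreg v_i) (vreg v_val))
     (Seq (Store (stamp 0) (vreg v_i) (vreg v_now)) (Assign v_i (e_add (Var v_i) (Lit 1)))))) s1 (fill_time k) (Inv (Suc i))"
      unfolding fill_time_def
    proof (rule runs_SeqI, rule assign[OF good1])
      show "e_fill k \<in> set (used_exprs k c)" by (simp add: used_exprs_def)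
      show "val (vars s1) a0 (e_fill k) \<le> B" using val x by simp
      fix s2 assume 2: "vars s2 = (vars s1)(v_val := val (vars s1) a0 (e_fill k))" "sregs s2 = sregs s1"
        "mem s2 = mem s1" "good s2"
      show "runs w (Seq (Store (data 0) (vreg v_i) (vreg v_val))
         (Seq (Store (stamp 0) (vreg v_i) (vreg v_now)) (Assign v_i (e_add (Var v_i) (Lit 1))))) s2
         (1 + (1 + (cost (e_add (Var v_i) (Lit 1)) + 1))) (Inv (Suc i))"
      proof (rule runs_SeqI, rule runs_Store, rule runs_SeqI, rule runs_Store)
        let ?\<mu> = "(mem s2)(data 0 := (mem s2 (data 0))(reg s2 (vreg v_i) := reg s2 (vreg v_val)))"
        let ?s3 = "s2\<lparr>mem := ?\<mu>\<rparr>"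
        let ?s4 = "?s3\<lparr>mem := (mem ?s3)(stamp 0 := (mem ?s3 (stamp 0))(reg ?s3 (vreg v_i) := reg ?s3 (vreg v_now)))\<rparr>"
        have mem4: "mem ?s4 = (mem s1)(data 0 := (mem s1 (data 0))(i := ?x), stamp 0 := (mem s1 (stamp 0))(i := q + 1))"
          using 2 val v1 by (simp add: vars_def[symmetric])
        have vars4: "vars ?s4 = (vars s1)(v_val := ?x)" "sregs ?s4 = sregs s1" using 2 val by simp_all
        have good4: "good ?s4" using 2 unfolding good_def by simp
        show "runs w (Assign v_i (e_add (Var v_i) (Lit 1))) ?s4 (cost (e_add (Var v_i) (Lit 1)) + 1) (Inv (Suc i))"
        proof (rule assign[OF good4])
          show "e_add (Var v_i) (Lit 1) \<in> set (used_exprs k c)" by (simp add: used_exprs_def)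
          show "val (vars ?s4) a0 (e_add (Var v_i) (Lit 1)) \<le> B"
            unfolding vars4 using v1 i B(9) by simp
          fix s5 assume 5: "vars s5 = (vars ?s4)(v_i := val (vars ?s4) a0 (e_add (Var v_i) (Lit 1)))"
            "sregs s5 = sregs ?s4" "mem s5 = mem ?s4" "good s5"
          have vars5: "vars s5 = (vars s1)(v_val := ?x, v_i := i + 1)" using 5(1) unfolding vars4 using v1 by simp
          have mem5: "mem s5 = (mem s1)(data 0 := (mem s1 (data 0))(i := ?x), stamp 0 := (mem s1 (stamp 0))(i := q + 1))"
            using 5(3) mem4 by simp
          have st: "mem s5 (stamp a) l = (if a = 0 \<and> l = i then q + 1 else mem s1 (stamp a) l)" for a l
            unfolding mem5 by simp
          have da: "mem s5 (data 0) l = (if l = i then ?x else mem s1 (data 0) l)" for l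
            unfolding mem5 by simp
          show "Inv (Suc i) s5"
            unfolding Inv_def st da using I 5(2,4) vars4(2) vars5 unfolding Inv_def
            by (auto simp: less_Suc_eq)
        qed
      qed
    qed
    then show "holds (Less (vreg v_i) (vreg v_len)) s1 \<and>
      runs w (Seq (Assign v_val (e_fill k)) (Seq (Store (data 0) (vreg v_i) (vreg v_val))
     (Seq (Store (stamp 0) (vreg v_i) (vreg v_now)) (Assign v_i (e_add (Var v_i) (Lit 1)))))) s1 (fill_time k) (Inv (Suc i))"
      using v1 i by simp
  qed
  then show ?thesis by (rule runs_weaken) (auto simp: Inv_def)
qed

lemma round:
  assumes s: "params s" "vars s v_q = q" "q < total" and stamps: "\<And>a l. mem s (stamp a) l \<le> q"
  shows "runs w (round_program k r P) s (round_time k r N T)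
    (\<lambda>s'. params s' \<and> vars s' v_q = q + 1 \<and> (\<forall>a l. mem s' (stamp a) l \<le> q + 1) \<and>
      vars s' v_ans = (if lcs_threshold k n g X < answer q then 1 else vars s v_ans))"
  unfolding round_program_def round_time_def
proof (rule runs_Seq[OF runs_zero_regs])
  let ?Q = "\<lambda>s'. params s' \<and> vars s' v_q = q + 1 \<and> (\<forall>a l. mem s' (stamp a) l \<le> q + 1) \<and> vars s' v_ans = (if lcs_threshold k n g X < answer q then 1 else vars s v_ans)"
  let ?p7 = "Assign v_q (e_add (Var v_q) (Lit 1))"
  let ?t7 = "cost (e_add (Var v_q) (Lit 1)) + 1"
  let ?p6 = "Seq (Assign v_ans (IfLess (e_threshold k) (Var v_res) (Lit 1) (Var v_ans))) ?p7"
  let ?t6 = "cost (IfLess (e_threshold k) (Var v_res) (Lit 1) (Var v_ans)) + 1 + ?t7"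
  let ?p5 = "Seq (Op And (vreg v_res) (sreg 0) (sreg 0)) ?p6"
  let ?t5 = "1 + ?t6"
  let ?p4 = "Seq (sim v_M v_now P) ?p5"
  let ?t4 = "3 * T + ?t5"
  let ?p3 = "Seq (fill_program k) ?p4"
  let ?t3 = "(1 + k * N) * (fill_time k + 1) + 1 + ?t4"
  let ?p2 = "Seq (Assign v_i (Lit 0)) ?p3"
  let ?t2 = "cost (Lit 0) + 1 + ?t3"
  let ?p1 = "Seq (Assign v_now (e_add (Var v_q) (Lit 1))) ?p2"
  let ?t1 = "cost (e_add (Var v_q) (Lit 1)) + 1 + ?t2"
  fix s1 assume 1: "vars s1 = vars s \<and> mem s1 = mem s \<and> (\<forall>i<r. sregs s1 i = 0)"
  then have good1: "good s1" using s by (simp add: params_def good_def)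
  show "runs w ?p1 s1 ?t1 ?Q"
  proof (rule runs_SeqI, rule assign[OF good1])
    show "e_add (Var v_q) (Lit 1) \<in> set (used_exprs k c)" by (simp add: used_exprs_def)
    show "val (vars s1) a0 (e_add (Var v_q) (Lit 1)) \<le> B" using 1 s B(8) by simp
    fix s2 assume 2: "vars s2 = (vars s1)(v_now := val (vars s1) a0 (e_add (Var v_q) (Lit 1)))" "sregs s2 = sregs s1"
        "mem s2 = mem s1" "good s2"
    show "runs w ?p2 s2 ?t2 ?Q"
    proof (rule runs_SeqI, rule assign[OF 2(4)])
      show "Lit 0 \<in> set (used_exprs k c)" by (simp add: used_exprs_def)
      show "val (vars s2) a0 (Lit 0) \<le> B" by simp
      fix s3 assume 3: "vars s3 = (vars s2)(v_i := val (vars s2) a0 (Lit 0))" "sregs s3 = sregs s2"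
        "mem s3 = mem s2" "good s3"
      have vars3: "vars s3 = (vars s)(v_now := q + 1, v_i := 0)" using 1 2 3 s by simp
      have params3: "params s3" using s(1) 3(4) unfolding params_def vars3 by simp
      show "runs w ?p3 s3 ?t3 ?Q"
      proof (rule runs_Seq[OF fill[OF params3]])
        show "vars s3 v_i = 0" "vars s3 v_q = q" "vars s3 v_now = q + 1" "q < total" using vars3 s by simp_all
        show "mem s3 (stamp a) l \<le> q" for a l using stamps 1 2 3 by simp
        fix s4 assume 4: "good s4 \<and> (\<forall>x. x \<noteq> v_i \<longrightarrow> x \<noteq> v_val \<longrightarrow> vars s4 x = vars s3 x) \<and> sregs s4 = sregs s3 \<and>
          (\<forall>a l. mem s4 (stamp a) l = q + 1 \<longleftrightarrow> a = 0 \<and> l < 1 + k * N) \<and> (\<forall>a l. mem s4 (stamp a) l \<le> q + 1) \<and>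
          (\<forall>l<1 + k * N. mem s4 (data 0) l = lcs_input k n g X a0 q ! l)"
        let ?xs = "lcs_input k n g X a0 q"
        have len: "length ?xs = 1 + k * N" by (simp add: length_lcs_input N)
        have v4: "vars s4 v_now = q + 1" "vars s4 v_M = 2 ^ w1" "vars s4 v_n = n" "vars s4 v_g = g" "vars s4 v_X = X"
          "vars s4 v_b = b" "vars s4 v_total = total" "vars s4 v_len = 1 + k * N" "vars s4 v_q = q" "vars s4 v_ans = vars s v_ans"
          using 4 vars3 s by (simp_all add: params_def)
        have regs4: "sregs s4 i = 0" if "i < r" for i using that 1 2 3 4 by simp
        have rel: "sim_rel w1 r v_now (vars s4) a0 (initial_state ?xs) s4"
          unfolding sim_rel_def v4(1)
        proof (intro conjI allI impI)
          show "mem s4 0 = a0" using 4 by (simp add: good_def)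
          show "sregs s4 i = reg (initial_state ?xs) i" "reg (initial_state ?xs) i < 2 ^ w1" if "i < r" for i
            using regs4[OF that] by (simp_all add: initial_state_def)
          show "mem (initial_state ?xs) a l = mem s4 (data a) l" if "mem s4 (stamp a) l = q + 1" for a l
          proof -
            have "a = 0 \<and> l < 1 + k * N" using that 4 by blast
            then show ?thesis using 4 len by (simp add: initial_state_def)
          qed
          show "mem (initial_state ?xs) a l = 0" if "mem s4 (stamp a) l \<noteq> q + 1" for a l
          proof -
            have "\<not> (a = 0 \<and> l < 1 + k * N)" using that 4 by blast
            then show ?thesis using len by (auto simp: initial_state_def)
          qed
          show "mem (initial_state ?xs) a l < 2 ^ w1" for a l
            using input[OF s(3) nth_mem] by (auto simp: initial_state_def)
          show "mem s4 (stamp a) l \<le> q + 1" for a l using 4 by blast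
        qed simp
        obtain t f where tf: "exec w1 P (initial_state ?xs) t f" "t \<le> T" "reg f 0 = answer q" using lcs[OF s(3)] by blast
        \<comment> \<open>\<open>Lit 0\<close> has size 1. Together with
          \<open>2 ^ w1 \<le> B\<close> this shows that the modulus \<open>2 ^ w1\<close> is itself
          a word.\<close>
        have "B < 2 ^ w" using w[of "Lit 0"] by (simp add: used_exprs_def)
        then have "(2::nat) ^ w1 < 2 ^ w" using B(7) by linarith
        then have "w1 < w" using power_strict_increasing_iff[of "2::nat" w1 w] by simp
        then have sim: "runs w (sim v_M v_now P) s4 (3 * T) (sim_rel w1 r v_now (vars s4) a0 f)"
          by (intro runs_weaken[OF sim_correct[OF tf(1) P(1) rel v4(2)]]) (use tf(2) in auto)
        show "runs w ?p4 s4 ?t4 ?Q"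
        proof (rule runs_Seq[OF sim], rule runs_SeqI, rule runs_Op)
          fix s5 assume 5: "sim_rel w1 r v_now (vars s4) a0 f s5"
          have ans: "sregs s5 0 = answer q" "answer q < 2 ^ w1" and vars5: "vars s5 = vars s4" and mem5: "mem s5 0 = a0"
            and st5: "\<And>a l. mem s5 (stamp a) l \<le> q + 1"
            using 5 P(2) tf(3) v4(1) by (auto simp: sim_rel_def)
          let ?s6 = "s5\<lparr>reg := (reg s5)(vreg v_res := apply_op w And (reg s5 (sreg 0)) (reg s5 (sreg 0)))\<rparr>"
          have vars6: "vars ?s6 = (vars s4)(v_res := answer q)" using ans vars5 by simp
          have good6: "good ?s6" using 4 mem5 ans(2) B(7) unfolding good_def vars6 by simp
          show "runs w ?p6 ?s6 ?t6 ?Q"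
          proof (rule runs_SeqI, rule assign[OF good6])
            let ?e = "IfLess (e_threshold k) (Var v_res) (Lit 1) (Var v_ans)"
            show "?e \<in> set (used_exprs k c)" by (simp add: used_exprs_def)
            have val: "val (vars ?s6) a0 ?e = (if lcs_threshold k n g X < answer q then 1 else vars s v_ans)"
              unfolding vars6 using v4 by (simp add: val_parameters)
            have "vars s v_ans \<le> B" using s(1) by (simp add: params_def good_def)
            then show "val (vars ?s6) a0 ?e \<le> B" unfolding val using B(1) by simp
            fix s7 assume 7: "vars s7 = (vars ?s6)(v_ans := val (vars ?s6) a0 ?e)" "sregs s7 = sregs ?s6"
              "mem s7 = mem ?s6" "good s7"
            have vars7: "vars s7 = (vars s4)(v_res := answer q,
                v_ans := (if lcs_threshold k n g X < answer q then 1 else vars s v_ans))"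
              using 7(1)[unfolded val, unfolded vars6] .
            show "runs w ?p7 s7 ?t7 ?Q"
            proof (rule assign[OF 7(4)])
              show "e_add (Var v_q) (Lit 1) \<in> set (used_exprs k c)" by (simp add: used_exprs_def)
              show "val (vars s7) a0 (e_add (Var v_q) (Lit 1)) \<le> B" unfolding vars7 using v4 s B(8) by simp
              fix s8 assume 8: "vars s8 = (vars s7)(v_q := val (vars s7) a0 (e_add (Var v_q) (Lit 1)))"
                "sregs s8 = sregs s7" "mem s8 = mem s7" "good s8"
              have vars8: "vars s8 = (vars s4)(v_res := answer q,
                  v_ans := (if lcs_threshold k n g X < answer q then 1 else vars s v_ans), v_q := q + 1)"
                using 8(1) unfolding vars7 using v4 by simp
              have "mem s8 = mem s5" using 7(3) 8(3) by simp
              then show "params s8 \<and> vars s8 v_q = q + 1 \<and> (\<forall>a l. mem s8 (stamp a) l \<le> q + 1) \<and>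
                vars s8 v_ans = (if lcs_threshold k n g X < answer q then 1 else vars s v_ans)"
                using 8(4) v4 st5 unfolding params_def vars8 by simp
            qed
          qed
        qed
      qed
    qed
  qed
qed

lemma rounds:
  assumes s: "params s" "vars s v_q = 0" "vars s v_ans = 0" and stamps: "\<And>a l. mem s (stamp a) l = 0"
  shows "runs w (While (Less (vreg v_q) (vreg v_total)) (round_program k r P)) s (total * (round_time k r N T + 1) + 1)
    (\<lambda>s'. vars s' v_ans = of_bool (\<exists>q<total. lcs_threshold k n g X < answer q))"
proof -
  define Inv where "Inv q s' \<longleftrightarrow> params s' \<and> vars s' v_q = q \<and> (\<forall>a l. mem s' (stamp a) l \<le> q) \<and>
      vars s' v_ans = of_bool (\<exists>q'<q. lcs_threshold k n g X < answer q')" for q s'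
  have "runs w (While (Less (vreg v_q) (vreg v_total)) (round_program k r P)) s (total * (round_time k r N T + 1) + 1) (Inv total)"
  proof (rule runs_While)
    show "Inv 0 s" using s stamps by (simp add: Inv_def)
    show "\<not> holds (Less (vreg v_q) (vreg v_total)) s'" if "Inv total s'" for s'
      using that by (simp add: Inv_def params_def)
    fix q s1 assume I: "Inv q s1" and q: "q < total"
    have "runs w (round_program k r P) s1 (round_time k r N T) (Inv (Suc q))"
    proof (rule runs_weaken[OF round])
      show "params s1" "vars s1 v_q = q" "mem s1 (stamp a) l \<le> q" for a l using I by (auto simp: Inv_def)
      have ans1: "vars s1 v_ans = of_bool (\<exists>q'<q. lcs_threshold k n g X < answer q')" using I by (simp add: Inv_def)
      have ex: "(\<exists>q'<Suc q. lcs_threshold k n g X < answer q') \<longleftrightarrow>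
          lcs_threshold k n g X < answer q \<or> (\<exists>q'<q. lcs_threshold k n g X < answer q')"
        by (auto simp: less_Suc_eq)
      show "Inv (Suc q) s2" if "params s2 \<and> vars s2 v_q = q + 1 \<and> (\<forall>a l. mem s2 (stamp a) l \<le> q + 1) \<and>
        vars s2 v_ans = (if lcs_threshold k n g X < answer q then 1 else vars s1 v_ans)" for s2
        using that unfolding Inv_def ex ans1 by simp
    qed (use q in simp_all)
    then show "holds (Less (vreg v_q) (vreg v_total)) s1 \<and> runs w (round_program k r P) s1 (round_time k r N T) (Inv (Suc q))"
      using I q by (simp add: Inv_def params_def)
  qed
  then show ?thesis by (rule runs_weaken) (simp_all add: Inv_def)
qed

lemma powers:
  assumes s: "good s" "vars s v_X = 1" "vars s v_i = 0" "vars s v_b = b"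
  shows "runs w (While (Less (vreg v_i) (vreg v_b))
        (Seq (Assign v_X (e_add (Var v_X) (Var v_X))) (Assign v_i (e_add (Var v_i) (Lit 1))))) s
     (b * (cost (e_add (Var v_X) (Var v_X)) + 1 + (cost (e_add (Var v_i) (Lit 1)) + 1) + 1) + 1)
     (\<lambda>s'. good s' \<and> vars s' = (vars s)(v_X := X, v_i := b) \<and> mem s' = mem s)"
proof -
  define Inv where "Inv i s' \<longleftrightarrow> good s' \<and> vars s' = (vars s)(v_X := 2 ^ i, v_i := i) \<and> mem s' = mem s" for i s'
  have "runs w (While (Less (vreg v_i) (vreg v_b))
        (Seq (Assign v_X (e_add (Var v_X) (Var v_X))) (Assign v_i (e_add (Var v_i) (Lit 1))))) s
     (b * (cost (e_add (Var v_X) (Var v_X)) + 1 + (cost (e_add (Var v_i) (Lit 1)) + 1) + 1) + 1) (Inv b)"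
  proof (rule runs_While)
    show "Inv 0 s" using s by (auto simp: Inv_def fun_eq_iff)
    show "\<not> holds (Less (vreg v_i) (vreg v_b)) s'" if "Inv b s'" for s' using that s by (simp add: Inv_def)
    fix i s1 assume I: "Inv i s1" and i: "i < b"
    then have good1: "good s1" and vars1: "vars s1 = (vars s)(v_X := 2 ^ i, v_i := i)" and mem1: "mem s1 = mem s"
      by (auto simp: Inv_def)
    have "(2::nat) ^ Suc i \<le> 2 ^ b" using i by (intro power_increasing) auto
    then have XB: "2 * 2 ^ i \<le> B" using B(5) X by simp
    have "runs w (Seq (Assign v_X (e_add (Var v_X) (Var v_X))) (Assign v_i (e_add (Var v_i) (Lit 1)))) s1
      (cost (e_add (Var v_X) (Var v_X)) + 1 + (cost (e_add (Var v_i) (Lit 1)) + 1)) (Inv (Suc i))"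
    proof (rule runs_SeqI, rule assign[OF good1])
      show "e_add (Var v_X) (Var v_X) \<in> set (used_exprs k c)" by (simp add: used_exprs_def)
      show "val (vars s1) a0 (e_add (Var v_X) (Var v_X)) \<le> B" unfolding vars1 using XB by simp
      fix s2 assume 2: "vars s2 = (vars s1)(v_X := val (vars s1) a0 (e_add (Var v_X) (Var v_X)))" "sregs s2 = sregs s1"
        "mem s2 = mem s1" "good s2"
      have vars2: "vars s2 = (vars s)(v_X := 2 ^ Suc i, v_i := i)" using 2(1) unfolding vars1 by auto
      show "runs w (Assign v_i (e_add (Var v_i) (Lit 1))) s2 (cost (e_add (Var v_i) (Lit 1)) + 1) (Inv (Suc i))"
      proof (rule assign[OF 2(4)])
        show "e_add (Var v_i) (Lit 1) \<in> set (used_exprs k c)" by (simp add: used_exprs_def)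
        show "val (vars s2) a0 (e_add (Var v_i) (Lit 1)) \<le> B" unfolding vars2 using i B(4) by simp
        fix s3 assume 3: "vars s3 = (vars s2)(v_i := val (vars s2) a0 (e_add (Var v_i) (Lit 1)))" "sregs s3 = sregs s2"
          "mem s3 = mem s2" "good s3"
        show "Inv (Suc i) s3" using 3(1,3,4) 2(3) mem1 unfolding vars2 by (auto simp: Inv_def)
      qed
    qed
    then show "holds (Less (vreg v_i) (vreg v_b)) s1 \<and>
        runs w (Seq (Assign v_X (e_add (Var v_X) (Var v_X))) (Assign v_i (e_add (Var v_i) (Lit 1)))) s1
      (cost (e_add (Var v_X) (Var v_X)) + 1 + (cost (e_add (Var v_i) (Lit 1)) + 1)) (Inv (Suc i))"
      using i s by (simp add: vars1)
  qed
  then show ?thesis by (rule runs_weaken) (auto simp: Inv_def X)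
qed

lemma N_pos: "0 < g \<Longrightarrow> 0 < N"
  using block_size_pos[of g X k] by (auto simp: N lcs_size_def X)

text \<open>After \<open>i\<close> doublings the value is \<open>2 ^ (i + 1)\<close>, which is at
  most \<open>N\<close> for \<open>i < floor_log N\<close> and exceeds \<open>N\<close> for
  \<open>i = floor_log N\<close>; hence the number of iterations.\<close>

lemma word:
  assumes g: "0 < g" and s: "good s" "vars s v_pow = 2" "vars s v_bound = N + 1"
  shows "runs w (While (Less (vreg v_pow) (vreg v_bound)) (Assign v_pow (e_add (Var v_pow) (Var v_pow)))) s
     (floor_log N * (cost (e_add (Var v_pow) (Var v_pow)) + 1 + 1) + 1)
     (\<lambda>s'. good s' \<and> vars s' = (vars s)(v_pow := 2 ^ (floor_log N + 1)) \<and> mem s' = mem s)"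
proof -
  define Inv where "Inv i s' \<longleftrightarrow> good s' \<and> vars s' = (vars s)(v_pow := 2 ^ (i + 1)) \<and> mem s' = mem s" for i s'
  have "runs w (While (Less (vreg v_pow) (vreg v_bound)) (Assign v_pow (e_add (Var v_pow) (Var v_pow)))) s
     (floor_log N * (cost (e_add (Var v_pow) (Var v_pow)) + 1 + 1) + 1) (Inv (floor_log N))"
  proof (rule runs_While)
    show "Inv 0 s" using s by (auto simp: Inv_def fun_eq_iff)
    have "N < 2 * 2 ^ floor_log N" using floor_log_exp2_gt[of N] by simp
    then show "\<not> holds (Less (vreg v_pow) (vreg v_bound)) s'" if "Inv (floor_log N) s'" for s'
      using that s by (simp add: Inv_def)
    fix i s1 assume I: "Inv i s1" and i: "i < floor_log N"
    then have good1: "good s1" and vars1: "vars s1 = (vars s)(v_pow := 2 ^ (i + 1))" and mem1: "mem s1 = mem s"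
      by (auto simp: Inv_def)
    have "(2::nat) ^ (i + 1) \<le> 2 ^ floor_log N" using i by (intro power_increasing) auto
    also have "\<dots> \<le> N" using floor_log_exp2_le[OF N_pos[OF g]] .
    finally have le: "(2::nat) ^ (i + 1) \<le> N" .
    have "runs w (Assign v_pow (e_add (Var v_pow) (Var v_pow))) s1 (cost (e_add (Var v_pow) (Var v_pow)) + 1) (Inv (Suc i))"
    proof (rule assign[OF good1])
      show "e_add (Var v_pow) (Var v_pow) \<in> set (used_exprs k c)" by (simp add: used_exprs_def)
      show "val (vars s1) a0 (e_add (Var v_pow) (Var v_pow)) \<le> B" unfolding vars1 using le B(6) by simp
      fix s2 assume 2: "vars s2 = (vars s1)(v_pow := val (vars s1) a0 (e_add (Var v_pow) (Var v_pow)))"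
        "sregs s2 = sregs s1" "mem s2 = mem s1" "good s2"
      show "Inv (Suc i) s2" using 2 mem1 unfolding vars1 by (auto simp: Inv_def)
    qed
    then show "holds (Less (vreg v_pow) (vreg v_bound)) s1 \<and>
        runs w (Assign v_pow (e_add (Var v_pow) (Var v_pow))) s1 (cost (e_add (Var v_pow) (Var v_pow)) + 1) (Inv (Suc i))"
      using le s by (simp add: vars1)
  qed
  then show ?thesis by (rule runs_weaken) (auto simp: Inv_def)
qed

lemma main:
  assumes g: "0 < g" and s: "good s" "vars s v_n = n" "vars s v_g = g" "vars s v_b = b" "vars s v_i = 0" "vars s v_q = 0" "vars s v_ans = 0"
    and stamps: "\<And>a l. mem s (stamp a) l = 0"
  shows "runs w (main_program k c r P) s (init_time k c b N (total * (round_time k r N T + 1) + 1))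
    (\<lambda>s'. vars s' v_ans = of_bool (\<exists>q<total. lcs_threshold k n g X < answer q))"
  unfolding main_program_def init_time_def
proof (rule runs_SeqI, rule assign[OF s(1)])
  let ?Q = "\<lambda>s'. vars s' v_ans = of_bool (\<exists>q<total. lcs_threshold k n g X < answer q)"
  let ?p8 = "While (Less (vreg v_q) (vreg v_total)) (round_program k r P)"
  let ?t8 = "total * (round_time k r N T + 1) + 1"
  let ?p7 = "Seq (Assign v_len (e_add (Lit 1) (e_mul (Lit k) (e_N k)))) ?p8"
  let ?t7 = "cost (e_add (Lit 1) (e_mul (Lit k) (e_N k))) + 1 + ?t8"
  let ?p6 = "Seq (Assign v_total (e_pow (e_s k) k)) ?p7"
  let ?t6 = "cost (e_pow (e_s k) k) + 1 + ?t7"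
  let ?p5 = "Seq (Assign v_M (e_pow (Var v_pow) c)) ?p6"
  let ?t5 = "cost (e_pow (Var v_pow) c) + 1 + ?t6"
  let ?p4 = "Seq (While (Less (vreg v_pow) (vreg v_bound)) (Assign v_pow (e_add (Var v_pow) (Var v_pow)))) ?p5"
  let ?t4 = "floor_log N * (cost (e_add (Var v_pow) (Var v_pow)) + 1 + 1) + 1 + ?t5"
  let ?p3 = "Seq (Assign v_pow (Lit 2)) ?p4"
  let ?t3 = "cost (Lit 2) + 1 + ?t4"
  let ?p2 = "Seq (Assign v_bound (e_add (e_N k) (Lit 1))) ?p3"
  let ?t2 = "cost (e_add (e_N k) (Lit 1)) + 1 + ?t3"
  let ?p1 = "Seq (While (Less (vreg v_i) (vreg v_b)) (Seq (Assign v_X (e_add (Var v_X) (Var v_X))) (Assign v_i (e_add (Var v_i) (Lit 1))))) ?p2"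
  let ?t1 = "b * (cost (e_add (Var v_X) (Var v_X)) + 1 + (cost (e_add (Var v_i) (Lit 1)) + 1) + 1) + 1 + ?t2"
  show "Lit 1 \<in> set (used_exprs k c)" by (simp add: used_exprs_def)
  show "val (vars s) a0 (Lit 1) \<le> B" using B(1) by simp
  fix s1 assume 1: "vars s1 = (vars s)(v_X := val (vars s) a0 (Lit 1))" "sregs s1 = sregs s" "mem s1 = mem s" "good s1"
  show "runs w ?p1 s1 ?t1 ?Q"
  proof (rule runs_Seq[OF powers[OF 1(4)]])
    show "vars s1 v_X = 1" "vars s1 v_i = 0" "vars s1 v_b = b" using 1 s by simp_all
    fix s2 assume 2: "good s2 \<and> vars s2 = (vars s1)(v_X := X, v_i := b) \<and> mem s2 = mem s1"
    have good2: "good s2" and v2: "vars s2 v_n = n" "vars s2 v_g = g" "vars s2 v_X = X" "vars s2 v_b = b"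
      "vars s2 v_q = 0" "vars s2 v_ans = 0" and mem2: "mem s2 = mem s"
      using 1 2 s by auto
    show "runs w ?p2 s2 ?t2 ?Q"
    proof (rule runs_SeqI, rule assign[OF good2])
      show "e_add (e_N k) (Lit 1) \<in> set (used_exprs k c)" by (simp add: used_exprs_def)
      have val: "val (vars s2) a0 (e_add (e_N k) (Lit 1)) = N + 1" using v2 by (simp add: val_parameters N)
      then show "val (vars s2) a0 (e_add (e_N k) (Lit 1)) \<le> B" using B(6) by simp
      fix s3 assume 3: "vars s3 = (vars s2)(v_bound := val (vars s2) a0 (e_add (e_N k) (Lit 1)))" "sregs s3 = sregs s2"
        "mem s3 = mem s2" "good s3"
      show "runs w ?p3 s3 ?t3 ?Q"
      proof (rule runs_SeqI, rule assign[OF 3(4)])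
        show "Lit 2 \<in> set (used_exprs k c)" by (simp add: used_exprs_def)
        show "val (vars s3) a0 (Lit 2) \<le> B" using B(1) by simp
        fix s4 assume 4: "vars s4 = (vars s3)(v_pow := val (vars s3) a0 (Lit 2))" "sregs s4 = sregs s3"
          "mem s4 = mem s3" "good s4"
        show "runs w ?p4 s4 ?t4 ?Q"
        proof (rule runs_Seq[OF word[OF g 4(4)]])
          show "vars s4 v_pow = 2" "vars s4 v_bound = N + 1" using 4(1) 3(1) val by simp_all
          fix s5 assume 5: "good s5 \<and> vars s5 = (vars s4)(v_pow := 2 ^ (floor_log N + 1)) \<and> mem s5 = mem s4"
          have good5: "good s5" and v5: "vars s5 v_n = n" "vars s5 v_g = g" "vars s5 v_X = X" "vars s5 v_b = b"
            "vars s5 v_q = 0" "vars s5 v_ans = 0" "vars s5 v_pow = 2 ^ (floor_log N + 1)" and mem5: "mem s5 = mem s"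
            using v2 3 4 5 mem2 by auto
          show "runs w ?p5 s5 ?t5 ?Q"
          proof (rule runs_SeqI, rule assign[OF good5])
            show "e_pow (Var v_pow) c \<in> set (used_exprs k c)" by (simp add: used_exprs_def)
            have valM: "val (vars s5) a0 (e_pow (Var v_pow) c) = 2 ^ w1"
              unfolding val_e_pow val.simps v5(7) w1 word_size_def power_mult[symmetric] by (simp add: mult.commute)
            then show "val (vars s5) a0 (e_pow (Var v_pow) c) \<le> B" using B(7) by simp
            fix s6 assume 6: "vars s6 = (vars s5)(v_M := val (vars s5) a0 (e_pow (Var v_pow) c))" "sregs s6 = sregs s5"
              "mem s6 = mem s5" "good s6"
            show "runs w ?p6 s6 ?t6 ?Q"
            proof (rule runs_SeqI, rule assign[OF 6(4)])
              show "e_pow (e_s k) k \<in> set (used_exprs k c)" by (simp add: used_exprs_def)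
              have valT: "val (vars s6) a0 (e_pow (e_s k) k) = total"
                using v5 6(1) by (simp add: val_parameters total)
              then show "val (vars s6) a0 (e_pow (e_s k) k) \<le> B" using B(8) by simp
              fix s7 assume 7: "vars s7 = (vars s6)(v_total := val (vars s6) a0 (e_pow (e_s k) k))" "sregs s7 = sregs s6"
                "mem s7 = mem s6" "good s7"
              show "runs w ?p7 s7 ?t7 ?Q"
              proof (rule runs_SeqI, rule assign[OF 7(4)])
                show "e_add (Lit 1) (e_mul (Lit k) (e_N k)) \<in> set (used_exprs k c)" by (simp add: used_exprs_def)
                have valL: "val (vars s7) a0 (e_add (Lit 1) (e_mul (Lit k) (e_N k))) = 1 + k * N"
                  using v5 6(1) 7(1) by (simp add: val_parameters N)
                then show "val (vars s7) a0 (e_add (Lit 1) (e_mul (Lit k) (e_N k))) \<le> B" using B(9) by (simp only:)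
                fix s8 assume 8: "vars s8 = (vars s7)(v_len := val (vars s7) a0 (e_add (Lit 1) (e_mul (Lit k) (e_N k))))"
                  "sregs s8 = sregs s7" "mem s8 = mem s7" "good s8"
                have vars8: "vars s8 = (vars s5)(v_M := 2 ^ w1, v_total := total, v_len := 1 + k * N)"
                  using 8(1) unfolding valL unfolding 7(1) valT unfolding 6(1) valM .
                show "runs w ?p8 s8 ?t8 ?Q"
                proof (rule rounds)
                  show "params s8" "vars s8 v_q = 0" "vars s8 v_ans = 0"
                    using 8(4) v5 unfolding params_def vars8 by simp_all
                  show "mem s8 (stamp a) l = 0" for a l using stamps 6(3) 7(3) 8(3) mem5 by simp
                qed
              qed
            qed
          qed
        qed
      qed
    qed
  qed
qed

lemma fov_correct:
  assumes s: "\<And>i. reg s i = 0" "mem s 0 = a0" "\<And>a l. a \<noteq> 0 \<Longrightarrow> mem s a l = 0"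
  shows "runs w (fov_program k c r P) s (fov_time k c r b N T total)
    (\<lambda>s'. reg s' 0 = (if g = 0 then n else of_bool (\<exists>q<total. lcs_threshold k n g X < answer q)))"
  unfolding fov_program_def fov_time_def
proof (rule runs_SeqI, rule assign)
  let ?A = "if g = 0 then n else of_bool (\<exists>q<total. lcs_threshold k n g X < answer q)"
  let ?Q = "\<lambda>s'. reg s' 0 = ?A"
  let ?t = "init_time k c b N (total * (round_time k r N T + 1) + 1)"
  let ?p3 = "Seq (If (Eq (vreg v_g) (vreg v_zero)) (Assign v_ans (Var v_n)) (main_program k c r P)) (Op And (sreg 0) (vreg v_ans) (vreg v_ans))"
  let ?t3 = "1 + ?t + 1"
  let ?p2 = "Seq (Assign v_b (Arr (Lit 2))) ?p3"
  let ?t2 = "cost (Arr (Lit 2)) + 1 + ?t3"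
  let ?p1 = "Seq (Assign v_g (Arr (Lit 1))) ?p2"
  let ?t1 = "cost (Arr (Lit 1)) + 1 + ?t2"
  have v: "vars s i = 0" for i using s(1) by (simp only: vars_def)
  show "good s" using v s(2) by (simp add: good_def)
  show "Arr (Lit 0) \<in> set (used_exprs k c)" by (simp add: used_exprs_def)
  show "val (vars s) a0 (Arr (Lit 0)) \<le> B" using a0(4) by simp
  fix s1 assume 1: "vars s1 = (vars s)(v_n := val (vars s) a0 (Arr (Lit 0)))" "mem s1 = mem s" "good s1"
  show "runs w ?p1 s1 ?t1 ?Q"
  proof (rule runs_SeqI, rule assign[OF 1(3)])
    show "Arr (Lit 1) \<in> set (used_exprs k c)" by (simp add: used_exprs_def)
    show "val (vars s1) a0 (Arr (Lit 1)) \<le> B" using a0(4) by simp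
    fix s2 assume 2: "vars s2 = (vars s1)(v_g := val (vars s1) a0 (Arr (Lit 1)))" "mem s2 = mem s1" "good s2"
    show "runs w ?p2 s2 ?t2 ?Q"
    proof (rule runs_SeqI, rule assign[OF 2(3)])
      show "Arr (Lit 2) \<in> set (used_exprs k c)" by (simp add: used_exprs_def)
      show "val (vars s2) a0 (Arr (Lit 2)) \<le> B" using a0(4) by simp
      fix s3 assume 3: "vars s3 = (vars s2)(v_b := val (vars s2) a0 (Arr (Lit 2)))" "mem s3 = mem s2" "good s3"
      have v3: "vars s3 v_n = n" "vars s3 v_g = g" "vars s3 v_b = b" "vars s3 v_i = 0" "vars s3 v_q = 0" "vars s3 v_ans = 0"
        "vars s3 v_zero = 0"
        using 1(1) 2(1) 3(1) v a0 by simp_all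
      have mem3: "mem s3 (stamp a) l = 0" for a l using 1(2) 2(2) 3(2) s(3)[of "stamp a" l] by simp
      have "runs w (If (Eq (vreg v_g) (vreg v_zero)) (Assign v_ans (Var v_n)) (main_program k c r P)) s3
        (1 + ?t)
        (\<lambda>s'. vars s' v_ans = ?A)"
      proof (rule runs_If)
        assume "holds (Eq (vreg v_g) (vreg v_zero)) s3"
        then have g: "g = 0" using v3 by simp
        have "runs w (Assign v_ans (Var v_n)) s3 (cost (Var v_n) + 1) (\<lambda>s'. vars s' v_ans = n)"
        proof (rule assign[OF 3(3)])
          show "Var v_n \<in> set (used_exprs k c)" by (simp add: used_exprs_def)
          show "val (vars s3) a0 (Var v_n) \<le> B" using v3 B(2) by simp
        qed (use v3 in simp)
        then show "runs w (Assign v_ans (Var v_n)) s3 ?t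
          (\<lambda>s'. vars s' v_ans = ?A)"
          by (rule runs_weaken) (simp_all add: init_time_def g)
      next
        assume "\<not> holds (Eq (vreg v_g) (vreg v_zero)) s3"
        then have g: "0 < g" using v3 by simp
        show "runs w (main_program k c r P) s3 ?t
          (\<lambda>s'. vars s' v_ans = ?A)"
          by (rule runs_weaken[OF main[OF g 3(3) v3(1-6) mem3]]) (use g in simp_all)
      qed
      then show "runs w ?p3 s3 ?t3 ?Q"
      proof (rule runs_Seq)
        fix s4 assume 4: "vars s4 v_ans = ?A"
        have "sreg 0 = 0" by (simp add: sreg_def)
        then show "runs w (Op And (sreg 0) (vreg v_ans) (vreg v_ans)) s4 1
          ?Q"
          using 4 by (intro runs_Op) (simp add: sreg_def)
      qed
    qed
  qed
qed

end

section \<open>Asymptotics\<close>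

lemma fov_time_le: "\<exists>K. \<forall>b N T tot. fov_time k c r b N T tot \<le> K * (1 + b + N + tot * (1 + N + T))"
proof -
  define A where "A = r + cost (e_add (Var v_q) (Lit 1)) + cost (Lit 0) +
     cost (IfLess (e_threshold k) (Var v_res) (Lit 1) (Var v_ans)) + cost (e_add (Var v_q) (Lit 1)) + 8"
  define F where "F = fill_time k + 1"
  define I where "I = cost (Lit 1) + cost (e_add (e_N k) (Lit 1)) + cost (Lit 2) + cost (e_pow (Var v_pow) c)
     + cost (e_pow (e_s k) k) + cost (e_add (Lit 1) (e_mul (Lit k) (e_N k)))
     + cost (Arr (Lit 0)) + cost (Arr (Lit 1)) + cost (Arr (Lit 2)) + 20"
  define D where "D = cost (e_add (Var v_X) (Var v_X)) + 1 + (cost (e_add (Var v_i) (Lit 1)) + 1) + 1"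
  define E where "E = cost (e_add (Var v_pow) (Var v_pow)) + 1 + 1"
  define K where "K = A + F + k * F + 3"
  define K' where "K' = I + D + E + K"
  have round: "round_time k r N T + 1 \<le> K * (1 + N + T)" for N T
  proof -
    have "round_time k r N T + 1 \<le> A + (1 + k * N) * F + 3 * T"
      by (simp add: round_time_def A_def F_def)
    also have "\<dots> \<le> K * (1 + N + T)" by (simp add: K_def algebra_simps)
    finally show ?thesis .
  qed
  have "fov_time k c r b N T tot \<le> K' * (1 + b + N + tot * (1 + N + T))" for b N T tot
  proof -
    have "fov_time k c r b N T tot \<le> I + b * D + floor_log N * E + tot * (round_time k r N T + 1)"
      by (simp add: fov_time_def init_time_def I_def D_def E_def)
    also have "\<dots> \<le> I + b * D + N * E + tot * (K * (1 + N + T))"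
    proof -
      have "floor_log N \<le> N"
      proof (cases "N = 0")
        case False
        then show ?thesis using floor_log_exp2_le[of N] less_exp[of "floor_log N"] by linarith
      qed simp
      then show ?thesis using round by (intro add_mono mult_mono) auto
    qed
    also have "\<dots> \<le> K' * (1 + b + N + tot * (1 + N + T))" by (simp add: K'_def algebra_simps)
    finally show ?thesis .
  qed
  then show ?thesis by blast
qed

text \<open>With \<open>L\<close> for the block size and \<open>m = n div L \<ge> 1\<close>, the
  estimate \<open>n < (m + 1) * L \<le> 2 * m * L\<close> shows that \<open>n / m\<close> rounded up
  is at most \<open>2 * L\<close>.\<close>

lemma pieces_le:
  assumes "block_size k g X \<le> n"
  shows "pieces k n g X \<le> 2 * block_size k g X"
proof (cases "block_size k g X = 0")
  case True
  then show ?thesis by (simp add: pieces_def per_block_def)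
next
  case False
  let ?L = "block_size k g X"
  define m where "m = n div ?L"
  have m: "per_block k n g X = m" using assms by (simp add: per_block_def lcs_size_def m_def)
  have m0: "0 < m" using assms False by (simp add: m_def div_greater_zero_iff)
  have "n < (m + 1) * ?L" using False unfolding m_def
    by (metis add.commute bot_nat_0.not_eq_extremum dividend_less_div_times mult.commute plus_1_eq_Suc mult_Suc)
  also have "\<dots> \<le> (2 * m) * ?L" using m0 by (intro mult_right_mono) auto
  finally have "n + (m - 1) \<le> 2 * ?L * m + (m - 1)" by (simp add: ac_simps)
  then have "(n + (m - 1)) div m \<le> (2 * ?L * m + (m - 1)) div m" by (rule div_le_mono)
  also have "\<dots> = 2 * ?L" using m0 by (subst div_mult_self3) auto
  finally show ?thesis by (simp add: pieces_def m)
qed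

text \<open>The block size is the value of an expression in \<open>g\<close> and \<open>X\<close>,
  so \<open>val_le\<close> gives a polynomial bound without expanding the definitions.\<close>

lemma block_size_le:
  "\<exists>S C. \<forall>g X D. g \<le> D \<longrightarrow> X \<le> D \<longrightarrow> C \<le> D \<longrightarrow> block_size k g X \<le> D ^ S"
proof (intro exI allI impI)
  fix g X D :: nat
  assume D: "g \<le> D" "X \<le> D" "2 + max_lit (e_block k) \<le> D"
  let ?\<rho> = "\<lambda>i. if i = v_g then g else if i = v_X then X else 0"
  have "val ?\<rho> (\<lambda>_. 0) (e_block k) \<le> D ^ expr_size (e_block k)"
    using D by (intro val_le) auto
  then show "block_size k g X \<le> D ^ expr_size (e_block k)" by (simp add: val_parameters)
qed

lemma smallo_ln:
  assumes "(\<lambda>n. real (g n)) \<in> o(\<lambda>n. log 2 (real n) / log 2 (log 2 (real n)))"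
  shows "(\<lambda>n. real (g n) / ln (real n)) \<longlonglongrightarrow> 0"
proof -
  have "(\<lambda>n. log 2 (real n) / log 2 (log 2 (real n))) \<in> O(\<lambda>n. ln (real n))"
  proof (rule bigoI)
    show "eventually (\<lambda>n. norm (log 2 (real n) / log 2 (log 2 (real n))) \<le> 1 / ln 2 * norm (ln (real n))) sequentially"
      \<comment> \<open>From 4 on the iterated logarithm is at least 1, so the quotient is at most
        the logarithm.\<close>
      using eventually_ge_at_top[of 4]
    proof eventually_elim
      case (elim n)
      have "log 2 4 \<le> log 2 (real n)" using elim by (subst log_le_cancel_iff) auto
      moreover have "log 2 4 = (2::real)" using log_pow_cancel[of 2 2] by simp
      ultimately have l: "2 \<le> log 2 (real n)" by simp
      then have "log 2 2 \<le> log 2 (log 2 (real n))" by (subst log_le_cancel_iff) auto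
      then have ll: "1 \<le> log 2 (log 2 (real n))" by simp
      have "log 2 (real n) / log 2 (log 2 (real n)) \<le> log 2 (real n) / 1"
        using l ll by (intro divide_left_mono) auto
      then show ?case using l ll elim by (simp add: log_def)
    qed
  qed
  from landau_o.small_big_trans[OF assms this] show ?thesis by (rule smalloD_tendsto)
qed

lemma smallo_log:
  assumes "(\<lambda>n. real (b n)) \<in> o(\<lambda>n. log 2 (real n))"
  shows "(\<lambda>n. real (b n) / ln (real n)) \<longlonglongrightarrow> 0"
proof -
  have "(\<lambda>n. log 2 (real n)) \<in> O(\<lambda>n. ln (real n))"
    by (rule bigoI[of _ "1 / ln 2"]) (simp add: log_def)
  from landau_o.small_big_trans[OF assms this] show ?thesis by (rule smalloD_tendsto)
qed

lemma inverse_ln_tendsto: "(\<lambda>n. (c::real) / ln (real n)) \<longlonglongrightarrow> 0"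
  by (rule tendsto_divide_0[OF tendsto_const])
    (intro filterlim_at_top_imp_at_infinity filterlim_compose[OF ln_at_top filterlim_real_sequentially])

lemma ln_params_tendsto:
  assumes g: "(\<lambda>n. real (g n) / ln (real n)) \<longlonglongrightarrow> 0" and b: "(\<lambda>n. real (b n) / ln (real n)) \<longlonglongrightarrow> 0"
  shows "(\<lambda>n. ln (real (g n + 2 ^ b n + C)) / ln (real n)) \<longlonglongrightarrow> 0"
proof (rule tendsto_sandwich)
  let ?u = "\<lambda>n. (ln (real C + 1) / ln (real n) + real (g n) / ln (real n)) + real (b n) / ln (real n)"
  show "(\<lambda>_. 0 :: real) \<longlonglongrightarrow> 0" by simp
  show "?u \<longlonglongrightarrow> 0"
    using tendsto_add[OF tendsto_add[OF inverse_ln_tendsto[of "ln (real C + 1)"] g] b] by simp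
  show "eventually (\<lambda>n. 0 \<le> ln (real (g n + 2 ^ b n + C)) / ln (real n)) sequentially"
    using eventually_ge_at_top[of 2]
  proof eventually_elim
    case (elim n)
    have "1 \<le> g n + 2 ^ b n + C" by (simp add: Suc_leI trans_le_add1 trans_le_add2)
    then have "1 \<le> real (g n + 2 ^ b n + C)" by linarith
    then show ?case using elim by (intro divide_nonneg_nonneg ln_ge_zero) auto
  qed
  show "eventually (\<lambda>n. ln (real (g n + 2 ^ b n + C)) / ln (real n) \<le> ?u n) sequentially"
    using eventually_ge_at_top[of 2]
  proof eventually_elim
    case (elim n)
    let ?g = "real (g n)" and ?X = "2 ^ b n :: real"
    have X1: "1 \<le> ?X" by simp
    \<comment> \<open>The sum is replaced by a product so that its logarithm splits into
      \<open>ln (C + 1)\<close>, \<open>ln (g + 1) \<le> g\<close> and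
      \<open>b * ln 2 \<le> b\<close>, all negligible against \<open>ln n\<close>.\<close>
    have "?g + ?X + real C \<le> (real C + 1) * (?g + 1) * ?X"
    proof -
      have "?g * 1 \<le> ?g * ?X" "real C * 1 \<le> real C * ?X" using X1 by (intro mult_left_mono; simp)+
      moreover have "0 \<le> real C * ?g * ?X" by simp
      moreover have "(real C + 1) * (?g + 1) * ?X = real C * ?g * ?X + real C * ?X + ?g * ?X + ?X"
        by (simp add: algebra_simps)
      ultimately show ?thesis by linarith
    qed
    then have "ln (real (g n + 2 ^ b n + C)) \<le> ln ((real C + 1) * (?g + 1) * ?X)"
      using X1 by (intro ln_mono) (auto simp: add_nonneg_pos add_pos_nonneg)
    also have "\<dots> = ln (real C + 1) + ln (?g + 1) + real (b n) * ln 2"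
      by (simp add: ln_mult ln_realpow)
    also have "\<dots> \<le> ln (real C + 1) + ?g + real (b n) * 1"
      using ln_add_one_self_le_self[of ?g] ln_2_less_1 by (intro add_mono mult_left_mono) (auto simp: add.commute)
    finally have "ln (real (g n + 2 ^ b n + C)) / ln (real n) \<le> (ln (real C + 1) + ?g + real (b n) * 1) / ln (real n)"
      using elim by (intro divide_right_mono) auto
    then show ?case by (simp add: add_divide_distrib)
  qed
qed

text \<open>The block size \<open>L\<close> is polynomial in the subpolynomial quantity
  \<open>D\<close>. The form \<open>(3 * L + 1) ^ k\<close> is chosen to dominate the number of
  block tuples, at most \<open>(2 * L) ^ k\<close>, and for positive \<open>k\<close> also
  \<open>L\<close>, while being at least 1.\<close>

lemma overhead_tendsto:
  assumes "(\<lambda>n. real (g n) / ln (real n)) \<longlonglongrightarrow> 0" "(\<lambda>n. real (b n) / ln (real n)) \<longlonglongrightarrow> 0"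
  shows "(\<lambda>n. ln (real ((3 * block_size k (g n) (2 ^ b n) + 1) ^ k)) / ln (real n)) \<longlonglongrightarrow> 0"
proof -
  obtain S C where SC: "\<And>g X D. g \<le> D \<Longrightarrow> X \<le> D \<Longrightarrow> C \<le> D \<Longrightarrow> block_size k g X \<le> D ^ S"
    using block_size_le[of k] by blast
  define D where "D n = g n + 2 ^ b n + C" for n
  have D1: "1 \<le> D n" for n by (simp add: D_def Suc_leI trans_le_add1 trans_le_add2)
  have lim: "(\<lambda>n. ln (real (D n)) / ln (real n)) \<longlonglongrightarrow> 0"
    unfolding D_def by (rule ln_params_tendsto[OF assms])
  let ?u = "\<lambda>n. real k * (ln 4 / ln (real n) + real S * (ln (real (D n)) / ln (real n)))"
  show ?thesis
  proof (rule tendsto_sandwich)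
    show "(\<lambda>_. 0 :: real) \<longlonglongrightarrow> 0" by simp
    have "?u \<longlonglongrightarrow> real k * (0 + real S * 0)"
      by (intro tendsto_intros inverse_ln_tendsto lim)
    then show "?u \<longlonglongrightarrow> 0" by simp
    show "eventually (\<lambda>n. 0 \<le> ln (real ((3 * block_size k (g n) (2 ^ b n) + 1) ^ k)) / ln (real n)) sequentially"
      using eventually_ge_at_top[of 2]
    proof eventually_elim
      case (elim n)
      have "1 \<le> real ((3 * block_size k (g n) (2 ^ b n) + 1) ^ k)"
        by (metis One_nat_def Suc_leI add_gr_0 less_one of_nat_1 of_nat_mono zero_less_power)
      then show ?case using elim by (intro divide_nonneg_nonneg ln_ge_zero) auto
    qed
    show "eventually (\<lambda>n. ln (real ((3 * block_size k (g n) (2 ^ b n) + 1) ^ k)) / ln (real n) \<le> ?u n) sequentially"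
      using eventually_ge_at_top[of 2]
    proof eventually_elim
      case (elim n)
      let ?L = "block_size k (g n) (2 ^ b n)"
      have "?L \<le> D n ^ S" by (rule SC) (auto simp: D_def)
      moreover have "1 \<le> D n ^ S" using D1 by simp
      ultimately have "3 * ?L + 1 \<le> 4 * D n ^ S" by linarith
      then have "real (3 * ?L + 1) \<le> real (4 * D n ^ S)" by (rule of_nat_mono)
      then have "ln (real (3 * ?L + 1)) \<le> ln (real (4 * D n ^ S))"
        using D1[of n] by (subst ln_le_cancel_iff) auto
      also have "\<dots> = ln 4 + real S * ln (real (D n))"
        using D1[of n] by (simp add: ln_mult ln_realpow)
      finally have "real k * ln (real (3 * ?L + 1)) \<le> real k * (ln 4 + real S * ln (real (D n)))"
        by (intro mult_left_mono) auto
      moreover have "ln (real ((3 * ?L + 1) ^ k)) = real k * ln (real (3 * ?L + 1))"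
        unfolding of_nat_power by (rule ln_realpow)
      ultimately have "ln (real ((3 * ?L + 1) ^ k)) / ln (real n) \<le> real k * (ln 4 + real S * ln (real (D n))) / ln (real n)"
        using elim by (intro divide_right_mono) auto
      then show ?case by (simp add: add_divide_distrib distrib_left)
    qed
  qed
qed

lemma eventually_le_of_ln:
  fixes f :: "nat \<Rightarrow> nat"
  assumes "(\<lambda>n. ln (real (f n)) / ln (real n)) \<longlonglongrightarrow> 0" "\<And>n. 1 \<le> f n"
  shows "eventually (\<lambda>n. f n \<le> n) sequentially"
proof -
  have "eventually (\<lambda>n. ln (real (f n)) / ln (real n) < 1) sequentially"
    using assms(1) by (rule order_tendstoD) simp
  then show ?thesis using eventually_ge_at_top[of 2]
  proof eventually_elim
    case (elim n)
    then have "ln (real (f n)) < ln (real n)" by (simp add: divide_less_eq)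
    then have "real (f n) < real n" using assms(2)[of n] elim by (subst (asm) ln_less_cancel_iff) auto
    then show ?case by simp
  qed
qed

section \<open>Words of \<open>O(log n)\<close> bits suffice\<close>

lemma ex_word_bound:
  fixes f :: "nat \<Rightarrow> nat"
  assumes "eventually (\<lambda>n. f n \<le> 2 * n) sequentially"
  shows "\<exists>c. \<forall>n. f n \<le> 2 ^ (c * (floor_log n + 1))"
proof -
  obtain n0 where n0: "\<And>n. n0 \<le> n \<Longrightarrow> f n \<le> 2 * n" using assms by (auto simp: eventually_sequentially)
  \<comment> \<open>The finitely many exceptions below \<open>n0\<close> are absorbed by the
    constant \<open>2 + M\<close> in the word size.\<close>
  define M where "M = (\<Sum>n<n0. f n)"
  have "f n \<le> 2 ^ ((2 + M) * (floor_log n + 1))" for n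
  proof (cases "n < n0")
    case True
    then have "f n \<le> M" unfolding M_def by (intro member_le_sum) auto
    also have "\<dots> \<le> 2 ^ M" using less_exp[of M] by simp
    also have "\<dots> \<le> 2 ^ ((2 + M) * (floor_log n + 1))" by (intro power_increasing) auto
    finally show ?thesis .
  next
    case False
    then have "f n \<le> 2 * n" using n0 by simp
    also have "\<dots> \<le> 2 * (2 * 2 ^ floor_log n)" using floor_log_exp2_gt[of n] by simp
    also have "\<dots> = 2 ^ (floor_log n + 2)" by simp
    also have "\<dots> \<le> 2 ^ ((2 + M) * (floor_log n + 1))" by (intro power_increasing) auto
    finally show ?thesis .
  qed
  then show ?thesis by blast
qed

text \<open>The quantities that \<open>B\<close> has to dominate are written as expressions, so that
  \<open>B\<close> can be the value of their sum and inherits a polynomial bound. The power of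
  \<open>2 * N + 2\<close> stands in for \<open>2 ^ word_size c N\<close>, which involves a
  logarithm; the last entry covers all literals.\<close>

definition bounded_exprs :: "nat \<Rightarrow> nat \<Rightarrow> expr list" where
  "bounded_exprs k c = [Var v_n, Var v_g, Var v_b, Var v_X, e_add (e_mul (Lit 2) (e_N k)) (Lit 1),
     e_pow (e_add (e_mul (Lit 2) (e_N k)) (Lit 2)) c, e_pow (e_s k) k, e_add (Lit 1) (e_mul (Lit k) (e_N k)),
     e_add (Lit 3) (e_mul (Lit k) (e_mul (Var v_n) (e_mul (Var v_g) (Var v_X)))),
     Lit (\<Sum>e\<leftarrow>used_exprs k c. max_lit e)]"

definition bound_expr :: "nat \<Rightarrow> nat \<Rightarrow> expr" where
  "bound_expr k c = foldr e_add (bounded_exprs k c) (Lit 2)"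

lemma val_foldr_add: "val \<rho> a (foldr e_add es e) = (\<Sum>x\<leftarrow>es. val \<rho> a x) + val \<rho> a e"
  by (induction es) auto

text \<open>
  All variables of the program stay below \<open>B\<close>, so the intermediate results of an expression stay below a
  power of \<open>B\<close> that depends on the expression only. As \<open>B\<close> is itself the value of an expression in \<open>n\<close>, \<open>g\<close>, \<open>b\<close>
  and \<open>2\<^sup>b\<close>, words of \<open>O(log n)\<close> bits never overflow.
\<close>

lemma reduction_bounds:
  assumes D: "n \<le> D" "g \<le> D" "2 ^ b \<le> D" "2 + max_lit (bound_expr k c) \<le> D"
    and k: "1 \<le> k" and X: "X = 2 ^ b"
    and W: "D ^ (expr_size (bound_expr k c) * (\<Sum>e\<leftarrow>used_exprs k c. expr_size e)) < 2 ^ w"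
  obtains B where "2 \<le> B" "n \<le> B" "g \<le> B" "b \<le> B" "X \<le> B" "2 * lcs_size k n g X + 1 \<le> B"
    "2 ^ word_size c (lcs_size k n g X) \<le> B" "pieces k n g X ^ k \<le> B" "1 + k * lcs_size k n g X \<le> B"
    "3 + k * n * g * X \<le> B" "B < 2 ^ w"
    "\<And>e. e \<in> set (used_exprs k c) \<Longrightarrow> max_lit e \<le> B \<and> B ^ expr_size e < 2 ^ w"
proof -
  define \<rho> where "\<rho> i = (if i = v_n then n else if i = v_g then g else if i = v_b then b else if i = v_X then X else 0)" for i
  have \<rho>: "\<rho> v_n = n" "\<rho> (Suc 0) = g" "\<rho> v_b = b" "\<rho> v_X = X" by (simp_all add: \<rho>_def)
  \<comment> \<open>The expressions that make up \<open>bound_expr\<close> do not read the input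
    array, hence the dummy \<open>\<lambda>_. 0\<close>.\<close>
  define B where "B = val \<rho> (\<lambda>_. 0) (bound_expr k c)"
  have "b < 2 ^ b" by (rule less_exp)
  then have bD: "b \<le> D" using D(3) by linarith
  have BD: "B \<le> D ^ expr_size (bound_expr k c)"
    unfolding B_def using D bD X by (intro val_le) (auto simp: \<rho>_def)
  have B: "val \<rho> (\<lambda>_. 0) e \<le> B" if "e \<in> set (bounded_exprs k c)" for e
  proof -
    have "val \<rho> (\<lambda>_. 0) e \<le> (\<Sum>x\<leftarrow>bounded_exprs k c. val \<rho> (\<lambda>_. 0) x)"
      using that by (intro member_le_sum_list) auto
    then show ?thesis by (simp add: B_def bound_expr_def val_foldr_add)
  qed
  have B2: "2 \<le> B" by (simp add: B_def bound_expr_def val_foldr_add)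
  have small: "B ^ i < 2 ^ w" if "i \<le> (\<Sum>e\<leftarrow>used_exprs k c. expr_size e)" for i
  proof -
    have "B ^ i \<le> B ^ (\<Sum>e\<leftarrow>used_exprs k c. expr_size e)" using that B2 by (intro power_increasing) auto
    also have "\<dots> \<le> (D ^ expr_size (bound_expr k c)) ^ (\<Sum>e\<leftarrow>used_exprs k c. expr_size e)"
      using BD by (rule power_mono) simp
    also have "\<dots> < 2 ^ w" using W by (simp add: power_mult)
    finally show ?thesis .
  qed
  let ?N = "lcs_size k n g X"
  show ?thesis
  proof (rule that[of B])
    show "2 \<le> B" by (rule B2)
    show "n \<le> B" "g \<le> B" "b \<le> B" "X \<le> B"
      using B[of "Var v_n"] B[of "Var v_g"] B[of "Var v_b"] B[of "Var v_X"] by (simp_all add: bounded_exprs_def \<rho>)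
    show "2 * ?N + 1 \<le> B"
      using B[of "e_add (e_mul (Lit 2) (e_N k)) (Lit 1)"] by (simp add: bounded_exprs_def val_parameters \<rho>)
    show "pieces k n g X ^ k \<le> B"
      using B[of "e_pow (e_s k) k"] by (simp add: bounded_exprs_def val_parameters \<rho>)
    show "1 + k * ?N \<le> B"
      using B[of "e_add (Lit 1) (e_mul (Lit k) (e_N k))"] by (simp add: bounded_exprs_def val_parameters \<rho>)
    show "3 + k * n * g * X \<le> B"
      using B[of "e_add (Lit 3) (e_mul (Lit k) (e_mul (Var v_n) (e_mul (Var v_g) (Var v_X))))"]
      by (simp add: bounded_exprs_def \<rho> mult.assoc)
    have "2 ^ word_size c ?N \<le> (2 * ?N + 2) ^ c"
    proof -
      have "2 ^ (floor_log ?N + 1) \<le> 2 * ?N + 2"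
        using floor_log_exp2_le[of ?N] by (cases "?N = 0") auto
      then have "(2 ^ (floor_log ?N + 1)) ^ c \<le> (2 * ?N + 2) ^ c" by (rule power_mono) simp
      then show ?thesis unfolding word_size_def power_mult[symmetric] by (simp add: mult.commute)
    qed
    also have "\<dots> \<le> B"
      using B[of "e_pow (e_add (e_mul (Lit 2) (e_N k)) (Lit 2)) c"] by (simp add: bounded_exprs_def val_parameters \<rho>)
    finally show "2 ^ word_size c ?N \<le> B" .
    have "1 \<le> (\<Sum>e\<leftarrow>used_exprs k c. expr_size e)" by (simp add: used_exprs_def)
    then show "B < 2 ^ w" using small[of 1] by simp
    fix e assume e: "e \<in> set (used_exprs k c)"
    have "max_lit e \<le> (\<Sum>e\<leftarrow>used_exprs k c. max_lit e)" using e by (intro member_le_sum_list) auto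
    also have "\<dots> \<le> B" using B[of "Lit (\<Sum>e\<leftarrow>used_exprs k c. max_lit e)"] by (simp add: bounded_exprs_def)
    finally show "max_lit e \<le> B \<and> B ^ expr_size e < 2 ^ w"
      using e by (intro conjI small member_le_sum_list) auto
  qed
qed

section \<open>Assembling the reduction\<close>

lemma lcs_input_in_k_LCS:
  assumes "2 \<le> k" "0 < g" "0 < X"
  shows "(lcs_input k n g X a q, lcs_length (lcs_strings k n g X a q)) \<in> k_LCS k (4 * k) (lcs_size k n g X)"
  unfolding k_LCS_def lcs_input_def using letter_less[OF assms]
  by (auto simp: lcs_strings_def intro!: exI[of _ "lcs_strings k n g X a q"])

lemma fov_program_correct:
  fixes n g b :: nat
  assumes k: "2 \<le> k" and P: "regs_below P r" "0 < r"
    and lcs: "\<And>n xs y. (xs, y) \<in> k_LCS k (4 * k) n \<Longrightarrow> (\<forall>x\<in>set xs. x < 2 ^ word_size c n) \<and>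
       (\<exists>t s. exec (word_size c n) P (initial_state xs) t s \<and> t \<le> T n \<and> reg s 0 = y)"
    and Vs: "length Vs = k" "\<forall>V\<in>set Vs. length V = n \<and> distinct V \<and> set V \<subseteq> factored_vectors g b"
    and D: "n \<le> D" "g \<le> D" "2 ^ b \<le> D" "2 + max_lit (bound_expr k c) \<le> D"
    and W: "D ^ (expr_size (bound_expr k c) * (\<Sum>e\<leftarrow>used_exprs k c. expr_size e)) < 2 ^ w"
    and xs: "xs = n # g # b # concat (map (encode_factored_vector b) (concat Vs))"
    and N_eq: "N = lcs_size k n g (2 ^ b)"
  shows "(\<forall>x\<in>set xs. x < 2 ^ w) \<and> length xs \<le> 2 ^ w \<and>
    (\<exists>t s. exec w (fov_program k c r P) (initial_state xs) t s \<and>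
       t \<le> fov_time k c r b N (T N) (pieces k n g (2 ^ b) ^ k) \<and>
       reg s 0 = of_bool (FOV_yes k g b (\<lambda>j. set (Vs ! j))))"
proof -
  define X where "X = (2::nat) ^ b"
  define a0 where "a0 = (\<lambda>i. if i < length xs then xs ! i else 0)"
  define answer where "answer q = lcs_length (lcs_strings k n g X a0 q)" for q
  define tot where "tot = pieces k n g X ^ k"
  obtain B where Bd: "2 \<le> B" "n \<le> B" "g \<le> B" "b \<le> B" "X \<le> B" "2 * lcs_size k n g X + 1 \<le> B"
    "2 ^ word_size c (lcs_size k n g X) \<le> B" "tot \<le> B" "1 + k * lcs_size k n g X \<le> B"
    "3 + k * n * g * X \<le> B" "B < 2 ^ w"
    "\<And>e. e \<in> set (used_exprs k c) \<Longrightarrow> max_lit e \<le> B \<and> B ^ expr_size e < 2 ^ w"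
    using reduction_bounds[OF D _ X_def W] k unfolding tot_def by (metis One_nat_def Suc_1 Suc_leD)
  have Vs': "\<forall>V\<in>set Vs. length V = n \<and> set V \<subseteq> factored_vectors g b" using Vs by blast
  have bit: "x \<le> 1" if "x \<in> set (concat (map (encode_factored_vector b) (concat Vs)))" for x
    using that by (auto simp: encode_factored_vector_def encode_set_def)
  have xB: "x \<le> B" if "x \<in> set xs" for x
  proof -
    consider "x = n" | "x = g" | "x = b" | "x \<in> set (concat (map (encode_factored_vector b) (concat Vs)))"
      using \<open>x \<in> set xs\<close> unfolding xs list.set insert_iff by blast
    then show ?thesis using Bd(1-4) bit[of x] by cases linarith+
  qed
  have len: "length xs = 3 + k * n * g * X"
  proof -
    have "length (concat Vs) = k * n" using length_concat_uniform[of Vs n] Vs by auto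
    moreover have "length (encode_factored_vector b v) = g * X" if "v \<in> set (concat Vs)" for v
    proof -
      have "length v = g" using that Vs by (auto simp: factored_vectors_def)
      then show ?thesis unfolding encode_factored_vector_def X_def
        by (subst length_concat_uniform[where l = "2 ^ b"]) (auto simp: length_encode_set)
    qed
    ultimately have "length (concat (map (encode_factored_vector b) (concat Vs))) = k * n * (g * X)"
      by (subst length_concat_uniform[where l = "g * X"]) auto
    then show ?thesis by (simp add: xs mult.assoc)
  qed
  \<comment> \<open>For \<open>g = 0\<close> the block size is 0, and division by zero makes
    \<open>per_block\<close> and \<open>pieces\<close> vanish too. So there are no rounds, and the
    conditions of the locale on rounds hold vacuously.\<close>
  have tot0: "tot = 0" if "g = 0"
  proof -
    have "block_size k g X = 0"
      using that by (simp add: block_size_def slot_length_def low_def inner_high_def gadget_length_def)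
    then have "pieces k n g X = 0" by (simp add: pieces_def per_block_def)
    then show ?thesis using k by (simp add: tot_def)
  qed
  interpret reduction k c r n g b X B w "word_size c (lcs_size k n g X)" "T (lcs_size k n g X)" "lcs_size k n g X"
    tot P a0 answer
  proof
    show "a0 0 = n" "a0 1 = g" "a0 2 = b" by (simp_all add: a0_def xs)
    show "a0 i \<le> B" for i using xB[OF nth_mem] by (auto simp: a0_def)
    fix q assume q: "q < tot"
    then have "0 < g" using tot0 by (cases "g = 0") auto
    then have mem: "(lcs_input k n g X a0 q, answer q) \<in> k_LCS k (4 * k) (lcs_size k n g X)"
      unfolding answer_def by (intro lcs_input_in_k_LCS k) (simp_all add: X_def)
    show "x < 2 ^ word_size c (lcs_size k n g X)" if "x \<in> set (lcs_input k n g X a0 q)" for x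
      using lcs[OF mem] that by blast
    show "\<exists>t s. exec (word_size c (lcs_size k n g X)) P (initial_state (lcs_input k n g X a0 q)) t s \<and>
        t \<le> T (lcs_size k n g X) \<and> reg s 0 = answer q"
      using lcs[OF mem] by blast
  qed (use k P Bd in \<open>simp_all add: X_def tot_def\<close>)
  have yes: "(if g = 0 then n else of_bool (\<exists>q<tot. lcs_threshold k n g X < answer q))
      = of_bool (FOV_yes k g b (\<lambda>j. set (Vs ! j)))"
  proof (cases "g = 0")
    case True
    have one: "V \<in> set Vs \<Longrightarrow> set V \<subseteq> {[]}" for V
      using Vs True by (auto simp: factored_vectors_def)
    have "Vs ! 0 \<in> set Vs" using k Vs by simp
    then have "length (Vs ! 0) = n" "distinct (Vs ! 0)" "set (Vs ! 0) \<subseteq> {[]}" using Vs one by auto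
    then have n1: "n \<le> 1" using card_mono[of "{[]}" "set (Vs ! 0)"] distinct_card[of "Vs ! 0"] by simp
    have "FOV_yes k g b (\<lambda>j. set (Vs ! j)) \<longleftrightarrow> n \<noteq> 0"
    proof (cases "n = 0")
      case True
      then have "set (Vs ! 0) = {}" using \<open>length (Vs ! 0) = n\<close> by simp
      then show ?thesis using True k unfolding FOV_yes_def by (metis empty_iff less_le_trans zero_less_numeral)
    next
      case False
      have "Vs ! j ! 0 \<in> set (Vs ! j)" if "j < k" for j
        using Vs that False by (metis neq0_conv nth_mem)
      then show ?thesis using True False unfolding FOV_yes_def
        by (auto intro!: exI[of _ "\<lambda>j. Vs ! j ! 0"])
    qed
    then show ?thesis using True n1 by (cases "n = 0") auto
  next
    case False
    then show ?thesis
      using FOV_yes_iff_lcs[OF k _ Vs(1) Vs' xs a0_def X_def] by (simp add: tot_def answer_def)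
  qed
  have "runs w (fov_program k c r P) (initial_state xs)
     (fov_time k c r b (lcs_size k n g X) (T (lcs_size k n g X)) tot)
     (\<lambda>s. reg s 0 = (if g = 0 then n else of_bool (\<exists>q<tot. lcs_threshold k n g X < answer q)))"
    by (rule fov_correct) (auto simp: initial_state_def a0_def fun_eq_iff)
  then have "\<exists>t s. exec w (fov_program k c r P) (initial_state xs) t s \<and>
       t \<le> fov_time k c r b N (T N) tot \<and> reg s 0 = of_bool (FOV_yes k g b (\<lambda>j. set (Vs ! j)))"
    unfolding runs_def yes unfolding N_eq X_def .
  moreover have "\<forall>x\<in>set xs. x < 2 ^ w" using xB Bd(11) le_less_trans by blast
  moreover have "length xs \<le> 2 ^ w" using len Bd(10,11) by linarith
  ultimately show ?thesis unfolding tot_def X_def by blast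
qed

lemma fov_time_soft_O:
  assumes k: "2 \<le> k" and g: "(\<lambda>n. real (g n) / ln (real n)) \<longlonglongrightarrow> 0" and b: "(\<lambda>n. real (b n) / ln (real n)) \<longlonglongrightarrow> 0"
    and T: "\<And>n. n \<le> T n"
  shows "(\<lambda>n. fov_time k c r (b n) (lcs_size k n (g n) (2 ^ b n)) (T (lcs_size k n (g n) (2 ^ b n)))
     (pieces k n (g n) (2 ^ b n) ^ k)) \<in> soft_O T"
proof -
  define L where "L n = block_size k (g n) (2 ^ b n)" for n
  define Y where "Y n = (3 * L n + 1) ^ k" for n
  \<comment> \<open>For \<open>n \<ge> 2\<close> this exponent makes \<open>n powr e n\<close> equal
    to \<open>Y n\<close>.\<close>
  define e where "e n = ln (real (Y n)) / ln (real n)" for n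
  let ?t = "\<lambda>n. fov_time k c r (b n) (lcs_size k n (g n) (2 ^ b n)) (T (lcs_size k n (g n) (2 ^ b n)))
     (pieces k n (g n) (2 ^ b n) ^ k)"
  have e0: "e \<longlonglongrightarrow> 0" unfolding e_def[abs_def] Y_def L_def by (rule overhead_tendsto[OF g b])
  have Y1: "1 \<le> Y n" for n by (simp add: Y_def)
  have ev_Y: "eventually (\<lambda>n. Y n \<le> n) sequentially"
    by (rule eventually_le_of_ln[OF e0[unfolded e_def[abs_def]] Y1])
  have ev_b: "eventually (\<lambda>n. b n \<le> n) sequentially"
  proof -
    have "eventually (\<lambda>n. real (b n) / ln (real n) < 1) sequentially"
      using b by (rule order_tendstoD) simp
    then show ?thesis using eventually_ge_at_top[of 2]
    proof eventually_elim
      case (elim n)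
      then have "real (b n) < ln (real n)" by (simp add: divide_less_eq)
      also have "\<dots> \<le> real n" using elim ln_le_minus_one[of "real n"] by simp
      finally show ?case by simp
    qed
  qed
  obtain K where K: "\<And>b N T tot. fov_time k c r b N T tot \<le> K * (1 + b + N + tot * (1 + N + T))"
    using fov_time_le by blast
  have "(\<lambda>n. real (?t n)) \<in> O(\<lambda>n. real (T n) * real n powr e n)"
  proof (rule bigoI)
    show "eventually (\<lambda>n. norm (real (?t n)) \<le> real (6 * K) * norm (real (T n) * real n powr e n)) sequentially"
      using ev_Y ev_b eventually_ge_at_top[of 2]
    proof eventually_elim
      case (elim n)
      have LY: "3 * L n + 1 \<le> Y n"
      proof -
        have "(3 * L n + 1) ^ 1 \<le> (3 * L n + 1) ^ k" using k by (intro power_increasing) auto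
        then show ?thesis by (simp add: Y_def)
      qed
      \<comment> \<open>A single gadget slot range fits into \<open>n\<close> letters from here on,
        so the strings have length exactly \<open>n\<close> and \<open>T\<close> is evaluated at
        \<open>n\<close> itself.\<close>
      then have Ln: "L n \<le> n" using elim by linarith
      then have N: "lcs_size k n (g n) (2 ^ b n) = n" by (simp add: lcs_size_def L_def)
      let ?tot = "pieces k n (g n) (2 ^ b n) ^ k"
      have tot: "?tot \<le> Y n"
      proof -
        have "pieces k n (g n) (2 ^ b n) \<le> 3 * L n + 1"
          using pieces_le[of k "g n" "2 ^ b n" n] Ln unfolding L_def by linarith
        then show ?thesis unfolding Y_def by (rule power_mono) simp
      qed
      have "?t n \<le> K * (1 + b n + n + ?tot * (1 + n + T n))" unfolding N by (rule K)
      \<comment> \<open>Each of \<open>1\<close>, \<open>b n\<close> and \<open>n\<close> is at most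
        \<open>n\<close> and hence at most \<open>T n\<close>. Here the cost of writing the strings
        is absorbed.\<close>
      also have "\<dots> \<le> K * (3 * T n * Y n + Y n * (3 * T n))"
      proof -
        have "1 + b n + n \<le> 3 * T n * 1" using T[of n] elim by linarith
        also have "\<dots> \<le> 3 * T n * Y n" using Y1[of n] by (intro mult_left_mono) auto
        finally have "1 + b n + n \<le> 3 * T n * Y n" .
        moreover have "?tot * (1 + n + T n) \<le> Y n * (3 * T n)"
          using T[of n] elim by (intro mult_mono tot) auto
        ultimately show ?thesis by (intro mult_left_mono add_mono) auto
      qed
      also have "\<dots> = 6 * K * (T n * Y n)" by (simp add: algebra_simps)
      finally have "real (?t n) \<le> real (6 * K * (T n * Y n))" by (rule of_nat_mono)
      moreover have "real n powr e n = real (Y n)"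
        using elim Y1[of n] by (simp add: powr_def e_def)
      ultimately show ?case by simp
    qed
  qed
  then show ?thesis unfolding soft_O_def using e0 by blast
qed

theorem theorem1p16:
  shows "\<exists>C :: nat. \<forall>k \<ge> 2. \<forall>g b :: nat \<Rightarrow> nat.
    (\<lambda>n. real (g n)) \<in> o(\<lambda>n. log 2 (real n) / log 2 (log 2 (real n))) \<longrightarrow>
    (\<lambda>n. real (b n)) \<in> o(\<lambda>n. log 2 (real n)) \<longrightarrow>
    (\<forall>T. solvable_in_time (k_LCS k (C * k)) T \<longrightarrow>
      (\<exists>t \<in> soft_O T. solvable_in_time (Fk_OV k g b) t))"
proof (intro exI[of _ 4] allI impI)
  fix k :: nat and g b T :: "nat \<Rightarrow> nat"
  assume k: "2 \<le> k"
    and go: "(\<lambda>n. real (g n)) \<in> o(\<lambda>n. log 2 (real n) / log 2 (log 2 (real n)))"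
    and bo: "(\<lambda>n. real (b n)) \<in> o(\<lambda>n. log 2 (real n))"
    and "solvable_in_time (k_LCS k (4 * k)) T"
  then obtain P c where Pc: "\<forall>n. \<forall>(xs, y)\<in>k_LCS k (4 * k) n. (\<forall>x\<in>set xs. x < 2 ^ word_size c n) \<and>
       length xs \<le> 2 ^ word_size c n \<and>
       (\<exists>t s. exec (word_size c n) P (initial_state xs) t s \<and> t \<le> T n \<and> reg s 0 = y)"
    unfolding solvable_in_time_def by (elim exE) (rule that)
  have P: "(\<forall>x\<in>set xs. x < 2 ^ word_size c n) \<and>
       (\<exists>t s. exec (word_size c n) P (initial_state xs) t s \<and> t \<le> T n \<and> reg s 0 = y)"
    if "(xs, y) \<in> k_LCS k (4 * k) n" for n xs y
    using bspec[OF spec[OF Pc, of n] that] by simp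
  note g = smallo_ln[OF go] and b = smallo_log[OF bo]
  have T: "n \<le> T n" for n
    by (rule k_LCS_time_lower_bound[OF k, of "4 * k" n "word_size c n" P]) (use k P in auto)
  obtain r where r: "0 < r" "regs_below P r" using ex_regs_below by blast
  define C where "C = 2 + max_lit (bound_expr k c)"
  \<comment> \<open>\<open>D n\<close> dominates \<open>n\<close>, \<open>g n\<close>,
    \<open>2 ^ b n\<close> and the literals, yet it is at most \<open>2 * n\<close> for large
    \<open>n\<close>, so each fixed power of it fits into words of \<open>O(log n)\<close>
    bits.\<close>
  define D where "D n = n + (g n + 2 ^ b n + C)" for n
  have "eventually (\<lambda>n. g n + 2 ^ b n + C \<le> n) sequentially"
    by (rule eventually_le_of_ln[OF ln_params_tendsto[OF g b]]) (simp add: C_def)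
  then have "eventually (\<lambda>n. D n \<le> 2 * n) sequentially" by eventually_elim (simp add: D_def)
  from ex_word_bound[OF this] obtain d where d: "\<And>n. D n \<le> 2 ^ (d * (floor_log n + 1))" by blast
  define S where "S = expr_size (bound_expr k c) * (\<Sum>e\<leftarrow>used_exprs k c. expr_size e)"
  \<comment> \<open>The factor \<open>d * S\<close> accommodates \<open>D n ^ S\<close>; the
    additional 1 makes the inequality strict.\<close>
  define c' where "c' = d * S + 1"
  have W: "D n ^ S < 2 ^ word_size c' n" for n
  proof -
    have "D n ^ S \<le> (2 ^ (d * (floor_log n + 1))) ^ S" by (rule power_mono[OF d]) simp
    also have "\<dots> = 2 ^ (d * S * (floor_log n + 1))" by (simp add: power_mult[symmetric] algebra_simps)
    also have "\<dots> < 2 ^ word_size c' n"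
      by (rule power_strict_increasing) (simp_all add: word_size_def c'_def)
    finally show ?thesis .
  qed
  define t where "t n = fov_time k c r (b n) (lcs_size k n (g n) (2 ^ b n)) (T (lcs_size k n (g n) (2 ^ b n)))
     (pieces k n (g n) (2 ^ b n) ^ k)" for n
  show "\<exists>t\<in>soft_O T. solvable_in_time (Fk_OV k g b) t"
  proof (rule bexI)
    show "t \<in> soft_O T" unfolding t_def[abs_def] by (rule fov_time_soft_O[OF k g b T])
    show "solvable_in_time (Fk_OV k g b) t"
      unfolding solvable_in_time_def
    proof (intro exI allI ballI, clarify)
      fix n xs y assume "(xs, y) \<in> Fk_OV k g b n"
      then obtain Vs where Vs: "length Vs = k"
        "\<forall>V\<in>set Vs. length V = n \<and> distinct V \<and> set V \<subseteq> factored_vectors (g n) (b n)"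
        and xs: "xs = n # g n # b n # concat (map (encode_factored_vector (b n)) (concat Vs))"
        and y: "y = of_bool (FOV_yes k (g n) (b n) (\<lambda>j. set (Vs ! j)))"
        unfolding Fk_OV_def by blast
      show "(\<forall>x\<in>set xs. x < 2 ^ word_size c' n) \<and> length xs \<le> 2 ^ word_size c' n \<and>
        (\<exists>ta s. exec (word_size c' n) (fov_program k c r P) (initial_state xs) ta s \<and> ta \<le> t n \<and> reg s 0 = y)"
        unfolding t_def y
        by (rule fov_program_correct[OF k r(2,1) P Vs _ _ _ _ W[of n, unfolded S_def] xs refl])
          (simp_all add: D_def C_def)
    qed
  qed
qed

end
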